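(* Let $G$ be an infinite, connected, locally finite graph which is transient, vertex-transitive and amenable. Then for every $u>0$, \[ \mathbb P_u[\mathcal I\text{ is connected}]=\mathbb P_u[\hat{\mathcal I}\text{ is connected}]=1. \]
   Context: $G=(V,E)$; simple random walk on $G$ is transient. Vertex-transitive: for any $x,y\in V$ there is a graph automorphism mapping $x$ to $y$. Amenable: $\kappa_V(G)=\inf\{|\partial_VK|/|K|:0<|K|<\infty\}=0$, where $\partial_VK$ is the set of vertices outside $K$ adjacent to $K$. Random interlacements: with $P_x$ the law of simple random walk from $x$, $\tilde H_K=\inf\{n\ge1:X_n\in K\}$, $e_K(x)=1_{\{x\in K\}}d_xP_x[\tilde H_K=\infty]$ ($d_x$ the degree), $W$ the set of doubly infinite nearest-neighbour paths $\mathbb Z\to V$ visiting each vertex finitely often, $W^*$ its quotient by time shift with projection $\pi^*$, $W^*_K$ the classes hitting $K$: $\nu$ is the unique $\sigma$-finite measure on $W^*$ with $1_{W^*_K}\nu=\pi^*\circ Q_K$ for all finite $K$, where $Q_K[(X_{-n})_{n\ge0}\in A,X_0=x,(X_n)_{n\ge0}\in B]=P_x[A\mid\tilde H_K=\infty]e_K(x)P_x[B]$. Under $\mathbb P_u$, $\omega$ is a Poisson point process on $W^*$ with intensity $u\nu$. $\mathcal I$ is the union of the ranges of the trajectories in the support of $\omega$, and $\mathcal I$ is connected if the subgraph it induces is connected. $\hat{\mathcal I}$ is the set of edges $\{w(k),w(k+1)\}$, $k\in\mathbb Z$, over all $w$ with $\pi^*(w)$ in the support of $\omega$; $\hat{\mathcal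 I}$ is connected if the graph formed by these edges and their endpoints is connected. *)

theory Defs
  imports "HOL-Probability.Probability"
begin

text \<open>The graph G = (V,E) has vertex set UNIV of type 'v and a symmetric,
irreflexive adjacency relation E (simple graph).\<close>

definition simple_graph :: "('v \<Rightarrow> 'v \<Rightarrow> bool) \<Rightarrow> bool" where
  "simple_graph E \<longleftrightarrow> (\<forall>x y. E x y \<longrightarrow> E y x) \<and> (\<forall>x. \<not> E x x)"

definition deg :: "('v \<Rightarrow> 'v \<Rightarrow> bool) \<Rightarrow> 'v \<Rightarrow> nat" where
  "deg E x = card {y. E x y}"

definition locally_finite :: "('v \<Rightarrow> 'v \<Rightarrow> bool) \<Rightarrow> bool" where
  "locally_finite E \<longleftrightarrow> (\<forall>x. finite {y. E x y})"

definition graph_connected :: "('v \<Rightarrow> 'v \<Rightarrow> bool) \<Rightarrow> bool" where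
  "graph_connected E \<longleftrightarrow> (\<forall>x y. E\<^sup>*\<^sup>* x y)"

definition vertex_transitive :: "('v \<Rightarrow> 'v \<Rightarrow> bool) \<Rightarrow> bool" where
  "vertex_transitive E \<longleftrightarrow>
     (\<forall>x y. \<exists>f. bij f \<and> (\<forall>a b. E a b \<longleftrightarrow> E (f a) (f b)) \<and> f x = y)"

definition vertex_boundary :: "('v \<Rightarrow> 'v \<Rightarrow> bool) \<Rightarrow> 'v set \<Rightarrow> 'v set" where
  "vertex_boundary E K = {y. y \<notin> K \<and> (\<exists>x\<in>K. E x y)}"

definition amenable :: "('v \<Rightarrow> 'v \<Rightarrow> bool) \<Rightarrow> bool" where
  "amenable E \<longleftrightarrow>
     (INF K \<in> {K. finite K \<and> K \<noteq> {}}. real (card (vertex_boundary E K)) / real (card K)) = 0"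

definition path_M :: "(nat \<Rightarrow> 'v) measure" where
  "path_M = PiM UNIV (\<lambda>_. count_space UNIV)"

definition dpath_M :: "(int \<Rightarrow> 'v) measure" where
  "dpath_M = PiM UNIV (\<lambda>_. count_space UNIV)"

definition srw_weight :: "('v \<Rightarrow> 'v \<Rightarrow> bool) \<Rightarrow> 'v \<Rightarrow> nat \<Rightarrow> (nat \<Rightarrow> 'v) \<Rightarrow> real" where
  "srw_weight E x n p =
     (if p 0 = x \<and> (\<forall>i<n. E (p i) (p (Suc i)))
      then (\<Prod>i<n. 1 / real (deg E (p i))) else 0)"

text \<open>P is the law of simple random walk started at x: a probability measure on
path space with the correct cylinder probabilities (this determines P uniquely).\<close>
definition is_srw_law :: "('v \<Rightarrow> 'v \<Rightarrow> bool) \<Rightarrow> 'v \<Rightarrow> (nat \<Rightarrow> 'v) measure \<Rightarrow> bool" where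
  "is_srw_law E x P \<longleftrightarrow> sets P = sets path_M \<and> prob_space P \<and>
     (\<forall>n p. emeasure P {\<omega> \<in> space path_M. \<forall>i\<le>n. \<omega> i = p i}
              = ennreal (srw_weight E x n p))"

definition srw :: "('v \<Rightarrow> 'v \<Rightarrow> bool) \<Rightarrow> 'v \<Rightarrow> (nat \<Rightarrow> 'v) measure" where
  "srw E x = (THE P. is_srw_law E x P)"

definition transient :: "('v \<Rightarrow> 'v \<Rightarrow> bool) \<Rightarrow> bool" where
  "transient E \<longleftrightarrow> (\<forall>x. AE \<omega> in srw E x. finite {n. \<omega> n = x})"

definition escape :: "'v set \<Rightarrow> (nat \<Rightarrow> 'v) set" where
  "escape K = {\<omega> \<in> space path_M. \<forall>n\<ge>1. \<omega> n \<notin> K}"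

definition equilibrium :: "('v \<Rightarrow> 'v \<Rightarrow> bool) \<Rightarrow> 'v set \<Rightarrow> 'v \<Rightarrow> real" where
  "equilibrium E K x =
     indicator K x * real (deg E x) * measure (srw E x) (escape K)"

definition Wpaths :: "('v \<Rightarrow> 'v \<Rightarrow> bool) \<Rightarrow> (int \<Rightarrow> 'v) set" where
  "Wpaths E = {w. (\<forall>n. E (w n) (w (n + 1))) \<and> (\<forall>x. finite {n. w n = x})}"

definition pistar :: "(int \<Rightarrow> 'v) \<Rightarrow> (int \<Rightarrow> 'v) set" where
  "pistar w = {(\<lambda>n. w (n + k)) | k. True}"

definition Wstar :: "('v \<Rightarrow> 'v \<Rightarrow> bool) \<Rightarrow> (int \<Rightarrow> 'v) set set" where
  "Wstar E = pistar ` Wpaths E"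

definition Wstar_M :: "('v \<Rightarrow> 'v \<Rightarrow> bool) \<Rightarrow> (int \<Rightarrow> 'v) set measure" where
  "Wstar_M E = measure_of (Wstar E)
     {A. A \<subseteq> Wstar E \<and> pistar -` A \<inter> Wpaths E \<in> sets dpath_M} (\<lambda>_. 0)"

definition WstarK :: "('v \<Rightarrow> 'v \<Rightarrow> bool) \<Rightarrow> 'v set \<Rightarrow> (int \<Rightarrow> 'v) set set" where
  "WstarK E K = {c \<in> Wstar E. \<exists>w\<in>c. \<exists>n. w n \<in> K}"

definition is_QK :: "('v \<Rightarrow> 'v \<Rightarrow> bool) \<Rightarrow> 'v set \<Rightarrow> (int \<Rightarrow> 'v) measure \<Rightarrow> bool" where
  "is_QK E K Q \<longleftrightarrow> sets Q = sets dpath_M \<and>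
     (\<forall>A \<in> sets path_M. \<forall>B \<in> sets path_M. \<forall>x.
        emeasure Q {w \<in> space dpath_M. (\<lambda>n. w (- int n)) \<in> A \<and> w 0 = x \<and> (\<lambda>n. w (int n)) \<in> B}
        = ennreal (measure (srw E x) (A \<inter> escape K) / measure (srw E x) (escape K)
                   * equilibrium E K x * measure (srw E x) B))"

text \<open>The random interlacement intensity measure nu: a sigma-finite measure on W* with
  1_{W*_K} nu = pistar \<circ> Q_K for every finite K (unique by Sznitman/Teixeira).\<close>
definition is_interlacement_intensity ::
    "('v \<Rightarrow> 'v \<Rightarrow> bool) \<Rightarrow> (int \<Rightarrow> 'v) set measure \<Rightarrow> bool" where
  "is_interlacement_intensity E \<nu> \<longleftrightarrow> sets \<nu> = sets (Wstar_M E) \<and> sigma_finite_measure \<nu> \<and>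
     (\<forall>K. finite K \<longrightarrow> (\<exists>Q. is_QK E K Q \<and>
        (\<forall>A \<in> sets (Wstar_M E).
           emeasure \<nu> (A \<inter> WstarK E K) = emeasure Q (pistar -` A \<inter> Wpaths E))))"

text \<open>A random point configuration is given by multiplicities eta \<omega> c \<in> nat of each
point c; its counting measure is N \<omega> A = sum of multiplicities over A.\<close>
definition count_pp :: "('a \<Rightarrow> nat) \<Rightarrow> 'a set \<Rightarrow> ennreal" where
  "count_pp \<eta> A = (\<integral>\<^sup>+ c. ennreal (real (\<eta> c)) \<partial>count_space A)"

definition is_PPP :: "'w measure \<Rightarrow> 'a measure \<Rightarrow> ('w \<Rightarrow> 'a \<Rightarrow> nat) \<Rightarrow> bool" where
  "is_PPP P \<mu> \<eta> \<longleftrightarrow> prob_space P \<and>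
     (\<forall>\<omega> \<in> space P. {c. \<eta> \<omega> c > 0} \<subseteq> space \<mu>) \<and>
     (\<forall>A \<in> sets \<mu>. (\<lambda>\<omega>. count_pp (\<eta> \<omega>) A) \<in> borel_measurable P) \<and>
     (\<forall>A \<in> sets \<mu>. emeasure \<mu> A < \<infinity> \<longrightarrow> (\<forall>k::nat.
        measure P {\<omega> \<in> space P. count_pp (\<eta> \<omega>) A = of_nat k}
          = (measure \<mu> A) ^ k / fact k * exp (- measure \<mu> A))) \<and>
     (\<forall>A \<in> sets \<mu>. emeasure \<mu> A = \<infinity> \<longrightarrow> (AE \<omega> in P. count_pp (\<eta> \<omega>) A = \<infinity>)) \<and>
     (\<forall>I (F :: nat \<Rightarrow> 'a set). finite I \<longrightarrow> F ` I \<subseteq> sets \<mu> \<longrightarrow> disjoint_family_on F I \<longrightarrow>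
        prob_space.indep_vars P (\<lambda>_. borel) (\<lambda>i \<omega>. count_pp (\<eta> \<omega>) (F i)) I)"

definition interlacement :: "((int \<Rightarrow> 'v) set \<Rightarrow> nat) \<Rightarrow> 'v set" where
  "interlacement \<eta> = \<Union> {range w | w c. \<eta> c > 0 \<and> w \<in> c}"

definition interlacement_edges :: "((int \<Rightarrow> 'v) set \<Rightarrow> nat) \<Rightarrow> 'v set set" where
  "interlacement_edges \<eta> = {{w k, w (k + 1)} | w c k. \<eta> c > 0 \<and> w \<in> c}"

definition induced_connected :: "('v \<Rightarrow> 'v \<Rightarrow> bool) \<Rightarrow> 'v set \<Rightarrow> bool" where
  "induced_connected E S \<longleftrightarrow>
     (\<forall>x\<in>S. \<forall>y\<in>S. (\<lambda>a b. E a b \<and> a \<in> S \<and> b \<in> S)\<^sup>*\<^sup>* x y)"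

definition edges_connected :: "'v set set \<Rightarrow> bool" where
  "edges_connected F \<longleftrightarrow>
     (\<forall>x\<in>\<Union>F. \<forall>y\<in>\<Union>F. (\<lambda>a b. {a, b} \<in> F)\<^sup>*\<^sup>* x y)"

end

theory Submission
  imports Defs
begin

text \<open>
It suffices to treat the edge set, since a connected edge set induces a connected vertex set. The
edge set is viewed as a bond percolation. Its avoidance probabilities are
$\exp(-u\,\nu(\mbox{trajectories using an edge of } L))$, which makes its law invariant under
automorphisms; as the Green function vanishes at infinity, the law is also mixing under a suitable
sequence of automorphisms, so invariant events have probability 0 or 1.

The edge set is insertion tolerant: for adjacent $x,y$, the trajectories through $x$ that follow their
first visit to $x$ by a step to $y$ and back have the law of arbitrary trajectories through $x$ with a loop
inserted, up to the factor $d^{-2}$. Comparing Poisson probabilities, opening the edge $xy$ on the event that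
$x$ is visited leads to a law that is absolutely continuous with respect to the original one.

These three properties, amenability and the fact that all clusters are infinite allow the argument of Burton
and Keane: if three clusters met with positive probability, insertion of all edges of a ball would produce a
positive density of trifurcation balls, whereas disjoint trifurcation balls inside a finite set are at most as
many as its boundary points. So there are at most two clusters, and two clusters
could be merged with positive probability, whence the 0-1 law gives connectedness.
\<close>

section \<open>Counting trifurcations\<close>

text \<open>The obstacle is insertion: trajectories are infinite, so no edge can be opened at an
  unvisited vertex, and edges are far from independent. A loop x, y, x added to a trajectory at x
  changes its edge set by xy at most and costs two steps of the walk, each of probability 1/d; hence
  the factor d^{-2}. On the event that exactly k > 0 trajectories visit x, all k of them receive the
  loop. The Poisson probabilities of having these k trajectories and using no edge of L then differ
  by d^{-2k} only, because the same total mass stands in both exponents. As this factor does not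
  depend on L, the two laws of the edge set are proportional, and summing null events over k loses
  nothing. Since insertion needs a visited endpoint, a ball is filled edge by edge, starting from a
  visited vertex in it. This is why trifurcations are balls with all inner edges open rather than
  single vertices. The intensity measure is only evaluated on trajectories that visit a given finite
  set, where it is expressed by two walks from a common point; invariance and decay of correlations
  thereby become statements about simple random walk.\<close>

definition off :: "('v \<Rightarrow> 'v \<Rightarrow> bool) \<Rightarrow> 'v set \<Rightarrow> 'v \<Rightarrow> 'v \<Rightarrow> bool" where
  "off R B a b \<longleftrightarrow> R a b \<and> a \<notin> B \<and> b \<notin> B"

definition inside :: "('v \<Rightarrow> 'v \<Rightarrow> bool) \<Rightarrow> 'v set \<Rightarrow> 'v \<Rightarrow> 'v \<Rightarrow> bool" where
  "inside R B a b \<longleftrightarrow> R a b \<and> a \<in> B \<and> b \<in> B"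

lemma rtranclp_symI:
  assumes "\<And>a b. R a b \<Longrightarrow> R b a" "R^** a b" shows "R^** b a"
  using assms by (metis sympI symp_rtranclp sympD)

text \<open>Only steps between vertices reachable from \<open>a\<close> have to be translated, and
  all of these satisfy \<open>P\<close>.\<close>

lemma rtranclp_confined:
  assumes "Q^** a b" and "\<And>v. Q^** a v \<Longrightarrow> P v" and "\<And>v w. Q v w \<Longrightarrow> P v \<Longrightarrow> P w \<Longrightarrow> Q' v w"
  shows "Q'^** a b"
  using assms(1)
proof (induction rule: rtranclp_induct)
  case (step y z)
  then have "Q' y z" using assms(2,3) by (meson rtranclp.rtrancl_into_rtrancl)
  with step show ?case by simp
qed simp

lemma off_sym: "(\<And>a b. R a b \<Longrightarrow> R b a) \<Longrightarrow> off R B a b \<Longrightarrow> off R B b a"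
  by (auto simp: off_def)

lemma inside_off:
  assumes "(inside R B)^** a b" "B \<inter> C = {}" shows "(off R C)^** a b"
  using assms(1)
  by (rule rtranclp_mono[THEN predicate2D, rotated]) (use assms(2) in \<open>auto simp: inside_def off_def\<close>)

text \<open>In place of the partition lemma of Burton and Keane: a trifurcation is charged to
  a boundary point that is minimal in its branch but larger than points of two other branches.\<close>

definition charged :: "('v \<Rightarrow> 'v \<Rightarrow> bool) \<Rightarrow> 'v set \<Rightarrow> ('v \<Rightarrow> nat) \<Rightarrow> 'v set \<Rightarrow> 'v \<Rightarrow> bool" where
  "charged R X g B x \<longleftrightarrow> x \<in> X \<and>
     (\<exists>a. \<exists>b\<in>B. R a b \<and> (off R B)^** x a) \<and>
     (\<forall>z\<in>X. (off R B)^** x z \<longrightarrow> g x \<le> g z) \<and>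
     (\<exists>y1\<in>X. \<exists>y2\<in>X. g y1 < g x \<and> g y2 < g x \<and> \<not> (off R B)^** y1 y2 \<and>
        (\<exists>a. \<exists>b\<in>B. R a b \<and> (off R B)^** y1 a) \<and> (\<exists>a. \<exists>b\<in>B. R a b \<and> (off R B)^** y2 a))"

text \<open>A branch that never enters \<open>C\<close> survives the deletion of \<open>C\<close>,
  and so does its last step into \<open>B\<close>, as \<open>B\<close> and \<open>C\<close> are
  disjoint.\<close>

lemma charged_reach:
  assumes adj: "R a b" "b \<in> B" "(off R B)^** x a" and avoid: "\<And>v. (off R B)^** x v \<Longrightarrow> v \<notin> C"
    and disj: "B \<inter> C = {}"
  shows "(off R C)^** x b"
proof -
  have "(off R C)^** x a"
    by (rule rtranclp_confined[OF adj(3), where P="\<lambda>v. v \<notin> C"]) (use avoid in \<open>auto simp: off_def\<close>)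
  moreover have "off R C a b" using adj avoid[OF adj(3)] disj by (auto simp: off_def)
  ultimately show ?thesis by simp
qed

text \<open>A smaller witness for \<open>C\<close> whose branch off \<open>C\<close> misses
  \<open>B\<close> would be joined to \<open>x\<close> off \<open>B\<close>, by way of
  \<open>C\<close> and \<open>c\<close>, against the minimality of \<open>x\<close> in its branch.
  So both witnesses reach the connected set \<open>B\<close> off \<open>C\<close>, which joins them
  although \<open>C\<close> should separate them.\<close>

lemma charged_unique_aux:
  assumes sym: "\<And>a b. R a b \<Longrightarrow> R b a"
    and B: "\<And>b b'. b \<in> B \<Longrightarrow> b' \<in> B \<Longrightarrow> (inside R B)^** b b'"
    and C: "\<And>b b'. b \<in> C \<Longrightarrow> b' \<in> C \<Longrightarrow> (inside R C)^** b b'"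
    and disj: "B \<inter> C = {}"
    and chB: "charged R X g B x" and chC: "charged R X g C x"
    and meet: "(off R B)^** x c" "c \<in> C"
  shows False
proof -
  have symB: "(off R B)^** v u" if "(off R B)^** u v" for u v
    by (rule rtranclp_symI[OF off_sym[OF sym] that])
  have symC: "(off R C)^** v u" if "(off R C)^** u v" for u v
    by (rule rtranclp_symI[OF off_sym[OF sym] that])
  have key: False if y: "y \<in> X" "g y < g x" "R a b" "b \<in> C" "(off R C)^** y a"
      "\<And>v. (off R C)^** y v \<Longrightarrow> v \<notin> B" for y a b
  proof -
    have "(off R B)^** y b" using charged_reach[OF y(3-6)] disj by blast
    moreover have "(off R B)^** b c" using inside_off[OF C[OF y(4) meet(2)]] disj by blast
    ultimately have "(off R B)^** x y" using meet(1) symB by (meson rtranclp_trans)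
    with chB y(1,2) show False unfolding charged_def by fastforce
  qed
  from chC obtain y1 y2 a1 a2 b1 b2 where y: "y1 \<in> X" "y2 \<in> X" "g y1 < g x" "g y2 < g x"
     "\<not> (off R C)^** y1 y2" "R a1 b1" "b1 \<in> C" "(off R C)^** y1 a1" "R a2 b2" "b2 \<in> C" "(off R C)^** y2 a2"
    unfolding charged_def by blast
  obtain v1 where v1: "(off R C)^** y1 v1" "v1 \<in> B" using key[OF y(1,3,6,7,8)] by blast
  obtain v2 where v2: "(off R C)^** y2 v2" "v2 \<in> B" using key[OF y(2,4,9,10,11)] by blast
  have "(off R C)^** v1 v2" using inside_off[OF B[OF v1(2) v2(2)] disj] .
  with v1 v2 y(5) symC show False by (meson rtranclp_trans)
qed

text \<open>If the branch of \<open>x\<close> off \<open>B\<close> misses \<open>C\<close>, then it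
  leads to \<open>B\<close> off \<open>C\<close>. Hence the preceding lemma applies to the two sets
  in one order or the other.\<close>

lemma charged_unique:
  assumes sym: "\<And>a b. R a b \<Longrightarrow> R b a"
    and B: "\<And>b b'. b \<in> B \<Longrightarrow> b' \<in> B \<Longrightarrow> (inside R B)^** b b'"
    and C: "\<And>b b'. b \<in> C \<Longrightarrow> b' \<in> C \<Longrightarrow> (inside R C)^** b b'"
    and disj: "B \<inter> C = {}"
    and chB: "charged R X g B x" and chC: "charged R X g C x"
  shows False
proof (cases "\<exists>c\<in>C. (off R B)^** x c")
  case True
  then show False using charged_unique_aux[OF sym B C disj chB chC] by blast
next
  case False
  from chB obtain a b where "b \<in> B" "R a b" "(off R B)^** x a" unfolding charged_def by blast
  then have "(off R C)^** x b" using False charged_reach[of R a b B x C] disj by blast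
  then show False using charged_unique_aux[OF sym C B _ chC chB] \<open>b \<in> B\<close> disj by blast
qed

text \<open>Finite stand-in for three infinite branches: each has to reach \<open>X\<close>, which
  will be the outer boundary of a finite region.\<close>

definition trifurcates :: "('v \<Rightarrow> 'v \<Rightarrow> bool) \<Rightarrow> 'v set \<Rightarrow> 'v set \<Rightarrow> bool" where
  "trifurcates R X B \<longleftrightarrow> (\<exists>a. (\<forall>i<3::nat. (\<exists>b\<in>B. R (a i) b) \<and> (\<exists>x\<in>X. (off R B)^** (a i) x)) \<and>
     (\<forall>i<3. \<forall>j<3. i \<noteq> j \<longrightarrow> \<not> (off R B)^** (a i) (a j)))"

text \<open>Take the \<open>g\<close>-least point of \<open>X\<close> in each of the three branches.
  The largest of these minima is charged, and the other two are its smaller witnesses.\<close>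

lemma trifurcates_charged:
  fixes R :: "'v \<Rightarrow> 'v \<Rightarrow> bool"
  assumes sym: "\<And>a b. R a b \<Longrightarrow> R b a" and g: "inj_on g X" and tri: "trifurcates R X B"
  shows "\<exists>x. charged R X (g :: 'v \<Rightarrow> nat) B x"
proof -
  let ?c = "(off R B)^**"
  have symB: "?c v u" if "?c u v" for u v
    by (rule rtranclp_symI[OF off_sym[OF sym] that])
  obtain a :: "nat \<Rightarrow> 'v" where a: "\<forall>i<3. (\<exists>b\<in>B. R (a i) b) \<and> (\<exists>x\<in>X. ?c (a i) x)"
     "\<forall>i<3. \<forall>j<3. i \<noteq> j \<longrightarrow> \<not> ?c (a i) (a j)"
    using tri unfolding trifurcates_def by (elim exE conjE)
  note a = a[rule_format]
  have "\<exists>m. m \<in> X \<and> ?c (a i) m \<and> (\<forall>z\<in>X. ?c (a i) z \<longrightarrow> g m \<le> g z)" if "i < 3" for i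
  proof -
    from a(1)[OF that] have "\<exists>m. m \<in> X \<and> ?c (a i) m" by blast
    from ex_has_least_nat[of "\<lambda>m. m \<in> X \<and> ?c (a i) m" _ g] this show ?thesis by blast
  qed
  then obtain m where m: "\<And>i. i<3 \<Longrightarrow> m i \<in> X" "\<And>i. i<3 \<Longrightarrow> ?c (a i) (m i)"
      "\<And>i z. i<3 \<Longrightarrow> z \<in> X \<Longrightarrow> ?c (a i) z \<Longrightarrow> g (m i) \<le> g z" by metis
  have sep: "\<not> ?c (m i) (m j)" if "i < 3" "j < 3" "i \<noteq> j" for i j
  proof
    assume "?c (m i) (m j)"
    then have "?c (a i) (m j)" using m(2)[OF that(1)] by (rule rtranclp_trans[rotated])
    then have "?c (a i) (a j)" using symB[OF m(2)[OF that(2)]] by (rule rtranclp_trans)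
    then show False using a(2)[OF that] by contradiction
  qed
  have link: "\<exists>u. \<exists>b\<in>B. R u b \<and> ?c (m l) u" if "l < 3" for l
    using a(1)[OF that] symB[OF m(2)[OF that]] by blast
  have ch: "charged R X g B (m i)"
    if i: "i < 3" "j < 3" "k < 3" "j \<noteq> k" "g (m j) < g (m i)" "g (m k) < g (m i)" for i j k
  proof -
    have "g (m i) \<le> g z" if "z \<in> X" "?c (m i) z" for z
      using rtranclp_trans[OF m(2)[OF i(1)] that(2)] m(3)[OF i(1) that(1)] by simp
    moreover have "\<exists>y1\<in>X. \<exists>y2\<in>X. g y1 < g (m i) \<and> g y2 < g (m i) \<and> \<not> ?c y1 y2 \<and>
        (\<exists>a. \<exists>b\<in>B. R a b \<and> ?c y1 a) \<and> (\<exists>a. \<exists>b\<in>B. R a b \<and> ?c y2 a)"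
      by (rule bexI[OF bexI[OF _ m(1)[OF i(3)]] m(1)[OF i(2)]])
        (intro conjI i(5,6) sep[OF i(2,3,4)] link[OF i(2)] link[OF i(3)])
    ultimately show ?thesis unfolding charged_def using m(1)[OF i(1)] link[OF i(1)] by simp
  qed
  have ne: "g (m i) \<noteq> g (m j)" if "i < 3" "j < 3" "i \<noteq> j" for i j
    using sep[OF that] inj_onD[OF g _ m(1)[OF that(1)] m(1)[OF that(2)]] by fastforce
  have n: "0 < (3::nat)" "1 < (3::nat)" "2 < (3::nat)" by auto
  consider "g (m 1) < g (m 0)" "g (m 2) < g (m 0)" | "g (m 0) < g (m 1)" "g (m 2) < g (m 1)"
     | "g (m 0) < g (m 2)" "g (m 1) < g (m 2)"
    using ne[OF n(1,2)] ne[OF n(1,3)] ne[OF n(2,3)] by linarith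
  then show ?thesis
  proof cases
    case 1 show ?thesis by (rule exI, rule ch[OF n(1,2,3) _ 1]) simp
  next
    case 2 show ?thesis by (rule exI, rule ch[OF n(2,1,3) _ 2]) simp
  next
    case 3 show ?thesis by (rule exI, rule ch[OF n(3,1,2) _ 3]) simp
  qed
qed

text \<open>Choosing a charged point for every set is injective by \<open>charged_unique\<close>;
  \<open>g\<close> is an arbitrary enumeration of \<open>X\<close>.\<close>

lemma card_trifurcations_le:
  assumes sym: "\<And>a b. R a b \<Longrightarrow> R b a" and X: "finite X"
    and conn: "\<And>B b b'. B \<in> \<B> \<Longrightarrow> b \<in> B \<Longrightarrow> b' \<in> B \<Longrightarrow> (inside R B)^** b b'"
    and disj: "\<And>B C. B \<in> \<B> \<Longrightarrow> C \<in> \<B> \<Longrightarrow> B \<noteq> C \<Longrightarrow> B \<inter> C = {}"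
    and tri: "\<And>B. B \<in> \<B> \<Longrightarrow> trifurcates R X B"
  shows "card \<B> \<le> card X"
proof -
  obtain g :: "'a \<Rightarrow> nat" where g: "inj_on g X" using finite_imp_inj_to_nat_seg X by blast
  obtain h where h: "\<And>B. B \<in> \<B> \<Longrightarrow> charged R X g B (h B)"
    using trifurcates_charged[OF sym g tri] by metis
  have "inj_on h \<B>"
  proof (rule inj_onI, rule ccontr)
    fix B C assume "B \<in> \<B>" "C \<in> \<B>" "h B = h C" "B \<noteq> C"
    note BC = this
    have chB: "charged R X g B (h B)" and chC: "charged R X g C (h B)" using h BC(1,2) BC(3) by metis+
    show False
      by (rule charged_unique[OF _ _ _ disj[OF BC(1,2,4)] chB chC]) (erule sym conn[OF BC(1)] conn[OF BC(2)], assumption?)+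
  qed
  moreover have "h ` \<B> \<subseteq> X" using h by (auto simp: charged_def)
  ultimately show ?thesis using X by (metis card_inj_on_le)
qed

section \<open>Percolation configurations on a transitive graph\<close>

text \<open>The closed ball of the graph distance, in terms of relation powers so that concatenation
  of walks and automorphisms act on it directly.\<close>

definition gball :: "('v \<Rightarrow> 'v \<Rightarrow> bool) \<Rightarrow> nat \<Rightarrow> 'v \<Rightarrow> 'v set" where
  "gball E r x = {y. \<exists>k\<le>r. (E ^^ k) x y}"

definition automorphism :: "('v \<Rightarrow> 'v \<Rightarrow> bool) \<Rightarrow> ('v \<Rightarrow> 'v) \<Rightarrow> bool" where
  "automorphism E f \<longleftrightarrow> bij f \<and> (\<forall>a b. E a b \<longleftrightarrow> E (f a) (f b))"

lemma relpowp_bij: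
  assumes "bij f" shows "((\<lambda>a b. Q (f a) (f b)) ^^ n) a b \<longleftrightarrow> (Q ^^ n) (f a) (f b)"
proof (induction n arbitrary: b)
  case 0
  then show ?case using assms by (auto dest: bij_is_inj injD)
next
  case (Suc n)
  have "((\<lambda>a b. Q (f a) (f b)) ^^ Suc n) a b \<longleftrightarrow> (\<exists>c. (Q ^^ n) (f a) (f c) \<and> Q (f c) (f b))"
    by (auto simp: Suc relcompp_apply)
  also have "\<dots> \<longleftrightarrow> (\<exists>c. (Q ^^ n) (f a) c \<and> Q c (f b))"
    using bij_is_surj[OF assms] by (metis surjD)
  also have "\<dots> \<longleftrightarrow> (Q ^^ Suc n) (f a) (f b)" by (auto simp: relcompp_apply)
  finally show ?case .
qed

lemma rtranclp_bij:
  assumes "bij f" shows "(\<lambda>a b. Q (f a) (f b))^** a b \<longleftrightarrow> Q^** (f a) (f b)"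
  unfolding rtranclp_power relpowp_bij[OF assms] ..

lemma relpowp_symI:
  assumes "\<And>a b. R a b \<Longrightarrow> R b a" shows "(R ^^ n) a b \<Longrightarrow> (R ^^ n) b a"
proof (induction n arbitrary: b)
  case (Suc n)
  then obtain c where "(R ^^ n) a c" "R c b" by auto
  then show ?case using Suc.IH assms by (meson relpowp_Suc_I2)
qed simp

locale transitive_graph =
  fixes E :: "'v \<Rightarrow> 'v \<Rightarrow> bool"
  assumes simple: "simple_graph E" and connected: "graph_connected E"
    and loc_fin: "locally_finite E" and transitive: "vertex_transitive E"
begin

lemma E_sym: "E a b \<Longrightarrow> E b a" and E_irrefl: "\<not> E a a"
  using simple by (auto simp: simple_graph_def)

lemma finite_nbrs: "finite {y. E x y}"
  using loc_fin by (auto simp: locally_finite_def)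

lemma ex_automorphism: "\<exists>f. automorphism E f \<and> f x = y"
  using transitive unfolding vertex_transitive_def automorphism_def by blast

lemma gball_self: "x \<in> gball E r x"
  by (auto simp: gball_def intro!: exI[of _ 0])

lemma gball_sym: "y \<in> gball E r x \<longleftrightarrow> x \<in> gball E r y"
  unfolding gball_def using relpowp_symI[of E, OF E_sym] by blast

lemma gball_trans: "y \<in> gball E r x \<Longrightarrow> z \<in> gball E q y \<Longrightarrow> z \<in> gball E (r + q) x"
  unfolding gball_def mem_Collect_eq by (elim exE conjE) (intro exI conjI, rule add_mono, assumption+, rule relpowp_trans)

lemma gball_mono: "r \<le> q \<Longrightarrow> gball E r x \<subseteq> gball E q x"
  unfolding gball_def by (auto intro: le_trans)

lemma finite_gball: "finite (gball E r x)"
proof (induction r)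
  case 0
  have "gball E 0 x = {x}" by (auto simp: gball_def)
  then show ?case by simp
next
  case (Suc r)
  have "gball E (Suc r) x \<subseteq> gball E r x \<union> (\<Union>y\<in>gball E r x. {z. E y z})"
  proof
    fix z assume "z \<in> gball E (Suc r) x"
    then obtain k where k: "k \<le> Suc r" "(E ^^ k) x z" by (auto simp: gball_def)
    show "z \<in> gball E r x \<union> (\<Union>y\<in>gball E r x. {z. E y z})"
    proof (cases "k \<le> r")
      case False
      then have "k = Suc r" using k by simp
      with k obtain y where "(E ^^ r) x y" "E y z" by auto
      then show ?thesis by (auto simp: gball_def)
    qed (use k in \<open>auto simp: gball_def\<close>)
  qed
  then show ?case by (rule finite_subset) (use Suc finite_nbrs in auto)
qed

lemma gball_automorphism: assumes "automorphism E f" shows "f ` gball E r x = gball E r (f x)"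
proof -
  have bij: "bij f" and EE: "E = (\<lambda>a b. E (f a) (f b))" using assms by (auto simp: automorphism_def)
  have *: "(E ^^ n) a b \<longleftrightarrow> (E ^^ n) (f a) (f b)" for n a b
    using relpowp_bij[OF bij, of n E a b] EE by simp
  show ?thesis
  proof
    show "f ` gball E r x \<subseteq> gball E r (f x)" using * by (auto simp: gball_def)
    show "gball E r (f x) \<subseteq> f ` gball E r x"
    proof
      fix z assume z: "z \<in> gball E r (f x)"
      obtain y where "z = f y" using bij_is_surj[OF bij] by (metis surjD)
      with z * show "z \<in> f ` gball E r x" by (auto simp: gball_def)
    qed
  qed
qed

lemma card_gball: "card (gball E r x) = card (gball E r y)"
proof -
  obtain f where f: "automorphism E f" "f x = y" using ex_automorphism by blast
  have "inj f" using f by (simp add: automorphism_def bij_is_inj)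
  then have "card (f ` gball E r x) = card (gball E r x)" by (meson card_image inj_on_subset subset_UNIV)
  then show ?thesis using gball_automorphism[OF f(1)] f(2) by simp
qed

lemma ex_gball: "\<exists>r. y \<in> gball E r x"
  using connected unfolding graph_connected_def rtranclp_power gball_def by blast

lemma countable_V: "countable (UNIV :: 'v set)"
proof -
  have "UNIV = (\<Union>r. gball E r undefined)" using ex_gball by auto
  then show ?thesis using finite_gball countable_finite by (metis countable_UN countableI_type)
qed

text \<open>Prefixes of a walk of length at most \<open>r\<close> from the centre end in the ball,
  so all its vertices are joined to the centre within it.\<close>

lemma gball_inside:
  assumes "x \<in> gball E r c" "y \<in> gball E r c" shows "(inside E (gball E r c))^** x y"
proof -
  have *: "(E ^^ k) c y \<Longrightarrow> k \<le> r \<Longrightarrow> (inside E (gball E r c))^** c y" for k y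
  proof (induction k arbitrary: y)
    case (Suc k)
    then obtain z where z: "(E ^^ k) c z" "E z y" by auto
    have "z \<in> gball E r c" "y \<in> gball E r c"
      unfolding gball_def using z(1) Suc.prems Suc_leD by blast+
    then have "inside E (gball E r c) z y" using z(2) by (simp add: inside_def)
    with Suc.IH[OF z(1)] Suc.prems show ?case by simp
  qed simp
  have "(inside E (gball E r c))^** c x" "(inside E (gball E r c))^** c y"
    using assms * by (auto simp: gball_def)
  moreover have "(inside E (gball E r c))^** x c"
    by (rule rtranclp_symI) (use calculation E_sym in \<open>auto simp: inside_def\<close>)
  ultimately show ?thesis by simp
qed

text \<open>The first vertex outside \<open>F\<close> on a walk that starts in \<open>F\<close>
  belongs to the outer boundary.\<close>

lemma exit_gball:
  assumes "x \<in> F" "y \<in> gball E r x" "y \<notin> F" shows "\<exists>z\<in>vertex_boundary E F. x \<in> gball E r z"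
proof -
  have "(E ^^ k) x y \<Longrightarrow> y \<notin> F \<Longrightarrow> \<exists>z\<in>vertex_boundary E F. \<exists>j\<le>k. (E ^^ j) x z" for k y
  proof (induction k arbitrary: y)
    case 0 then show ?case using assms(1) by simp
  next
    case (Suc k)
    then obtain z where z: "(E ^^ k) x z" "E z y" by auto
    show ?case
    proof (cases "z \<in> F")
      case True
      then have "y \<in> vertex_boundary E F" using z Suc.prems by (auto simp: vertex_boundary_def)
      then show ?thesis using Suc.prems by blast
    next
      case False
      then show ?thesis using Suc.IH[OF z(1)] by (meson le_SucI)
    qed
  qed
  moreover obtain k where k: "k \<le> r" "(E ^^ k) x y" using assms(2) by (auto simp: gball_def)
  ultimately obtain z j where zj: "z\<in>vertex_boundary E F" "j \<le> k" "(E ^^ j) x z" using assms(3) by blast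
  then have "z \<in> gball E r x" unfolding gball_def using k(1) le_trans by blast
  with zj(1) show ?thesis using gball_sym by blast
qed

lemma finite_boundary: "finite F \<Longrightarrow> finite (vertex_boundary E F)"
  by (rule finite_subset[of _ "\<Union>x\<in>F. {y. E x y}"]) (use finite_nbrs in \<open>auto simp: vertex_boundary_def\<close>)

text \<open>Take a maximal disjoint family of \<open>r\<close>-balls inside \<open>F\<close>. Any
  other \<open>r\<close>-ball inside \<open>F\<close> meets one of them, so its centre is within
  \<open>r + r\<close> of a chosen centre; points whose ball leaves \<open>F\<close> are within
  \<open>r\<close> of the boundary.\<close>

lemma ball_packing:
  assumes F: "finite F"
  shows "\<exists>P. finite P \<and> (\<forall>x\<in>P. gball E r x \<subseteq> F) \<and> (\<forall>x\<in>P. \<forall>y\<in>P. x \<noteq> y \<longrightarrow> gball E r x \<inter> gball E r y = {}) \<and>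
     card F \<le> card (vertex_boundary E F) * card (gball E r c) + card P * card (gball E (r + r) c)"
proof -
  define F0 where "F0 = {x \<in> F. gball E r x \<subseteq> F}"
  define \<P> where "\<P> = {P. P \<subseteq> F0 \<and> (\<forall>x\<in>P. \<forall>y\<in>P. x \<noteq> y \<longrightarrow> gball E r x \<inter> gball E r y = {})}"
  have "finite \<P>" unfolding \<P>_def by (rule finite_subset[of _ "Pow F0"]) (use F in \<open>auto simp: F0_def\<close>)
  moreover have "{} \<in> \<P>" by (auto simp: \<P>_def)
  ultimately obtain P where P: "P \<in> \<P>" and max: "\<And>P'. P' \<in> \<P> \<Longrightarrow> P \<subseteq> P' \<Longrightarrow> P' = P"
    using finite_has_maximal2[of \<P> "{}"] by blast
  have cover: "F0 \<subseteq> (\<Union>p\<in>P. gball E (r + r) p)"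
  proof
    fix x assume x: "x \<in> F0"
    show "x \<in> (\<Union>p\<in>P. gball E (r + r) p)"
    proof (cases "\<exists>p\<in>P. gball E r x \<inter> gball E r p \<noteq> {}")
      case True
      then obtain p y where py: "p \<in> P" "y \<in> gball E r x" "y \<in> gball E r p" by auto
      have "x \<in> gball E r y" using py(2) gball_sym by simp
      then have "x \<in> gball E (r + r) p" by (rule gball_trans[OF py(3)])
      with py(1) show ?thesis by auto
    next
      case False
      have "insert x P \<in> \<P>" using x P False unfolding \<P>_def by (simp add: Int_commute)
      then have "insert x P = P" by (rule max) auto
      then have "x \<in> P" by auto
      then show ?thesis using gball_self by (rule UN_I)
    qed
  qed
  have finP: "finite P" using P F by (auto simp: \<P>_def F0_def intro: finite_subset)
  have "F - F0 \<subseteq> (\<Union>z\<in>vertex_boundary E F. gball E r z)"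
  proof
    fix x assume "x \<in> F - F0"
    then obtain y where "x \<in> F" "y \<in> gball E r x" "y \<notin> F" by (auto simp: F0_def)
    from exit_gball[OF this] show "x \<in> (\<Union>z\<in>vertex_boundary E F. gball E r z)" by auto
  qed
  with cover have "F \<subseteq> (\<Union>z\<in>vertex_boundary E F. gball E r z) \<union> (\<Union>p\<in>P. gball E (r + r) p)" by blast
  then have "card F \<le> card ((\<Union>z\<in>vertex_boundary E F. gball E r z) \<union> (\<Union>p\<in>P. gball E (r + r) p))"
    by (intro card_mono) (use finP F finite_boundary finite_gball in auto)
  also have "\<dots> \<le> card (\<Union>z\<in>vertex_boundary E F. gball E r z) + card (\<Union>p\<in>P. gball E (r + r) p)"
    by (rule card_Un_le)
  also have "\<dots> \<le> (\<Sum>z\<in>vertex_boundary E F. card (gball E r z)) + (\<Sum>p\<in>P. card (gball E (r + r) p))"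
    by (intro add_mono card_UN_le) (use finP F finite_boundary in auto)
  also have "\<dots> = card (vertex_boundary E F) * card (gball E r c) + card P * card (gball E (r + r) c)"
  proof -
    have "(\<Sum>z\<in>A. card (gball E q z)) = (\<Sum>z\<in>A. card (gball E q c))" for A q
      by (intro sum.cong refl card_gball)
    then show ?thesis by simp
  qed
  finally show ?thesis using P finP by (intro exI[of _ P]) (auto simp: \<P>_def F0_def)
qed

lemma folner:
  assumes "amenable E" "\<epsilon> > 0"
  shows "\<exists>F. finite F \<and> F \<noteq> {} \<and> real (card (vertex_boundary E F)) \<le> \<epsilon> * real (card F)"
proof -
  let ?q = "\<lambda>K. real (card (vertex_boundary E K)) / real (card K)"
  have "Inf (?q ` {K. finite K \<and> K \<noteq> {}}) < \<epsilon>" using assms by (simp add: amenable_def)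
  moreover have "?q ` {K. finite K \<and> K \<noteq> {}} \<noteq> {}" by auto
  ultimately obtain K where "finite K" "K \<noteq> {}" "?q K < \<epsilon>"
    using cInf_lessD[of "?q ` {K. finite K \<and> K \<noteq> {}}" \<epsilon>] by blast
  then show ?thesis by (intro exI[of _ K]) (simp add: pos_divide_less_eq card_gt_0_iff)
qed

end

text \<open>Configurations live on ordered pairs, which makes the space a plain product. Symmetry
  and containment in \<open>E\<close> are almost sure properties instead of being built into the
  type.\<close>

definition conf_M :: "('v \<times> 'v \<Rightarrow> bool) measure" where
  "conf_M = PiM UNIV (\<lambda>_. count_space UNIV)"

definition crel :: "('v \<times> 'v \<Rightarrow> bool) \<Rightarrow> 'v \<Rightarrow> 'v \<Rightarrow> bool" where
  "crel s a b \<longleftrightarrow> s (a, b)"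

definition pull :: "('v \<Rightarrow> 'v) \<Rightarrow> ('v \<times> 'v \<Rightarrow> bool) \<Rightarrow> 'v \<times> 'v \<Rightarrow> bool" where
  "pull f s = (\<lambda>(a, b). s (f a, f b))"

definition open_edges :: "('v \<times> 'v) set \<Rightarrow> ('v \<times> 'v \<Rightarrow> bool) \<Rightarrow> 'v \<times> 'v \<Rightarrow> bool" where
  "open_edges L s = (\<lambda>e. s e \<or> e \<in> L)"

definition touched :: "('v \<times> 'v \<Rightarrow> bool) \<Rightarrow> 'v \<Rightarrow> bool" where
  "touched s x \<longleftrightarrow> (\<exists>z. s (x, z))"

text \<open>An infinite branch forces \<open>a\<close> to lie outside \<open>B\<close>, since no
  \<open>off\<close> step starts in \<open>B\<close>.\<close>

definition arm :: "('v \<times> 'v \<Rightarrow> bool) \<Rightarrow> 'v set \<Rightarrow> 'v \<Rightarrow> bool" where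
  "arm s B a \<longleftrightarrow> (\<exists>b\<in>B. s (a, b)) \<and> infinite {v. (off (crel s) B)^** a v}"

definition trif :: "('v \<Rightarrow> 'v \<Rightarrow> bool) \<Rightarrow> ('v \<times> 'v \<Rightarrow> bool) \<Rightarrow> 'v set \<Rightarrow> bool" where
  "trif E s B \<longleftrightarrow> (\<forall>a\<in>B. \<forall>b\<in>B. E a b \<longrightarrow> s (a, b)) \<and>
     (\<exists>a b c. arm s B a \<and> arm s B b \<and> arm s B c \<and> \<not> (off (crel s) B)^** a b \<and>
        \<not> (off (crel s) B)^** a c \<and> \<not> (off (crel s) B)^** b c)"

definition conf_connected :: "('v \<times> 'v \<Rightarrow> bool) \<Rightarrow> bool" where
  "conf_connected s \<longleftrightarrow> (\<forall>a b. touched s a \<longrightarrow> touched s b \<longrightarrow> (crel s)^** a b)"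

lemma space_conf_M[simp]: "space conf_M = UNIV"
  by (auto simp: conf_M_def space_PiM)

lemma measurable_conf_coord[simp]: "Measurable.pred conf_M (\<lambda>s. s e)"
  unfolding conf_M_def by simp

lemma measurable_into_conf:
  assumes "\<And>e. Measurable.pred M (\<lambda>x. g x e)" shows "g \<in> M \<rightarrow>\<^sub>M conf_M"
  unfolding conf_M_def by (rule measurable_PiM_single') (use assms in auto)

lemma measurable_pull: "pull f \<in> conf_M \<rightarrow>\<^sub>M conf_M"
  by (rule measurable_into_conf) (auto simp: pull_def split_beta)

lemma pred_countable_Ex:
  assumes "countable I" "\<And>i. i \<in> I \<Longrightarrow> Measurable.pred M (P i)"
  shows "Measurable.pred M (\<lambda>s. \<exists>i\<in>I. P i s)"
  using sets.sets_Collect_countable_Ex'[of I M P] assms by (simp add: pred_def)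

lemma pred_countable_All:
  assumes "countable I" "\<And>i. i \<in> I \<Longrightarrow> Measurable.pred M (P i)"
  shows "Measurable.pred M (\<lambda>s. \<forall>i\<in>I. P i s)"
  using sets.sets_Collect_countable_All'[of I M P] assms by (simp add: pred_def)

context transitive_graph begin

lemma pred_ex_V:
  assumes "\<And>v :: 'v. Measurable.pred M (P v)" shows "Measurable.pred M (\<lambda>s. \<exists>v. P v s)"
  using pred_countable_Ex[OF countable_V, of P M] assms by simp

lemma pred_all_V:
  assumes "\<And>v :: 'v. Measurable.pred M (P v)" shows "Measurable.pred M (\<lambda>s. \<forall>v. P v s)"
  using pred_countable_All[OF countable_V, of P M] assms by simp

lemma pred_rtranclp:
  assumes "\<And>a b :: 'v. Measurable.pred M (\<lambda>s. R s a b)"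
  shows "Measurable.pred M (\<lambda>s. (R s)^** a b)"
proof -
  have "Measurable.pred M (\<lambda>s. (R s ^^ n) a b)" for n
  proof (induction n arbitrary: b)
    case (Suc n)
    show ?case unfolding relpowp.simps relcompp_apply
      by (intro pred_ex_V pred_intros_logic Suc assms)
  qed simp
  then show ?thesis unfolding rtranclp_power by (intro pred_intros_countable)
qed

text \<open>An infinite set is one that leaves every finite set, and there are only countably many
  finite sets of vertices.\<close>

lemma pred_infinite:
  assumes "\<And>v :: 'v. Measurable.pred M (\<lambda>s. Q s v)"
  shows "Measurable.pred M (\<lambda>s. infinite {v. Q s v})"
proof -
  have *: "infinite {v. Q s v} \<longleftrightarrow> (\<forall>F\<in>{F. finite F}. \<exists>v. v \<notin> F \<and> Q s v)" for s
  proof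
    assume "infinite {v. Q s v}"
    then show "\<forall>F\<in>{F. finite F}. \<exists>v. v \<notin> F \<and> Q s v"
      by (metis finite_subset mem_Collect_eq subsetI)
  qed auto
  have c: "countable {F :: 'v set. finite F}"
    using countable_Collect_finite_subset[OF countable_V] by simp
  show ?thesis unfolding *
    by (intro pred_countable_All[OF c] pred_ex_V pred_intros_logic) (use assms in auto)
qed

lemma pred_touched: "Measurable.pred conf_M (\<lambda>s. touched s (x :: 'v))"
  unfolding touched_def by (intro pred_ex_V) simp

lemma pred_conf_connected: "Measurable.pred conf_M (conf_connected :: ('v \<times> 'v \<Rightarrow> bool) \<Rightarrow> bool)"
  unfolding conf_connected_def crel_def[abs_def]
  by (intro pred_all_V pred_intros_logic pred_rtranclp pred_touched) simp

lemma pred_trif: "Measurable.pred conf_M (\<lambda>s. trif E s B)"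
proof -
  have c: "countable B" using countable_V by (rule countable_subset[rotated]) auto
  have [measurable]: "Measurable.pred conf_M (\<lambda>s. (off (crel s) B)^** a b)" for a b
    unfolding off_def crel_def by (intro pred_rtranclp pred_intros_logic) simp_all
  have [measurable]: "Measurable.pred conf_M (\<lambda>s. arm s B a)" for a
    unfolding arm_def by (intro pred_intros_logic pred_infinite pred_countable_Ex[OF c]) simp_all
  show ?thesis unfolding trif_def
    by (intro pred_intros_logic pred_ex_V pred_countable_All[OF c]) simp_all
qed

end

section \<open>Trifurcation sets of an edge configuration\<close>

context transitive_graph begin

text \<open>Cutting the configuration down to \<open>F\<close> and its boundary turns infinite arms
  into branches reaching the boundary, so that the finite count applies with the boundary as
  \<open>X\<close>.\<close>

lemma trif_count:
  assumes s: "\<And>a b. s (a, b) \<Longrightarrow> s (b, a) \<and> E a b" and F: "finite F"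
    and sub: "\<And>B. B \<in> \<B> \<Longrightarrow> B \<subseteq> F"
    and conn: "\<And>B b b'. B \<in> \<B> \<Longrightarrow> b \<in> B \<Longrightarrow> b' \<in> B \<Longrightarrow> (inside E B)^** b b'"
    and disj: "\<And>B C. B \<in> \<B> \<Longrightarrow> C \<in> \<B> \<Longrightarrow> B \<noteq> C \<Longrightarrow> B \<inter> C = {}"
    and tri: "\<And>B. B \<in> \<B> \<Longrightarrow> trif E s B"
  shows "card \<B> \<le> card (vertex_boundary E F)"
proof -
  define X where "X = vertex_boundary E F"
  define R where "R = (\<lambda>a b. s (a, b) \<and> a \<in> F \<union> X \<and> b \<in> F \<union> X)"
  have finX: "finite X" unfolding X_def using F by (rule finite_boundary)
  show ?thesis unfolding X_def[symmetric]
  proof (rule card_trifurcations_le[where R=R, OF _ finX _ disj])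
    show "R b a" if "R a b" for a b using that s by (auto simp: R_def)
    show "(inside R B)^** b b'" if B: "B \<in> \<B>" and b: "b \<in> B" "b' \<in> B" for B b b'
    proof (rule rtranclp_mono[THEN predicate2D, rotated, OF conn[OF B b]], rule predicate2I)
      fix a c assume "inside E B a c"
      then show "inside R B a c" using sub[OF B] tri[OF B] unfolding inside_def R_def trif_def by blast
    qed
    show "trifurcates R X B" if B: "B \<in> \<B>" for B
    proof -
      have off_R: "off (crel s) B a b" if "off R B a b" for a b
        using that by (auto simp: off_def R_def crel_def)
      have nc: "\<not> (off R B)^** a b" if "\<not> (off (crel s) B)^** a b" for a b
      proof
        assume "(off R B)^** a b"
        from rtranclp_mono[THEN predicate2D, OF _ this] have "(off (crel s) B)^** a b" using off_R by blast
        with that show False ..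
      qed
      have arm1: "(\<exists>b\<in>B. R a b) \<and> (\<exists>x\<in>X. (off R B)^** a x)" if a: "arm s B a" for a
      proof -
        from a obtain b where b: "b \<in> B" "s (a, b)" and inf: "infinite {v. (off (crel s) B)^** a v}"
          by (auto simp: arm_def)
        have bF: "b \<in> F" using sub B b by blast
        have aFX: "a \<in> F \<union> X" using s[OF b(2)] bF E_sym by (auto simp: X_def vertex_boundary_def)
        \<comment> \<open>An arm stays in \<open>F\<close> until its first step out, which lands in
          \<open>X\<close>. Up to that moment its steps are also steps of \<open>R\<close>.\<close>
        have "(\<exists>x\<in>X. (off R B)^** a x) \<or> (v \<in> F \<and> (off R B)^** a v)" if "(off (crel s) B)^** a v" for v
          using that
        proof (induction rule: rtranclp_induct)
          case base then show ?case using aFX by blast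
        next
          case (step v w)
          show ?case
          proof (cases "\<exists>x\<in>X. (off R B)^** a x")
            case False
            then have v: "v \<in> F" "(off R B)^** a v" using step.IH by auto
            have vw: "s (v, w)" "v \<notin> B" "w \<notin> B" using step.hyps(2) by (auto simp: off_def crel_def)
            have w: "w \<in> F \<union> X" using s[OF vw(1)] v(1) by (auto simp: X_def vertex_boundary_def)
            then have "off R B v w" using v vw by (auto simp: off_def R_def)
            with v(2) have "(off R B)^** a w" by simp
            with w show ?thesis by blast
          qed simp
        qed
        moreover obtain v where "(off (crel s) B)^** a v" "v \<notin> F" using inf F
          by (metis (mono_tags, lifting) finite_subset mem_Collect_eq subsetI)
        ultimately have "\<exists>x\<in>X. (off R B)^** a x" by blast
        moreover have "R a b" using b bF aFX by (simp add: R_def)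
        ultimately show ?thesis using b(1) by blast
      qed
      from tri[OF B] obtain a b c where abc: "arm s B a" "arm s B b" "arm s B c"
         "\<not> (off (crel s) B)^** a b" "\<not> (off (crel s) B)^** a c" "\<not> (off (crel s) B)^** b c"
        unfolding trif_def by blast
      have symR: "\<not> (off R B)^** v u" if "\<not> (off R B)^** u v" for u v
        using that rtranclp_symI[of "off R B" v u] s by (auto simp: off_def R_def)
      have 3: "(\<forall>i<3. P i) \<longleftrightarrow> P 0 \<and> P 1 \<and> P (2::nat)" for P
        by (auto simp: numeral_3_eq_3 numeral_2_eq_2 less_Suc_eq)
      show ?thesis unfolding trifurcates_def
      proof (rule exI[of _ "(!) [a, b, c]"], intro conjI)
        show "\<forall>i<3. (\<exists>ba\<in>B. R ([a, b, c] ! i) ba) \<and> (\<exists>x\<in>X. (off R B)^** ([a, b, c] ! i) x)"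
          unfolding 3 using arm1[OF abc(1)] arm1[OF abc(2)] arm1[OF abc(3)] by simp
        show "\<forall>i<3. \<forall>j<3. i \<noteq> j \<longrightarrow> \<not> (off R B)^** ([a, b, c] ! i) ([a, b, c] ! j)"
          unfolding 3 using nc[OF abc(4)] nc[OF abc(5)] nc[OF abc(6)] symR by simp
      qed
    qed
  qed
qed

lemma crel_pull: "crel (pull f s) a b = crel s (f a) (f b)"
  by (simp add: crel_def pull_def)

lemma trif_pull:
  assumes f: "automorphism E f" shows "trif E (pull f s) B \<longleftrightarrow> trif E s (f ` B)"
proof -
  let ?o = "(off (crel s) (f ` B))^**"
  have bij: "bij f" and EE: "\<And>a b. E (f a) (f b) \<longleftrightarrow> E a b" using f by (auto simp: automorphism_def)
  have inj: "f a \<in> f ` B \<longleftrightarrow> a \<in> B" for a using bij by (auto simp: bij_def inj_image_mem_iff)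
  have off: "off (crel (pull f s)) B = (\<lambda>a b. off (crel s) (f ` B) (f a) (f b))"
    by (auto simp: fun_eq_iff off_def crel_pull inj)
  have offs: "(off (crel (pull f s)) B)^** a b \<longleftrightarrow> ?o (f a) (f b)" for a b
    unfolding off by (rule rtranclp_bij[OF bij])
  have arm: "arm (pull f s) B a \<longleftrightarrow> arm s (f ` B) (f a)" for a
  proof -
    have "bij_betw f {v. ?o (f a) (f v)} {v. ?o (f a) v}"
      unfolding bij_betw_def
    proof
      show "inj_on f {v. ?o (f a) (f v)}" using bij by (metis bij_is_inj inj_on_subset subset_UNIV)
      show "f ` {v. ?o (f a) (f v)} = {v. ?o (f a) v}"
        using bij_is_surj[OF bij] by (auto simp: image_iff)
    qed
    from bij_betw_finite[OF this] show ?thesis by (simp add: arm_def offs) (simp add: pull_def)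
  qed
  have ex: "(\<exists>a. P (f a)) \<longleftrightarrow> (\<exists>a. P a)" for P using bij_is_surj[OF bij] by (metis surjD)
  show ?thesis unfolding trif_def arm offs
  proof (rule arg_cong2[where f="(\<and>)"])
    show "(\<forall>a\<in>B. \<forall>b\<in>B. E a b \<longrightarrow> pull f s (a, b)) = (\<forall>a\<in>f ` B. \<forall>b\<in>f ` B. E a b \<longrightarrow> s (a, b))"
      by (simp add: EE pull_def)
    show "(\<exists>a b c. arm s (f ` B) (f a) \<and> arm s (f ` B) (f b) \<and> arm s (f ` B) (f c) \<and>
         \<not> ?o (f a) (f b) \<and> \<not> ?o (f a) (f c) \<and>
         \<not> ?o (f b) (f c)) =
      (\<exists>a b c. arm s (f ` B) a \<and> arm s (f ` B) b \<and> arm s (f ` B) c \<and>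
         \<not> ?o a b \<and> \<not> ?o a c \<and>
         \<not> ?o b c)"
      by (subst (1 2 3) ex[symmetric]) (rule refl)
  qed
qed

text \<open>Otherwise the cluster of \<open>a\<close> would be covered by the finite set
  \<open>B\<close> and by the finite branches of the finitely many vertices joined to
  \<open>B\<close>.\<close>

lemma ex_arm:
  assumes s: "\<And>a b. s (a, b) \<Longrightarrow> s (b, a) \<and> E a b" and B: "finite B" "a \<in> B"
    and inf: "infinite {v. (crel s)^** a v}"
  shows "\<exists>a'. (crel s)^** a a' \<and> arm s B a'"
proof (rule ccontr)
  assume no: "\<not> ?thesis"
  define N where "N = {v. (crel s)^** a v \<and> (\<exists>b\<in>B. s (v, b))}"
  have "N \<subseteq> (\<Union>b\<in>B. {v. E b v})" using s E_sym by (auto simp: N_def)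
  then have N: "finite N" by (rule finite_subset) (use B finite_nbrs in auto)
  have fin: "finite {v. (off (crel s) B)^** a' v}" if "a' \<in> N" for a'
    using that no by (auto simp: N_def arm_def)
  have "v \<in> B \<or> (\<exists>a'\<in>N. (off (crel s) B)^** a' v)" if "(crel s)^** a v" for v
    using that
  proof (induction rule: rtranclp_induct)
    case base then show ?case using B by simp
  next
    case (step v w)
    show ?case
    proof (cases "w \<in> B")
      case w: False
      show ?thesis
      proof (cases "v \<in> B")
        case True
        have "(crel s)^** a w" using step.hyps by simp
        moreover have "s (w, v)" using step.hyps(2) s by (auto simp: crel_def)
        ultimately have "w \<in> N" using True by (auto simp: N_def)
        then show ?thesis by blast
      next
        case False
        then obtain a' where "a' \<in> N" "(off (crel s) B)^** a' v" using step.IH by blast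
        moreover have "off (crel s) B v w" using False w step.hyps(2) by (simp add: off_def)
        ultimately show ?thesis using rtranclp.rtrancl_into_rtrancl by metis
      qed
    qed simp
  qed
  then have "{v. (crel s)^** a v} \<subseteq> B \<union> (\<Union>a'\<in>N. {v. (off (crel s) B)^** a' v})" by blast
  then have "finite {v. (crel s)^** a v}" by (rule finite_subset) (use N B fin in auto)
  with inf show False ..
qed

end

definition inner_edges :: "('v \<Rightarrow> 'v \<Rightarrow> bool) \<Rightarrow> 'v set \<Rightarrow> ('v \<times> 'v) set" where
  "inner_edges E B = {(a, b). a \<in> B \<and> b \<in> B \<and> E a b}"

text \<open>Each of the three infinite clusters provides an arm. Opening edges inside
  \<open>B\<close> leaves the relation off \<open>B\<close> unchanged, so the arms survive and stay
  apart.\<close>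

lemma trif_open_edges:
  assumes G: "transitive_graph E" and s: "\<And>a b. s (a, b) \<Longrightarrow> s (b, a) \<and> E a b" and B: "finite B"
    and abc: "a \<in> B" "b \<in> B" "c \<in> B"
    and inf: "infinite {v. (crel s)^** a v}" "infinite {v. (crel s)^** b v}" "infinite {v. (crel s)^** c v}"
    and nc: "\<not> (crel s)^** a b" "\<not> (crel s)^** a c" "\<not> (crel s)^** b c"
  shows "trif E (open_edges (inner_edges E B) s) B"
proof -
  interpret transitive_graph E by fact
  have sy: "(crel s)^** u v \<Longrightarrow> (crel s)^** v u" for u v
    by (rule rtranclp_symI) (use s in \<open>auto simp: crel_def\<close>)
  obtain a' b' c' where a': "(crel s)^** a a'" "arm s B a'" and b': "(crel s)^** b b'" "arm s B b'"
    and c': "(crel s)^** c c'" "arm s B c'" using ex_arm[OF s B] abc inf by metis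
  have off: "off (crel (open_edges (inner_edges E B) s)) B = off (crel s) B"
    by (auto simp: fun_eq_iff off_def crel_def open_edges_def inner_edges_def)
  have arm: "arm (open_edges (inner_edges E B) s) B v" if "arm s B v" for v
    using that unfolding arm_def off by (auto simp: open_edges_def)
  have sep: "\<not> (off (crel s) B)^** u' v'" if "(crel s)^** u u'" "(crel s)^** v v'" "\<not> (crel s)^** u v" for u v u' v'
  proof
    assume "(off (crel s) B)^** u' v'"
    then have "(crel s)^** u' v'" by (rule rtranclp_mono[THEN predicate2D, rotated]) (auto simp: off_def)
    then have "(crel s)^** u v" using that(1) sy[OF that(2)] by (meson rtranclp_trans)
    with that(3) show False ..
  qed
  show ?thesis unfolding trif_def off
    using arm[OF a'(2)] arm[OF b'(2)] arm[OF c'(2)] sep[OF a'(1) b'(1) nc(1)] sep[OF a'(1) c'(1) nc(2)]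
      sep[OF b'(1) c'(1) nc(3)] by (auto simp: open_edges_def inner_edges_def)
qed

text \<open>The filled set \<open>B\<close> joins the clusters of \<open>a\<close> and
  \<open>b\<close>, and vertices touched only by the new edges lie in \<open>B\<close>.\<close>

lemma conf_connected_open_edges:
  assumes s: "\<And>a b. s (a, b) \<Longrightarrow> s (b, a) \<and> E a b" and E: "\<And>a b. E a b \<Longrightarrow> E b a"
    and B: "\<And>x y. x \<in> B \<Longrightarrow> y \<in> B \<Longrightarrow> (inside E B)^** x y"
    and a: "a \<in> B" and b: "b \<in> B"
    and two: "\<And>x. touched s x \<Longrightarrow> (crel s)^** x a \<or> (crel s)^** x b"
  shows "conf_connected (open_edges (inner_edges E B) s)"
proof -
  let ?s = "open_edges (inner_edges E B) s"
  have sy: "(crel ?s)^** v u" if "(crel ?s)^** u v" for u v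
    by (rule rtranclp_symI[OF _ that]) (use s E in \<open>auto simp: crel_def open_edges_def inner_edges_def\<close>)
  have inB: "(crel ?s)^** x y" if "x \<in> B" "y \<in> B" for x y
    by (rule rtranclp_mono[THEN predicate2D, rotated, OF B[OF that]])
      (auto simp: crel_def open_edges_def inner_edges_def inside_def)
  have ss: "(crel ?s)^** x y" if "(crel s)^** x y" for x y
    by (rule rtranclp_mono[THEN predicate2D, rotated, OF that]) (auto simp: crel_def open_edges_def)
  have toa: "(crel ?s)^** x a" if "touched ?s x" for x
  proof (cases "touched s x")
    case True
    from two[OF this] show ?thesis using ss inB[OF b a] by (meson rtranclp_trans)
  next
    case False
    with that have "x \<in> B" by (auto simp: touched_def open_edges_def inner_edges_def)
    then show ?thesis using inB a by blast
  qed
  show ?thesis unfolding conf_connected_def using toa sy by (meson rtranclp_trans)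
qed

section \<open>Uniqueness of the infinite cluster\<close>

text \<open>\<open>insertion\<close> is absolute continuity in terms of null events: opening an edge
  at a touched vertex does not lead into a null set. It is stated for predicates, so that it can be
  iterated without measurability side conditions.\<close>

locale invariant_percolation = transitive_graph E + prob_space \<mu>
  for E :: "'v \<Rightarrow> 'v \<Rightarrow> bool" and \<mu> :: "('v \<times> 'v \<Rightarrow> bool) measure" +
  assumes sets_mu: "sets \<mu> = sets conf_M"
    and AE_edges: "AE s in \<mu>. \<forall>a b. s (a, b) \<longrightarrow> s (b, a) \<and> E a b"
    and AE_infinite: "AE s in \<mu>. \<forall>a. touched s a \<longrightarrow> infinite {v. (crel s)^** a v}"
    and invariant: "automorphism E f \<Longrightarrow> distr \<mu> conf_M (pull f) = \<mu>"
    and ergodic: "A \<in> sets conf_M \<Longrightarrow> (\<And>f. automorphism E f \<Longrightarrow> pull f -` A = A) \<Longrightarrow> prob A = 0 \<or> prob A = 1"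
    and insertion: "(AE s in \<mu>. Q s) \<Longrightarrow> E x y \<Longrightarrow>
      AE s in \<mu>. touched s x \<longrightarrow> Q (open_edges {(x, y), (y, x)} s)"
    and amenable: "amenable E"
begin

lemma space_mu[simp]: "space \<mu> = UNIV"
  using sets_eq_imp_space_eq[OF sets_mu] by simp

text \<open>Absolute continuity of opening all of \<open>L\<close> at once, on the event that the
  seed \<open>v\<close> is touched.\<close>

definition insertable :: "'v \<Rightarrow> ('v \<times> 'v) set \<Rightarrow> bool" where
  "insertable v L \<longleftrightarrow> (\<forall>Q. (AE s in \<mu>. Q s) \<longrightarrow> (AE s in \<mu>. touched s v \<longrightarrow> Q (open_edges L s)))"

lemma insertableD:
  "(AE s in \<mu>. Q s) \<Longrightarrow> insertable v L \<Longrightarrow> AE s in \<mu>. touched s v \<longrightarrow> Q (open_edges L s)"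
  unfolding insertable_def by simp

lemma insertable_empty: "insertable v {}"
  by (auto simp: insertable_def open_edges_def)

text \<open>Once \<open>L\<close> is open, \<open>x\<close> is touched, being the seed or an
  endpoint of an edge of \<open>L\<close>; so one more edge can be opened there. Both orientations
  are added to let \<open>y\<close> be the next starting point.\<close>

lemma insertable_step:
  assumes L: "insertable v L" and x: "x = v \<or> x \<in> fst ` L" and xy: "E x y"
  shows "insertable v (insert (x, y) (insert (y, x) L))"
  unfolding insertable_def
proof (intro allI impI)
  fix Q assume "AE s in \<mu>. Q s"
  from insertion[OF this xy] have "AE s in \<mu>. touched s x \<longrightarrow> Q (open_edges {(x, y), (y, x)} s)" .
  from insertableD[OF this L]
  have "AE s in \<mu>. touched s v \<longrightarrow> (touched (open_edges L s) x \<longrightarrow> Q (open_edges {(x, y), (y, x)} (open_edges L s)))" .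
  then show "AE s in \<mu>. touched s v \<longrightarrow> Q (open_edges (insert (x, y) (insert (y, x) L)) s)"
  proof eventually_elim
    case (elim s)
    show ?case
    proof
      assume v: "touched s v"
      have "touched (open_edges L s) x" using x v by (auto simp: touched_def open_edges_def)
      moreover have "open_edges {(x, y), (y, x)} (open_edges L s) = open_edges (insert (x, y) (insert (y, x) L)) s"
        by (auto simp: open_edges_def fun_eq_iff)
      ultimately show "Q (open_edges (insert (x, y) (insert (y, x) L)) s)" using elim v by simp
    qed
  qed
qed

text \<open>A maximal insertable set of inner edges contains all inner edges at the seed and at its
  own endpoints; since \<open>B\<close> is connected, these are all inner edges.\<close>

lemma insertable_inner_edges:
  assumes B: "finite B" "v \<in> B" and conn: "\<And>x y. x \<in> B \<Longrightarrow> y \<in> B \<Longrightarrow> (inside E B)^** x y"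
  shows "insertable v (inner_edges E B)"
proof -
  define \<L> where "\<L> = {L. L \<subseteq> inner_edges E B \<and> insertable v L}"
  have finE: "finite (inner_edges E B)"
    by (rule finite_subset[of _ "B \<times> B"]) (use B in \<open>auto simp: inner_edges_def\<close>)
  have "finite \<L>" unfolding \<L>_def by (rule finite_subset[of _ "Pow (inner_edges E B)"]) (use finE in auto)
  moreover have "{} \<in> \<L>" by (auto simp: \<L>_def insertable_empty)
  ultimately obtain L where L: "L \<in> \<L>" and max: "\<And>L'. L' \<in> \<L> \<Longrightarrow> L \<subseteq> L' \<Longrightarrow> L' = L"
    using finite_has_maximal2[of \<L> "{}"] by blast
  have closed: "(x, y) \<in> L \<and> (y, x) \<in> L" if "x = v \<or> x \<in> fst ` L" "inside E B x y" for x y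
  proof -
    have "insertable v (insert (x, y) (insert (y, x) L))"
      using insertable_step[OF _ that(1)] L that(2) by (auto simp: \<L>_def inside_def)
    then have "insert (x, y) (insert (y, x) L) \<in> \<L>"
      using L that(2) E_sym by (auto simp: \<L>_def inside_def inner_edges_def)
    from max[OF this] have "insert (x, y) (insert (y, x) L) = L" by (meson subset_insertI2 subset_refl)
    then show ?thesis by (metis insertCI)
  qed
  have reach: "x = v \<or> x \<in> fst ` L" if "x \<in> B" for x
    using conn[OF B(2) that]
  proof (induction rule: rtranclp_induct)
    case (step y z)
    have "(z, y) \<in> L" using closed[OF step.IH step.hyps(2)] by simp
    then have "z \<in> fst ` L" by (metis fst_conv image_eqI)
    then show ?case ..
  qed simp
  have "inner_edges E B \<subseteq> L"
  proof
    fix e assume "e \<in> inner_edges E B"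
    then obtain x y where "e = (x, y)" "inside E B x y" "x \<in> B" by (auto simp: inner_edges_def inside_def)
    then show "e \<in> L" using closed[OF reach] by simp
  qed
  then show ?thesis using L by (auto simp: \<L>_def)
qed

lemma prob_trif_eq: "prob {s. trif E s (gball E r x)} = prob {s. trif E s (gball E r y)}"
proof -
  obtain f where f: "automorphism E f" "f x = y" using ex_automorphism by blast
  have meas: "{s. trif E s (gball E r x)} \<in> sets conf_M" using pred_trif[of "gball E r x"] by (simp add: pred_def)
  have "prob {s. trif E s (gball E r x)} = measure (distr \<mu> conf_M (pull f)) {s. trif E s (gball E r x)}"
    by (simp add: invariant[OF f(1)])
  also have "\<dots> = prob (pull f -` {s. trif E s (gball E r x)} \<inter> space \<mu>)"
    by (rule measure_distr[OF _ meas]) (simp add: measurable_pull measurable_cong_sets[OF sets_mu refl])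
  also have "pull f -` {s. trif E s (gball E r x)} \<inter> space \<mu> = {s. trif E s (gball E r y)}"
    using trif_pull[OF f(1)] gball_automorphism[OF f(1)] f(2) by auto
  finally show ?thesis .
qed

text \<open>Count trifurcation balls in a disjoint packing of \<open>F\<close>. Their number is
  almost surely at most the size of the boundary, while its expectation is the number of balls times
  \<open>?p\<close>, as all balls of the same radius are equally likely to trifurcate.\<close>

lemma trif_bound:
  assumes F: "finite F"
  shows "prob {s. trif E s (gball E r c)} * card F \<le>
    card (vertex_boundary E F) * (card (gball E r c) + card (gball E (r + r) c))"
proof -
  let ?p = "prob {s. trif E s (gball E r c)}"
  obtain P where P: "finite P" "\<forall>x\<in>P. gball E r x \<subseteq> F"
    "\<forall>x\<in>P. \<forall>y\<in>P. x \<noteq> y \<longrightarrow> gball E r x \<inter> gball E r y = {}"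
    "card F \<le> card (vertex_boundary E F) * card (gball E r c) + card P * card (gball E (r + r) c)"
    using ball_packing[OF F, of r c] by (elim exE conjE)
  have inj: "inj_on (gball E r) P"
  proof (rule inj_onI, rule ccontr)
    fix x y assume xy: "x \<in> P" "y \<in> P" "gball E r x = gball E r y" "x \<noteq> y"
    have "gball E r x \<inter> gball E r y = {}" using P(3) xy(1,2,4) by blast
    moreover have "x \<in> gball E r x" by (rule gball_self)
    ultimately show False using xy(3) by blast
  qed
  have meas: "{s. trif E s (gball E r x)} \<in> sets \<mu>" for x
    using pred_trif[of "gball E r x"] by (simp add: pred_def sets_mu)
  have count: "AE s in \<mu>. (\<Sum>x\<in>P. indicator {s. trif E s (gball E r x)} s) \<le> (of_nat (card (vertex_boundary E F)) :: ennreal)"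
    using AE_edges
  proof eventually_elim
    case (elim s)
    let ?B = "gball E r ` {x \<in> P. trif E s (gball E r x)}"
    have "card ?B \<le> card (vertex_boundary E F)"
    proof (rule trif_count[of s, OF _ F])
      show "s (b, a) \<and> E a b" if "s (a, b)" for a b using elim that by simp
      show "B \<subseteq> F" "trif E s B" if "B \<in> ?B" for B using that P(2) by auto
      show "(inside E B)^** b b'" if "B \<in> ?B" "b \<in> B" "b' \<in> B" for B b b'
        using that gball_inside by auto
      show "B \<inter> C = {}" if BC: "B \<in> ?B" "C \<in> ?B" "B \<noteq> C" for B C
      proof -
        obtain x y where xy: "B = gball E r x" "C = gball E r y" "x \<in> P" "y \<in> P" using BC(1,2) by blast
        then have "x \<noteq> y" using BC(3) by blast
        with P(3) xy(3,4) have "gball E r x \<inter> gball E r y = {}" by blast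
        then show ?thesis unfolding xy .
      qed
    qed
    moreover have "card ?B = card {x \<in> P. trif E s (gball E r x)}"
      by (rule card_image) (use inj in \<open>auto intro: inj_on_subset\<close>)
    moreover have "(\<Sum>x\<in>P. indicator {s. trif E s (gball E r x)} s) = (of_nat (card {x \<in> P. trif E s (gball E r x)}) :: ennreal)"
      using P(1) by (simp add: indicator_def sum.If_cases Int_def)
    ultimately show ?case by simp
  qed
  have "ennreal (card P * ?p) = (\<Sum>x\<in>P. emeasure \<mu> {s. trif E s (gball E r x)})"
  proof -
    have "(\<Sum>x\<in>P. emeasure \<mu> {s. trif E s (gball E r x)}) = (\<Sum>x\<in>P. ennreal ?p)"
      unfolding emeasure_eq_measure by (intro sum.cong refl arg_cong[where f=ennreal] prob_trif_eq)
    then show ?thesis by (simp add: ennreal_mult'' ennreal_of_nat_eq_real_of_nat)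
  qed
  also have "\<dots> = (\<integral>\<^sup>+s. (\<Sum>x\<in>P. indicator {s. trif E s (gball E r x)} s) \<partial>\<mu>)"
    using meas by (subst nn_integral_sum) auto
  also have "\<dots> \<le> (\<integral>\<^sup>+s. of_nat (card (vertex_boundary E F)) \<partial>\<mu>)"
    by (rule nn_integral_mono_AE[OF count])
  also have "\<dots> = of_nat (card (vertex_boundary E F))" using emeasure_space_1 by simp
  finally have le: "card P * ?p \<le> card (vertex_boundary E F)"
    by (simp add: ennreal_of_nat_eq_real_of_nat)
  have "?p * card F \<le> ?p * (card (vertex_boundary E F) * card (gball E r c)) + (card P * ?p) * card (gball E (r + r) c)"
  proof -
    have "real (card F) \<le> card (vertex_boundary E F) * card (gball E r c) + card P * card (gball E (r + r) c)"
      using P(4) by (simp only: of_nat_le_iff)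
    then have "?p * card F \<le> ?p * (card (vertex_boundary E F) * card (gball E r c) + card P * card (gball E (r + r) c))"
      by (intro mult_left_mono) auto
    then show ?thesis by (simp add: algebra_simps)
  qed
  also have "\<dots> \<le> 1 * real (card (vertex_boundary E F) * card (gball E r c)) + real (card (vertex_boundary E F)) * card (gball E (r + r) c)"
    by (intro add_mono mult_right_mono le) auto
  finally show ?thesis by (simp add: algebra_simps)
qed

text \<open>Divide \<open>trif_bound\<close> by the size of \<open>F\<close> and let the boundary
  ratio of \<open>F\<close> become small; the probability does not depend on
  \<open>F\<close>.\<close>

lemma prob_trif_zero: "prob {s. trif E s (gball E r c)} = 0"
proof -
  let ?p = "prob {s. trif E s (gball E r c)}"
  let ?C = "real (card (gball E r c) + card (gball E (r + r) c))"
  have "?p \<le> 0 + \<epsilon>" if e: "\<epsilon> > 0" for \<epsilon>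
  proof -
    \<comment> \<open>\<open>?C\<close> is the sum of the two ball sizes in
      \<open>trif_bound\<close>; the added 1 keeps the denominator positive.\<close>
    define \<delta> where "\<delta> = \<epsilon> / (?C + 1)"
    have "\<delta> > 0" using e by (simp add: \<delta>_def)
    then obtain F where F: "finite F" "F \<noteq> {}" "card (vertex_boundary E F) \<le> \<delta> * card F"
      using folner[OF amenable] by blast
    have "?p * card F \<le> card (vertex_boundary E F) * ?C" using trif_bound[OF F(1), of r c] by simp
    also have "\<dots> \<le> (\<delta> * card F) * ?C" using F(3) by (intro mult_right_mono) auto
    finally have "?p * card F \<le> (\<delta> * ?C) * card F" by (simp add: algebra_simps)
    then have "?p \<le> \<delta> * ?C" using F by (simp add: card_gt_0_iff)
    also have "\<dots> \<le> \<epsilon>" using e by (simp add: \<delta>_def field_simps)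
    finally show ?thesis by simp
  qed
  then have "?p \<le> 0" by (rule field_le_epsilon)
  then show ?thesis using measure_nonneg[of \<mu> "{s. trif E s (gball E r c)}"] by simp
qed

text \<open>Three clusters meet a common ball about a fixed vertex. Filling this ball from a touched
  vertex would make it a trifurcation ball, an event of probability 0; there are only countably many
  radii to consider.\<close>

lemma AE_no_three_clusters:
  "AE s in \<mu>. \<forall>a b c. touched s a \<longrightarrow> touched s b \<longrightarrow> touched s c \<longrightarrow>
     (crel s)^** a b \<or> (crel s)^** a c \<or> (crel s)^** b c"
proof -
  fix v0 :: 'v
  let ?B = "\<lambda>r. gball E r v0"
  have 1: "AE s in \<mu>. touched s v \<longrightarrow> \<not> trif E (open_edges (inner_edges E (?B r)) s) (?B r)"
    if v: "v \<in> ?B r" for r v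
  proof -
    have meas: "{s. trif E s (?B r)} \<in> sets \<mu>"
      using pred_trif[of "?B r"] by (simp add: pred_def sets_mu)
    have "AE s in \<mu>. \<not> trif E s (?B r)"
      by (rule AE_I[of _ _ "{s. trif E s (?B r)}"])
        (use meas prob_trif_zero[of r v0] in \<open>auto simp: emeasure_eq_measure\<close>)
    then show ?thesis by (rule insertableD) (rule insertable_inner_edges[OF finite_gball v gball_inside])
  qed
  have "AE s in \<mu>. \<forall>r. \<forall>v\<in>?B r. touched s v \<longrightarrow> \<not> trif E (open_edges (inner_edges E (?B r)) s) (?B r)"
    unfolding AE_all_countable by (intro allI AE_finite_allI finite_gball 1)
  with AE_edges AE_infinite show ?thesis
  proof eventually_elim
    case (elim s)
    show ?case
    proof (intro allI impI, rule ccontr)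
      fix a b c assume t: "touched s a" "touched s b" "touched s c"
        and n: "\<not> ((crel s)^** a b \<or> (crel s)^** a c \<or> (crel s)^** b c)"
      obtain r1 r2 r3 where "a \<in> ?B r1" "b \<in> ?B r2" "c \<in> ?B r3" using ex_gball by blast
      then have in_ball: "a \<in> ?B (r1 + r2 + r3)" "b \<in> ?B (r1 + r2 + r3)" "c \<in> ?B (r1 + r2 + r3)"
        using gball_mono[of r1 "r1+r2+r3" v0] gball_mono[of r2 "r1+r2+r3" v0] gball_mono[of r3 "r1+r2+r3" v0] by auto
      have "trif E (open_edges (inner_edges E (?B (r1 + r2 + r3))) s) (?B (r1 + r2 + r3))"
        by (rule trif_open_edges[OF transitive_graph_axioms _ finite_gball in_ball]) (use elim(1,2) t n in simp_all)
      moreover note elim(3)[THEN spec, THEN bspec, OF in_ball(1)]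
      ultimately show False using t(1) by simp
    qed
  qed
qed

text \<open>If connectedness had probability 0, this would remain so after filling any ball. But
  when there are at most two clusters, filling a ball that meets both of them connects everything.
  So the probability is positive, and ergodicity makes it 1.\<close>

theorem AE_conf_connected: "AE s in \<mu>. conf_connected s"
proof -
  have meas: "{s :: 'v \<times> 'v \<Rightarrow> bool. conf_connected s} \<in> sets conf_M" using pred_conf_connected by (simp add: pred_def)
  have inv: "pull f -` {s. conf_connected s} = {s. conf_connected s}" if f: "automorphism E f" for f
  proof -
    have bij: "bij f" using f by (simp add: automorphism_def)
    have ex: "(\<forall>a b. P (f a) (f b)) \<longleftrightarrow> (\<forall>a b. P a b)" for P
      using bij_is_surj[OF bij] by (metis surjD)
    have ex': "(\<exists>a. P (f a)) \<longleftrightarrow> (\<exists>a. P a)" for P using bij_is_surj[OF bij] by (metis surjD)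
    have t: "touched (pull f s) a \<longleftrightarrow> touched s (f a)" for s a
      using ex'[of "\<lambda>z. s (f a, z)"] by (simp add: touched_def pull_def)
    have c: "(crel (pull f s))^** a b \<longleftrightarrow> (crel s)^** (f a) (f b)" for s a b
      using rtranclp_bij[OF bij, of "crel s"] by (simp add: crel_pull[abs_def] fun_eq_iff)
    have "conf_connected (pull f s) \<longleftrightarrow> conf_connected s" for s
      unfolding conf_connected_def t c by (rule ex)
    then show ?thesis by auto
  qed
  have "prob {s. conf_connected s} \<noteq> 0"
  proof
    assume 0: "prob {s. conf_connected s} = 0"
    have nc: "AE s in \<mu>. \<not> conf_connected s"
      by (rule AE_I[of _ _ "{s. conf_connected s}"]) (use meas 0 sets_mu in \<open>auto simp: emeasure_eq_measure\<close>)
    fix v0 :: 'v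
  let ?B = "\<lambda>r. gball E r v0"
    have 1: "AE s in \<mu>. touched s v \<longrightarrow> \<not> conf_connected (open_edges (inner_edges E (?B r)) s)"
      if v: "v \<in> ?B r" for r v
      by (rule insertableD[OF nc insertable_inner_edges[OF finite_gball v gball_inside]])
    have "AE s in \<mu>. \<forall>r. \<forall>v\<in>?B r. touched s v \<longrightarrow> \<not> conf_connected (open_edges (inner_edges E (?B r)) s)"
      unfolding AE_all_countable by (intro allI AE_finite_allI finite_gball 1)
    with AE_edges AE_no_three_clusters nc have "AE s in \<mu>. False"
    proof eventually_elim
      case (elim s)
      have sy: "(crel s)^** u v \<Longrightarrow> (crel s)^** v u" for u v
        by (rule rtranclp_symI) (use elim(1) in \<open>auto simp: crel_def\<close>)
      obtain a b where ab: "touched s a" "touched s b" "\<not> (crel s)^** a b"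
        using elim(3) by (auto simp: conf_connected_def)
      obtain r1 r2 where "a \<in> ?B r1" "b \<in> ?B r2" using ex_gball by blast
      then have in_ball: "a \<in> ?B (r1 + r2)" "b \<in> ?B (r1 + r2)"
        using gball_mono[of r1 "r1+r2" v0] gball_mono[of r2 "r1+r2" v0] by auto
      have "conf_connected (open_edges (inner_edges E (?B (r1 + r2))) s)"
      proof (rule conf_connected_open_edges[OF _ E_sym gball_inside in_ball])
        show "s (b, a) \<and> E a b" if "s (a, b)" for a b using elim(1) that by simp
        show "(crel s)^** x a \<or> (crel s)^** x b" if "touched s x" for x
          using elim(2)[rule_format, OF that ab(1,2)] ab(3) by blast
      qed
      moreover note elim(4)[THEN spec, THEN bspec, OF in_ball(1)]
      ultimately show False using ab(1) by simp
    qed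
    then show False by (simp add: AE_False)
  qed
  then have "prob {s. conf_connected s} = 1" using ergodic[OF meas inv] by blast
  then show ?thesis using prob_Collect_eq_1[of conf_connected] meas sets_mu by simp
qed

end

section \<open>Simple random walk\<close>

text \<open>Restricting to an event and pushing forward gives a measure again. Conditional
  identities can therefore be proved as equalities of measures, checked on a generator.\<close>

lemma emeasure_distr_density_indicator:
  assumes C: "C \<in> sets M" and g: "g \<in> M \<rightarrow>\<^sub>M N" and A: "A \<in> sets N"
  shows "emeasure (distr (density M (indicator C)) N g) A = emeasure M (C \<inter> g -` A)"
proof -
  have gA: "g -` A \<inter> space M \<in> sets M" by (rule measurable_sets[OF g A])
  have CA: "C \<inter> g -` A = C \<inter> (g -` A \<inter> space M)" using sets.sets_into_space[OF C] by auto
  have "emeasure (distr (density M (indicator C)) N g) A = emeasure (density M (indicator C)) (g -` A \<inter> space M)"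
    using g A by (subst emeasure_distr) auto
  also have "\<dots> = (\<integral>\<^sup>+x. indicator C x * indicator (g -` A \<inter> space M) x \<partial>M)"
    by (rule emeasure_density) (use C gA in auto)
  also have "\<dots> = (\<integral>\<^sup>+x. indicator (C \<inter> (g -` A \<inter> space M)) x \<partial>M)"
    by (intro nn_integral_cong) (auto simp: indicator_def)
  also have "\<dots> = emeasure M (C \<inter> (g -` A \<inter> space M))" using C gA by (intro nn_integral_indicator) auto
  finally show ?thesis unfolding CA .
qed

lemma space_path_M[simp]: "space path_M = UNIV"
  by (auto simp: path_M_def space_PiM)

definition cyl :: "nat \<Rightarrow> (nat \<Rightarrow> 'v) \<Rightarrow> (nat \<Rightarrow> 'v) set" where
  "cyl n p = {\<omega>. \<forall>i\<le>n. \<omega> i = p i}"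

definition sh :: "(nat \<Rightarrow> 'v) \<Rightarrow> nat \<Rightarrow> 'v" where
  "sh \<omega> = (\<lambda>i. \<omega> (Suc i))"

lemma funpow_sh: "(sh ^^ n) \<omega> = (\<lambda>i. \<omega> (n + i))"
  by (induction n) (auto simp: sh_def)

lemma measurable_path_coord[measurable]: "(\<lambda>\<omega>. \<omega> i) \<in> path_M \<rightarrow>\<^sub>M count_space UNIV"
  unfolding path_M_def by simp

lemma pred_path_coord: "Measurable.pred path_M (\<lambda>\<omega>. Q (\<omega> i))"
  by (rule measurable_compose[OF measurable_path_coord]) simp

lemma measurable_into_path:
  assumes "\<And>i. (\<lambda>x. g x i) \<in> M \<rightarrow>\<^sub>M count_space UNIV" shows "g \<in> M \<rightarrow>\<^sub>M path_M"
  unfolding path_M_def by (rule measurable_PiM_single') (use assms in auto)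

lemma measurable_sh[measurable]: "sh \<in> path_M \<rightarrow>\<^sub>M path_M"
  by (rule measurable_into_path) (simp add: sh_def)

lemma measurable_funpow_sh[measurable]: "(sh ^^ n) \<in> path_M \<rightarrow>\<^sub>M path_M"
  by (rule measurable_into_path) (simp add: funpow_sh)

lemma measurable_map_path: "(\<lambda>\<omega> i. f (\<omega> i)) \<in> path_M \<rightarrow>\<^sub>M path_M"
  by (rule measurable_into_path, rule measurable_compose[OF measurable_path_coord]) simp

lemma cyl_sets: "cyl n p \<in> sets path_M"
proof -
  have "Measurable.pred path_M (\<lambda>\<omega>. \<forall>i\<le>n. \<omega> i = p i)" by measurable
  then show ?thesis by (simp add: cyl_def pred_def)
qed

lemma cyl_Int: "\<exists>k r. cyl n p \<inter> cyl m q = cyl k r \<or> cyl n p \<inter> cyl m q = {}"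
proof (cases "\<forall>i\<le>min n m. p i = q i")
  case True
  have "cyl n p \<inter> cyl m q = cyl (max n m) (if n \<le> m then q else p)"
    using True by (auto simp: cyl_def)
  then show ?thesis by blast
next
  case False
  then have "cyl n p \<inter> cyl m q = {}" by (auto simp: cyl_def)
  then show ?thesis by blast
qed

text \<open>Initial segments are coded as lists because lists over a countable vertex set are
  countable; events depending on finitely many coordinates become countable unions of
  cylinders.\<close>

lemma ex_cyl_list:
  assumes "\<And>\<omega>. Q \<omega> \<longleftrightarrow> Q' (map \<omega> [0..<Suc n])"
  shows "{\<omega>. Q \<omega>} = (\<Union>xs\<in>{xs \<in> lists UNIV. length xs = Suc n \<and> Q' xs}. cyl n (\<lambda>i. xs ! i))"
proof (intro set_eqI iffI)
  fix \<omega> assume "\<omega> \<in> {\<omega>. Q \<omega>}"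
  then show "\<omega> \<in> (\<Union>xs\<in>{xs \<in> lists UNIV. length xs = Suc n \<and> Q' xs}. cyl n (\<lambda>i. xs ! i))"
    using assms by (intro UN_I[of "map \<omega> [0..<Suc n]"]) (auto simp: cyl_def simp del: upt_Suc)
next
  fix \<omega> assume "\<omega> \<in> (\<Union>xs\<in>{xs \<in> lists UNIV. length xs = Suc n \<and> Q' xs}. cyl n (\<lambda>i. xs ! i))"
  then obtain xs where xs: "length xs = Suc n" "Q' xs" "\<omega> \<in> cyl n (\<lambda>i. xs ! i)" by auto
  have "map \<omega> [0..<Suc n] = xs"
    by (rule nth_equalityI) (use xs in \<open>auto simp: cyl_def simp del: upt_Suc\<close>)
  then show "\<omega> \<in> {\<omega>. Q \<omega>}" using xs assms by simp
qed

lemma sets_path_M_cyl: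
  assumes V: "countable (UNIV :: 'v set)"
  shows "sets path_M = sigma_sets UNIV (insert {} {cyl n p | n (p :: nat \<Rightarrow> 'v). True})"
proof -
  let ?G = "insert {} {cyl n p | n (p :: nat \<Rightarrow> 'v). True}"
  have eq: "sets path_M = sigma_sets UNIV {{f. f i \<in> A} | i (A :: 'v set). True}"
    unfolding path_M_def sets_PiM_single by simp
  have "sets path_M \<subseteq> sigma_sets UNIV ?G" unfolding eq
  proof (rule sigma_sets_mono, safe)
    fix i and A :: "'v set"
    have c: "countable (lists (UNIV :: 'v set))" using V by (rule countable_lists)
    have "{f. f i \<in> A} = (\<Union>xs\<in>{xs \<in> lists UNIV. length xs = Suc i \<and> xs ! i \<in> A}. cyl i (\<lambda>j. xs ! j))"
      by (rule ex_cyl_list) (simp del: upt_Suc)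
    moreover have "\<dots> \<in> sigma_sets UNIV ?G"
      by (rule sigma_sets_UNION) (use c in \<open>auto intro!: countable_image intro: countable_subset\<close>)
    ultimately show "{f. f i \<in> A} \<in> sigma_sets UNIV ?G" by simp
  qed
  moreover have "sigma_sets UNIV ?G \<subseteq> sets path_M"
    using sets.sigma_sets_subset[of ?G path_M] cyl_sets by auto
  ultimately show ?thesis by (rule equalityI)
qed

lemma path_measure_eqI:
  assumes V: "countable (UNIV :: 'v set)"
    and M: "sets M = sets path_M" and N: "sets N = sets path_M"
    and eq: "\<And>n (p :: nat \<Rightarrow> 'v). emeasure M (cyl n p) = emeasure N (cyl n p)"
    and fin: "finite_measure M"
  shows "M = N"
proof (rule measure_eqI_generator_eq)
  let ?G = "insert {} {cyl n p | n (p :: nat \<Rightarrow> 'v). True}"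
  show "Int_stable ?G"
  proof (rule Int_stableI)
    fix a b assume "a \<in> ?G" "b \<in> ?G"
    then consider "a \<inter> b = {}" | n p m q where "a = cyl n p" "b = cyl m q" by blast
    then show "a \<inter> b \<in> ?G"
    proof cases
      case 2
      then show ?thesis using cyl_Int[of n p m q] by auto
    qed simp
  qed
  show "sets M = sigma_sets UNIV ?G" "sets N = sigma_sets UNIV ?G" using sets_path_M_cyl[OF V] M N by auto
  let ?A = "\<lambda>i. cyl 0 (\<lambda>_. from_nat_into (UNIV :: 'v set) i)"
  show "range ?A \<subseteq> ?G" by auto
  show "(\<Union>i. ?A i) = UNIV"
  proof (intro set_eqI iffI UNIV_I)
    fix \<omega> :: "nat \<Rightarrow> 'v"
    obtain i where "from_nat_into UNIV i = \<omega> 0" using from_nat_into_surj[OF V] by blast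
    then have "\<omega> \<in> ?A i" by (simp add: cyl_def)
    then show "\<omega> \<in> (\<Union>i. ?A i)" by (rule UN_I[OF UNIV_I])
  qed
  show "emeasure M (?A i) \<noteq> \<infinity>" for i using finite_measure.emeasure_finite[OF fin] by simp
qed (use eq in auto)

section \<open>Existence and uniqueness of the walk law\<close>

locale infinite_transitive_graph = transitive_graph E for E :: "'v \<Rightarrow> 'v \<Rightarrow> bool" +
  assumes infinite_V: "infinite (UNIV :: 'v set)"
begin

definition d :: nat where "d = deg E undefined"

lemma deg_eq: "deg E x = d"
proof -
  obtain f where f: "automorphism E f" "f x = undefined" using ex_automorphism by blast
  have bij: "bij f" and EE: "\<And>a b. E (f a) (f b) \<longleftrightarrow> E a b" using f by (auto simp: automorphism_def)
  have "f ` {y. E x y} = {y. E (f x) y}"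
    using bij_is_surj[OF bij] EE by (auto simp: image_iff) (metis surjD)
  then show ?thesis unfolding d_def deg_def f(2)[symmetric]
    using bij by (metis bij_is_inj card_image inj_on_subset subset_UNIV)
qed

lemma card_nbrs: "card {y. E x y} = d"
  using deg_eq[of x] by (simp add: deg_def)

lemma d_pos: "d > 0"
proof (rule ccontr)
  assume "\<not> d > 0"
  then have no: "\<not> E x y" for x y using card_nbrs[of x] finite_nbrs[of x] by auto
  have "x = y" for x y :: 'v
  proof -
    have "E^** x y" using connected by (simp add: graph_connected_def)
    then show ?thesis by (induction rule: rtranclp_induct) (use no in auto)
  qed
  then have "UNIV = {undefined :: 'v}" by blast
  then show False using infinite_V by (metis finite.emptyI finite.insertI)
qed

text \<open>All degrees equal \<open>d\<close>, so one i.i.d. sequence of uniform choices from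
  \<open>{..<d}\<close> drives the walk, each choice selecting a neighbour by an enumeration.
  Existence is what gives the definite description \<open>srw\<close> a meaning.\<close>

lemma ex_srw_law: "\<exists>P. is_srw_law E x P"
proof -
  have "\<exists>h. bij_betw h {..<d} {y. E v y}" for v
    using ex_bij_betw_nat_finite[OF finite_nbrs[of v]] card_nbrs[of v] by (simp add: atLeast0LessThan)
  then obtain nb where nb: "\<And>v. bij_betw (nb v) {..<d} {y. E v y}" by metis
  define U where "U = measure_pmf (pmf_of_set {..<d})"
  define M0 where "M0 = PiM (UNIV :: nat set) (\<lambda>_. U)"
  interpret U: prob_space U unfolding U_def by (rule measure_pmf.prob_space_axioms)
  interpret product_prob_space "\<lambda>_ :: nat. U" UNIV ..
  define X where "X = (\<lambda>\<xi> n. rec_nat x (\<lambda>n v. nb v (\<xi> n)) n)"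
  have X0: "X \<xi> 0 = x" and XS: "X \<xi> (Suc n) = nb (X \<xi> n) (\<xi> n)" for \<xi> n by (auto simp: X_def)
  have spaceM0: "space M0 = UNIV" by (simp add: M0_def space_PiM U_def)
  have m\<xi>: "(\<lambda>\<xi>. g (\<xi> n)) \<in> M0 \<rightarrow>\<^sub>M count_space UNIV" for n and g :: "nat \<Rightarrow> 'v"
  proof (rule measurable_compose[of "\<lambda>\<xi>. \<xi> n" M0 U g])
    show "(\<lambda>\<xi>. \<xi> n) \<in> M0 \<rightarrow>\<^sub>M U" unfolding M0_def by simp
    show "g \<in> U \<rightarrow>\<^sub>M count_space UNIV" by (simp add: U_def)
  qed
  have mX: "(\<lambda>\<xi>. X \<xi> n) \<in> M0 \<rightarrow>\<^sub>M count_space UNIV" for n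
  proof (induction n)
    case (Suc n)
    show ?case unfolding XS
      by (rule measurable_compose_countable'[OF m\<xi> Suc countable_V])
  qed (simp add: X0)
  have mX': "X \<in> M0 \<rightarrow>\<^sub>M path_M" by (rule measurable_into_path) (rule mX)
  have step: "emeasure U {j. nb v j = w} = ennreal (if E v w then 1 / d else 0)" for v w
  proof -
    have fin: "finite {..<d}" "{..<d} \<noteq> {}" using d_pos by auto
    have "card ({..<d} \<inter> {j. nb v j = w}) = (if E v w then 1 else 0)"
    proof (cases "E v w")
      case True
      then have "w \<in> nb v ` {..<d}" using nb[of v] by (simp add: bij_betw_def)
      then obtain j where j: "j < d" "nb v j = w" by blast
      then have "{..<d} \<inter> {j. nb v j = w} = {j}" using nb[of v] by (auto simp: bij_betw_def inj_on_def)
      then show ?thesis using True by simp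
    next
      case False
      then have "{..<d} \<inter> {j. nb v j = w} = {}" using nb[of v] by (auto simp: bij_betw_def)
      then show ?thesis using False by simp
    qed
    then show ?thesis unfolding U_def
      by (simp add: measure_pmf.emeasure_eq_measure measure_pmf_of_set[OF fin(2,1)])
  qed
  define P where "P = distr M0 path_M X"
  have "is_srw_law E x P" unfolding is_srw_law_def
  proof (intro conjI allI)
    show "sets P = sets path_M" by (simp add: P_def)
    have "prob_space M0" unfolding M0_def by (rule prob_space_axioms)
    then show "prob_space P" unfolding P_def by (rule prob_space.prob_space_distr[OF _ mX'])
    fix n and p :: "nat \<Rightarrow> 'v"
    have path: "(\<forall>i\<le>n. X \<xi> i = p i) \<longleftrightarrow> p 0 = x \<and> (\<forall>i<n. nb (p i) (\<xi> i) = p (Suc i))" for \<xi>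
    proof (induction n)
      case 0 show ?case by (auto simp: X0)
    next
      case (Suc n)
      have "(\<forall>i\<le>Suc n. X \<xi> i = p i) \<longleftrightarrow> (\<forall>i\<le>n. X \<xi> i = p i) \<and> nb (p n) (\<xi> n) = p (Suc n)"
        unfolding XS[symmetric] by (metis XS le_Suc_eq order_refl)
      then show ?case unfolding Suc by (auto simp: less_Suc_eq)
    qed
    have "emeasure P {\<omega> \<in> space path_M. \<forall>i\<le>n. \<omega> i = p i} = emeasure M0 {\<xi>. \<forall>i\<le>n. X \<xi> i = p i}"
      unfolding P_def using cyl_sets[of n p]
      by (subst emeasure_distr[OF mX']) (auto simp: cyl_def spaceM0 intro!: arg_cong2[where f=emeasure])
    also have "\<dots> = ennreal (srw_weight E x n p)"
    proof (cases "p 0 = x")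
      case False then show ?thesis by (simp add: path srw_weight_def)
    next
      case True
      have "emeasure M0 {\<xi>. \<forall>i\<le>n. X \<xi> i = p i} = emeasure M0 {\<xi> \<in> space M0. \<forall>i\<in>{..<n}. \<xi> i \<in> {j. nb (p i) j = p (Suc i)}}"
        by (simp add: path True spaceM0 Ball_def)
      also have "\<dots> = (\<Prod>i<n. emeasure U {j. nb (p i) j = p (Suc i)})"
        unfolding M0_def by (rule emeasure_PiM_Collect) (auto simp: U_def)
      also have "\<dots> = (\<Prod>i<n. ennreal (if E (p i) (p (Suc i)) then 1 / d else 0))" by (simp add: step)
      also have "\<dots> = ennreal (\<Prod>i<n. if E (p i) (p (Suc i)) then 1 / d else 0)" by (rule prod_ennreal) auto
      also have "(\<Prod>i<n. if E (p i) (p (Suc i)) then 1 / real d else 0) = srw_weight E x n p"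
      proof (cases "\<forall>i<n. E (p i) (p (Suc i))")
        case False
        then have "(\<Prod>i<n. if E (p i) (p (Suc i)) then 1 / real d else 0) = 0" by (intro prod_zero) auto
        then show ?thesis using False by (auto simp: srw_weight_def)
      qed (simp add: srw_weight_def True deg_eq)
      finally show ?thesis .
    qed
    finally show "emeasure P {\<omega> \<in> space path_M. \<forall>i\<le>n. \<omega> i = p i} = ennreal (srw_weight E x n p)" .
  qed
  then show ?thesis ..
qed

lemma srw_law_unique:
  assumes "is_srw_law E x P" "is_srw_law E x P'" shows "P = P'"
  by (rule path_measure_eqI[OF countable_V])
    (use assms in \<open>auto simp: is_srw_law_def cyl_def prob_space.finite_measure\<close>)

lemma srw_law: "is_srw_law E x (srw E x)"
  unfolding srw_def by (rule theI') (use ex_srw_law srw_law_unique in blast)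

lemma srw_eqI: "is_srw_law E x P \<Longrightarrow> srw E x = P"
  using srw_law srw_law_unique by blast

lemma sets_srw[measurable_cong]: "sets (srw E x) = sets path_M" and prob_space_srw: "prob_space (srw E x)"
  and emeasure_cyl: "emeasure (srw E x) (cyl n p) = ennreal (srw_weight E x n p)"
  using srw_law[of x] by (auto simp: is_srw_law_def cyl_def)

lemma space_srw[simp]: "space (srw E x) = UNIV"
  using sets_eq_imp_space_eq[OF sets_srw] by simp

sublocale srw: prob_space "srw E x" for x
  by (rule prob_space_srw)

lemma srw_weight_Suc:
  "srw_weight E x (Suc n) p = (if p 0 = x \<and> E x (p 1) then srw_weight E (p 1) n (sh p) / d else 0)"
proof -
  have "(\<forall>i<Suc n. E (p i) (p (Suc i))) \<longleftrightarrow> E (p 0) (p 1) \<and> (\<forall>i<n. E (sh p i) (sh p (Suc i)))"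
    by (simp add: All_less_Suc2 sh_def)
  then show ?thesis by (auto simp: srw_weight_def deg_eq sh_def)
qed

end

section \<open>Markov property and return probabilities\<close>

context infinite_transitive_graph begin

abbreviation P :: "'v \<Rightarrow> (nat \<Rightarrow> 'v) set \<Rightarrow> real" where "P x B \<equiv> measure (srw E x) B"

lemma sh_vimage_sets: "B \<in> sets path_M \<Longrightarrow> {\<omega>. (sh ^^ n) \<omega> \<in> B} \<in> sets path_M"
  using measurable_sets[OF measurable_funpow_sh, of B n] by (simp add: vimage_def)

lemma sh_vimage_sets1: "B \<in> sets path_M \<Longrightarrow> {\<omega>. sh \<omega> \<in> B} \<in> sets path_M"
  using sh_vimage_sets[of B 1] by simp

lemma coord_sets: "{\<omega>. Q (\<omega> i)} \<in> sets path_M"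
  using pred_path_coord[of Q i] by (simp add: pred_def)

lemma AE_start: "AE \<omega> in srw E x. \<omega> 0 = x"
proof -
  have "P x (cyl 0 (\<lambda>_. x)) = 1" using emeasure_cyl[of x 0 "\<lambda>_. x"]
    by (simp add: srw_weight_def measure_def)
  then have "AE \<omega> in srw E x. \<omega> \<in> cyl 0 (\<lambda>_. x)" by (intro srw.AE_prob_1)
  then show ?thesis by (simp add: cyl_def)
qed

lemma AE_walk: "AE \<omega> in srw E x. \<forall>n. E (\<omega> n) (\<omega> (Suc n))"
  unfolding AE_all_countable
proof
  fix n
  have "{\<omega>. \<not> E (\<omega> n) (\<omega> (Suc n))} =
     (\<Union>xs\<in>{xs \<in> lists UNIV. length xs = Suc (Suc n) \<and> \<not> E (xs ! n) (xs ! Suc n)}. cyl (Suc n) (\<lambda>j. xs ! j))"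
    by (rule ex_cyl_list) (simp del: upt_Suc)
  also have "\<dots> \<in> null_sets (srw E x)"
  proof (rule null_sets_UN')
    show "countable {xs \<in> lists UNIV. length xs = Suc (Suc n) \<and> \<not> E (xs ! n) (xs ! Suc n)}"
      by (rule countable_subset[OF _ countable_lists[OF countable_V]]) auto
    fix xs assume xs: "xs \<in> {xs \<in> lists UNIV. length xs = Suc (Suc n) \<and> \<not> E (xs ! n) (xs ! Suc n)}"
    show "cyl (Suc n) (\<lambda>j. xs ! j) \<in> null_sets (srw E x)"
      using xs by (intro null_setsI) (auto simp: emeasure_cyl srw_weight_def cyl_sets sets_srw)
  qed
  finally show "AE \<omega> in srw E x. E (\<omega> n) (\<omega> (Suc n))"
    using AE_not_in[of "{\<omega>. \<not> E (\<omega> n) (\<omega> (Suc n))}" "srw E x"] by simp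
qed

lemma cyl_Suc: "cyl (Suc n) (case_nat x q) = {\<omega>. \<omega> 0 = x \<and> sh \<omega> \<in> cyl n q}"
proof -
  have "(\<forall>i\<le>Suc n. Q i) \<longleftrightarrow> Q 0 \<and> (\<forall>i\<le>n. Q (Suc i))" for Q
    unfolding less_Suc_eq_le[symmetric] by (rule All_less_Suc2)
  then show ?thesis by (simp add: cyl_def sh_def)
qed

text \<open>As functions of \<open>B\<close> both sides are finite measures, so cylinders suffice;
  there \<open>srw_weight_Suc\<close> splits off the first step.\<close>

lemma emeasure_srw_step:
  assumes xy: "E x y" and B: "B \<in> sets path_M"
  shows "emeasure (srw E x) {\<omega>. \<omega> 1 = y \<and> sh \<omega> \<in> B} = ennreal (1 / d) * emeasure (srw E y) B"
proof -
  define M1 where "M1 = distr (density (srw E x) (indicator {\<omega>. \<omega> 1 = y})) path_M sh"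
  have S: "{\<omega>. \<omega> 1 = y} \<in> sets path_M" by (rule coord_sets)
  have M1: "emeasure M1 B = emeasure (srw E x) {\<omega>. \<omega> 1 = y \<and> sh \<omega> \<in> B}" if B: "B \<in> sets path_M" for B
  proof -
    have "emeasure M1 B = emeasure (srw E x) ({\<omega>. \<omega> 1 = y} \<inter> sh -` B)" unfolding M1_def
      by (rule emeasure_distr_density_indicator[OF _ _ B])
        (use S measurable_sh in \<open>auto simp: sets_srw measurable_cong_sets[OF sets_srw refl]\<close>)
    then show ?thesis by (simp add: vimage_def Int_def)
  qed
  have "M1 = scale_measure (ennreal (1 / d)) (srw E y)"
  proof (rule path_measure_eqI[OF countable_V])
    show "sets M1 = sets path_M" by (simp add: M1_def)
    show "sets (scale_measure (ennreal (1 / d)) (srw E y)) = sets path_M" by (simp add: sets_srw)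
    have U: "(UNIV :: (nat \<Rightarrow> 'v) set) \<in> sets path_M" using sets.top[of path_M] by simp
    have "emeasure M1 UNIV \<le> 1" unfolding M1[OF U] by (rule srw.emeasure_le_1)
    moreover have "space M1 = UNIV" by (simp add: M1_def)
    ultimately show "finite_measure M1" by (intro finite_measureI) (auto simp: top_unique)
    fix n and q :: "nat \<Rightarrow> 'v"
    \<comment> \<open>Adding the almost sure starting point \<open>x\<close> makes the event a
      cylinder with one more coordinate.\<close>
    have 1: "{\<omega>. \<omega> 1 = y \<and> sh \<omega> \<in> cyl n q} \<inter> {\<omega>. \<omega> 0 = x} =
       (if q 0 = y then cyl (Suc n) (case_nat x q) else {})"
      unfolding cyl_Suc by (auto simp: cyl_def sh_def)
    have m: "{\<omega>. \<omega> 1 = y \<and> sh \<omega> \<in> cyl n q} \<in> sets (srw E x)"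
      using sets.Int[OF S sh_vimage_sets1[OF cyl_sets[of n q]]] by (simp add: sets_srw Int_def)
    have "emeasure M1 (cyl n q) = emeasure (srw E x) {\<omega>. \<omega> 1 = y \<and> sh \<omega> \<in> cyl n q}"
      by (rule M1[OF cyl_sets])
    also have "\<dots> = emeasure (srw E x) ({\<omega>. \<omega> 1 = y \<and> sh \<omega> \<in> cyl n q} \<inter> {\<omega>. \<omega> 0 = x})"
    proof (rule emeasure_eq_AE)
      show "AE \<omega> in srw E x. \<omega> \<in> {\<omega>. \<omega> 1 = y \<and> sh \<omega> \<in> cyl n q} \<longleftrightarrow>
          \<omega> \<in> {\<omega>. \<omega> 1 = y \<and> sh \<omega> \<in> cyl n q} \<inter> {\<omega>. \<omega> 0 = x}"
        using AE_start[of x] by eventually_elim simp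
    qed (use m sets.Int[OF m, of "{\<omega>. \<omega> 0 = x}"] coord_sets[of "\<lambda>v. v = x" 0] in \<open>simp_all add: sets_srw\<close>)
    also have "\<dots> = ennreal (1 / d) * emeasure (srw E y) (cyl n q)"
    proof (cases "q 0 = y")
      case True
      have "sh (case_nat x q) = q" by (auto simp: sh_def)
      then show ?thesis unfolding 1 using True xy
        by (simp add: emeasure_cyl srw_weight_Suc flip: ennreal_mult')
    next
      case False
      then show ?thesis unfolding 1 by (simp add: emeasure_cyl srw_weight_def)
    qed
    finally show "emeasure M1 (cyl n q) = emeasure (scale_measure (ennreal (1 / d)) (srw E y)) (cyl n q)" by simp
  qed
  then show ?thesis using M1[OF B] by simp
qed

lemma srw_step:
  assumes xy: "E x y" and B: "B \<in> sets path_M"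
  shows "P x {\<omega>. \<omega> 1 = y \<and> sh \<omega> \<in> B} = P y B / d"
  using emeasure_srw_step[OF assms] by (simp add: measure_def enn2real_mult)

lemma first_step:
  assumes B: "B \<in> sets path_M"
  shows "P x {\<omega>. sh \<omega> \<in> B} = (\<Sum>z | E x z. P z B) / d"
proof -
  let ?A = "\<lambda>z. {\<omega>. \<omega> 1 = z \<and> sh \<omega> \<in> B}"
  have A: "?A z \<in> sets (srw E x)" for z
    using sets.Int[OF coord_sets[of "\<lambda>v. v = z" 1] sh_vimage_sets1[OF B]] by (simp add: sets_srw Int_def)
  have "P x {\<omega>. sh \<omega> \<in> B} = P x (\<Union>z\<in>{z. E x z}. ?A z)"
  proof (rule measure_eq_AE)
    show "AE \<omega> in srw E x. \<omega> \<in> {\<omega>. sh \<omega> \<in> B} \<longleftrightarrow> \<omega> \<in> (\<Union>z\<in>{z. E x z}. ?A z)"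
      using AE_start[of x] AE_walk[of x]
    proof eventually_elim
      case (elim \<omega>)
      then have "E x (\<omega> 1)" by (metis One_nat_def)
      then show ?case by auto
    qed
  qed (use A finite_nbrs[of x] sh_vimage_sets1[OF B] in \<open>auto simp: sets_srw\<close>)
  also have "\<dots> = (\<Sum>z | E x z. P x (?A z))"
    by (rule srw.finite_measure_finite_Union) (use A finite_nbrs[of x] in \<open>auto simp: disjoint_family_on_def\<close>)
  also have "\<dots> = (\<Sum>z | E x z. P z B / d)" by (intro sum.cong refl srw_step B) auto
  finally show ?thesis by (simp add: sum_divide_distrib)
qed

lemma srw_automorphism:
  assumes f: "automorphism E f"
  shows "srw E (f x) = distr (srw E x) path_M (\<lambda>\<omega> i. f (\<omega> i))"
proof (rule srw_eqI)
  have bij: "bij f" and EE: "\<And>a b. E (f a) (f b) \<longleftrightarrow> E a b" using f by (auto simp: automorphism_def)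
  have m: "(\<lambda>\<omega> i. f (\<omega> i)) \<in> srw E x \<rightarrow>\<^sub>M path_M"
    using measurable_map_path[of f] by (simp add: measurable_cong_sets[OF sets_srw refl])
  show "is_srw_law E (f x) (distr (srw E x) path_M (\<lambda>\<omega> i. f (\<omega> i)))"
    unfolding is_srw_law_def
  proof (intro conjI allI)
    show "prob_space (distr (srw E x) path_M (\<lambda>\<omega> i. f (\<omega> i)))" by (rule srw.prob_space_distr[OF m])
    fix n and p :: "nat \<Rightarrow> 'v"
    have "\<exists>v. f v = p i" for i using bij_is_surj[OF bij] by (metis surjD)
    then obtain q where q0: "\<And>i. f (q i) = p i" by metis
    have q: "p = (\<lambda>i. f (q i))" using q0 by auto
    have inj: "f a = f b \<longleftrightarrow> a = b" for a b using bij by (metis bij_is_inj injD)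
    have "emeasure (distr (srw E x) path_M (\<lambda>\<omega> i. f (\<omega> i))) {\<omega> \<in> space path_M. \<forall>i\<le>n. \<omega> i = p i}
        = emeasure (srw E x) (cyl n q)"
      using cyl_sets[of n p]
      by (subst emeasure_distr[OF m]) (auto simp: cyl_def q inj intro!: arg_cong2[where f=emeasure])
    also have "\<dots> = ennreal (srw_weight E (f x) n p)"
      by (auto simp: emeasure_cyl srw_weight_def q inj EE deg_eq)
    finally show "emeasure (distr (srw E x) path_M (\<lambda>\<omega> i. f (\<omega> i))) {\<omega> \<in> space path_M. \<forall>i\<le>n. \<omega> i = p i}
      = ennreal (srw_weight E (f x) n p)" .
  qed simp
qed

lemma P_automorphism:
  assumes f: "automorphism E f" and B: "B \<in> sets path_M"
  shows "P (f x) B = P x {\<omega>. (\<lambda>i. f (\<omega> i)) \<in> B}"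
  unfolding srw_automorphism[OF f] using measurable_map_path[of f] B
  by (subst measure_distr) (auto simp: measurable_cong_sets[OF sets_srw refl] vimage_def)

definition pn :: "nat \<Rightarrow> 'v \<Rightarrow> 'v \<Rightarrow> real" where
  "pn n x y = P x {\<omega>. \<omega> n = y}"

lemma pn_nonneg: "pn n x y \<ge> 0" by (simp add: pn_def)

lemma pn_0: "pn 0 x y = (if x = y then 1 else 0)"
proof -
  have "pn 0 x y = measure (srw E x) (if x = y then UNIV else {})"
    unfolding pn_def by (rule measure_eq_AE) (use AE_start[of x] coord_sets sets.top[of path_M] in \<open>auto simp: sets_srw\<close>)
  then show ?thesis using srw.prob_space by auto
qed

lemma markov:
  assumes B: "B \<in> sets path_M" shows "P x {\<omega>. \<omega> n = y \<and> (sh ^^ n) \<omega> \<in> B} = pn n x y * P y B"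
proof (induction n arbitrary: x)
  case 0
  show ?case
  proof (cases "x = y")
    case True
    have "P x {\<omega>. \<omega> 0 = y \<and> (sh ^^ 0) \<omega> \<in> B} = P x B"
      by (rule measure_eq_AE) (use True AE_start[of x] B sets.Int[OF coord_sets[of "\<lambda>v. v = y" 0] B] in \<open>auto simp: sets_srw Int_def\<close>)
    then show ?thesis using True by (simp add: pn_0)
  next
    case False
    have "P x {\<omega>. \<omega> 0 = y \<and> (sh ^^ 0) \<omega> \<in> B} = P x {}"
      by (rule measure_eq_AE) (use False AE_start[of x] B sets.Int[OF coord_sets[of "\<lambda>v. v = y" 0] B] in \<open>auto simp: sets_srw Int_def\<close>)
    then show ?thesis using False by (simp add: pn_0)
  qed
next
  case (Suc n)
  let ?B = "{\<omega>. \<omega> n = y \<and> (sh ^^ n) \<omega> \<in> B}"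
  have m: "?B \<in> sets path_M" using sets.Int[OF coord_sets[of "\<lambda>v. v = y" n] sh_vimage_sets[OF B, of n]] by (simp add: Int_def)
  have m': "{\<omega>. \<omega> n = y} \<in> sets path_M" by (rule coord_sets)
  have "P x {\<omega>. \<omega> (Suc n) = y \<and> (sh ^^ Suc n) \<omega> \<in> B} = P x {\<omega>. sh \<omega> \<in> ?B}"
    by (simp only: funpow_Suc_right o_def mem_Collect_eq) (simp add: sh_def)
  also have "\<dots> = (\<Sum>z | E x z. pn n z y * P y B) / d" unfolding first_step[OF m] by (simp only: Suc)
  also have "\<dots> = (\<Sum>z | E x z. pn n z y) / d * P y B" by (simp add: sum_distrib_right)
  also have "(\<Sum>z | E x z. pn n z y) / d = pn (Suc n) x y"
    using first_step[OF m', of x] by (simp add: pn_def sh_def)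
  finally show ?case .
qed

lemma pn_Suc: "pn (Suc n) x y = (\<Sum>z | E x z. pn n z y) / d"
  using first_step[OF coord_sets[of "\<lambda>v. v = y" n], of x] by (simp add: pn_def sh_def)

lemma pn_1: "pn 1 x y = (if E x y then 1 / d else 0)"
  using finite_nbrs[of x] by (simp add: pn_Suc pn_0 sum.delta)

lemma gball_Suc: "E x z \<Longrightarrow> gball E n z \<subseteq> gball E (Suc n) x"
proof
  fix y assume "E x z" "y \<in> gball E n z"
  moreover from this have "z \<in> gball E 1 x" by (auto simp: gball_def intro!: exI[of _ 1])
  ultimately show "y \<in> gball E (Suc n) x" using gball_trans[of z 1 x y n] by simp
qed

lemma pn_zero: "y \<notin> gball E n x \<Longrightarrow> pn n x y = 0"
proof (induction n arbitrary: x)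
  case 0 then show ?case using gball_self[of x 0] by (auto simp: pn_0)
next
  case (Suc n)
  have "pn n z y = 0" if "E x z" for z using Suc.IH[of z] gball_Suc[OF that] Suc.prems by blast
  then show ?case by (simp add: pn_Suc)
qed

lemma chapman_kolmogorov:
  "finite S \<Longrightarrow> gball E m x \<subseteq> S \<Longrightarrow> pn (m + n) x y = (\<Sum>z\<in>S. pn m x z * pn n z y)"
proof (induction m arbitrary: x)
  case 0
  then have "x \<in> S" using gball_self by blast
  have "(\<Sum>z\<in>S. pn 0 x z * pn n z y) = (\<Sum>z\<in>S. if x = z then pn n x y else 0)"
    by (intro sum.cong refl) (auto simp: pn_0)
  then show ?case using 0(1) \<open>x \<in> S\<close> by (simp add: sum.delta)
next
  case (Suc m)
  have "pn (Suc m + n) x y = (\<Sum>w | E x w. pn (m + n) w y) / d" by (simp add: pn_Suc)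
  also have "\<dots> = (\<Sum>w | E x w. \<Sum>z\<in>S. pn m w z * pn n z y) / d"
  proof -
    have "pn (m + n) w y = (\<Sum>z\<in>S. pn m w z * pn n z y)" if "E x w" for w
      by (rule Suc.IH[OF Suc.prems(1)]) (use Suc.prems(2) gball_Suc[OF that] in blast)
    then show ?thesis by simp
  qed
  also have "(\<Sum>w | E x w. \<Sum>z\<in>S. pn m w z * pn n z y) = (\<Sum>z\<in>S. (\<Sum>w | E x w. pn m w z) * pn n z y)"
    by (subst sum.swap) (simp add: sum_distrib_right)
  also have "\<dots> / d = (\<Sum>z\<in>S. pn (Suc m) x z * pn n z y)"
    unfolding pn_Suc times_divide_eq_left sum_divide_distrib[symmetric] by (rule refl)
  finally show ?case .
qed

text \<open>Constant degree makes the one-step kernel symmetric, and in the induction the first step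
  from \<open>x\<close> becomes the last step to \<open>x\<close>.\<close>

lemma pn_sym: "pn n x y = pn n y x"
proof (induction n arbitrary: x y)
  case 0 show ?case by (auto simp: pn_0)
next
  case (Suc n)
  define S where "S = gball E 1 x \<union> gball E n y"
  have S: "finite S" "gball E 1 x \<subseteq> S" "gball E n y \<subseteq> S" by (auto simp: S_def finite_gball)
  have "pn (1 + n) x y = (\<Sum>z\<in>S. pn 1 x z * pn n z y)" by (rule chapman_kolmogorov[OF S(1,2)])
  also have "\<dots> = (\<Sum>z\<in>S. pn n y z * pn 1 z x)"
  proof (intro sum.cong refl)
    fix z
    have "pn 1 x z = pn 1 z x" unfolding pn_1 using E_sym by auto
    then show "pn 1 x z * pn n z y = pn n y z * pn 1 z x" using Suc.IH[of z y] by simp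
  qed
  also have "\<dots> = pn (n + 1) y x" by (rule chapman_kolmogorov[OF S(1,3), symmetric])
  finally show ?case by simp
qed

lemma pn_diag: "pn n x x = pn n y y"
proof -
  obtain f where f: "automorphism E f" "f x = y" using ex_automorphism by blast
  have inj: "f a = f b \<longleftrightarrow> a = b" for a b using f(1) by (metis automorphism_def bij_is_inj injD)
  show ?thesis unfolding pn_def f(2)[symmetric]
    using P_automorphism[OF f(1) coord_sets[of "\<lambda>v. v = f x" n], of x] by (simp add: inj)
qed

text \<open>Split at time \<open>n\<close> and apply 2ab \<le> a^2 + b^2 together with symmetry; by
  transitivity the diagonal is the same at all vertices.\<close>

lemma pn_even_le: "pn (2 * n) x y \<le> pn (2 * n) c c"
proof -
  define S where "S = gball E n x \<union> gball E n y"
  have S: "finite S" "gball E n x \<subseteq> S" "gball E n y \<subseteq> S" by (auto simp: S_def finite_gball)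
  have "pn (n + n) x y = (\<Sum>z\<in>S. pn n x z * pn n z y)" by (rule chapman_kolmogorov[OF S(1,2)])
  also have "\<dots> \<le> (\<Sum>z\<in>S. (pn n x z * pn n z x + pn n y z * pn n z y) / 2)"
  proof (rule sum_mono)
    fix z
    have "0 \<le> (pn n x z - pn n y z)\<^sup>2" by simp
    then show "pn n x z * pn n z y \<le> (pn n x z * pn n z x + pn n y z * pn n z y) / 2"
      unfolding pn_sym[of n z y] pn_sym[of n z x] by (simp add: power2_eq_square algebra_simps)
  qed
  also have "\<dots> = (pn (n + n) x x + pn (n + n) y y) / 2"
    unfolding chapman_kolmogorov[OF S(1,2), of n x] chapman_kolmogorov[OF S(1,3), of n y]
    by (simp add: sum.distrib flip: sum_divide_distrib)
  also have "\<dots> = pn (n + n) c c" using pn_diag[of "n+n" x c] pn_diag[of "n+n" y c] by simp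
  finally show ?thesis by (simp add: mult_2)
qed

lemma pn_odd_le: "pn (Suc (2 * n)) x y \<le> pn (2 * n) c c"
proof -
  have "(\<Sum>z | E x z. pn (2 * n) z y) \<le> (\<Sum>z | E x z. pn (2 * n) c c)" by (intro sum_mono pn_even_le)
  also have "\<dots> = d * pn (2 * n) c c" by (simp add: card_nbrs)
  finally show ?thesis using d_pos by (simp add: pn_Suc field_simps)
qed

lemma pn_pos: "(E ^^ n) x y \<Longrightarrow> pn n x y > 0"
proof (induction n arbitrary: x)
  case 0 then show ?case by (simp add: pn_0)
next
  case (Suc n)
  then obtain z where z: "E x z" "(E ^^ n) z y" using relpowp_Suc_E2 by metis
  have "0 < pn n z y" using Suc.IH z by blast
  also have "\<dots> \<le> (\<Sum>z | E x z. pn n z y)"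
    by (rule member_le_sum) (use z finite_nbrs pn_nonneg in auto)
  finally show ?case using d_pos by (simp add: pn_Suc)
qed

end

section \<open>Hitting probabilities from transience\<close>

locale transient_transitive_graph = infinite_transitive_graph E for E :: "'v \<Rightarrow> 'v \<Rightarrow> bool" +
  assumes transient: "transient E"
begin

lemma pred_finite_visits: "Measurable.pred path_M (\<lambda>\<omega>. finite {n. \<omega> n = (y :: 'v)})"
proof -
  have *: "finite {n. \<omega> n = y} \<longleftrightarrow> (\<exists>N. \<forall>n. N \<le> n \<longrightarrow> \<omega> n \<noteq> y)" for \<omega> :: "nat \<Rightarrow> 'v"
    unfolding finite_nat_set_iff_bounded by (auto simp: not_less) (metis linorder_not_less)+
  show ?thesis unfolding *
    by (intro pred_intros_countable pred_intros_logic pred_path_coord[of "\<lambda>v. v \<noteq> y"]) auto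
qed

text \<open>\<open>transient\<close> speaks of returns to the starting vertex. Were infinitely many
  visits to \<open>y\<close> possible from \<open>x\<close>, the walk from \<open>y\<close> could go
  to \<open>x\<close> first and would then return to \<open>y\<close> infinitely often with positive
  probability.\<close>

lemma AE_transient: "AE \<omega> in srw E x. finite {n. \<omega> n = y}"
proof -
  define B where "B = {\<omega> :: nat \<Rightarrow> 'v. infinite {n. \<omega> n = y}}"
  have B: "B \<in> sets path_M" unfolding B_def
  proof -
    have "Measurable.pred path_M (\<lambda>\<omega>. \<not> finite {n. \<omega> n = y})" by (intro pred_intros_logic pred_finite_visits)
    then show "{\<omega>. infinite {n. \<omega> n = y}} \<in> sets path_M" by (simp add: pred_def)
  qed
  obtain n where n: "(E ^^ n) y x" using connected unfolding graph_connected_def rtranclp_power by blast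
  have "P y {\<omega>. \<omega> n = x \<and> (sh ^^ n) \<omega> \<in> B} \<le> P y {}"
  proof (rule srw.finite_measure_mono_AE)
    have "AE \<omega> in srw E y. finite {n. \<omega> n = y}" using transient by (simp add: transient_def)
    then show "AE \<omega> in srw E y. \<omega> \<in> {\<omega>. \<omega> n = x \<and> (sh ^^ n) \<omega> \<in> B} \<longrightarrow> \<omega> \<in> {}"
    proof eventually_elim
      case (elim \<omega>)
      have "finite {i. (sh ^^ n) \<omega> i = y}"
        using finite_vimageI[OF elim, of "\<lambda>i. n + i"] by (simp add: vimage_def funpow_sh)
      then show ?case by (simp add: B_def)
    qed
  qed simp
  then have "pn n y x * P x B \<le> 0" by (simp add: markov[OF B])
  then have "P x B = 0" using pn_pos[OF n] measure_nonneg[of "srw E x" B] by (simp add: mult_le_0_iff)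
  then show ?thesis
    by (intro AE_I[of _ _ B]) (use B in \<open>auto simp: B_def sets_srw srw.emeasure_eq_measure\<close>)
qed

lemma escape_sets: "escape K \<in> sets path_M"
proof -
  have "Measurable.pred path_M (\<lambda>\<omega>. \<forall>n. 1 \<le> n \<longrightarrow> \<omega> n \<notin> K)"
    by (intro pred_intros_countable pred_intros_logic pred_path_coord[of "\<lambda>v. v \<notin> K"]) auto
  then show ?thesis by (simp add: escape_def pred_def)
qed

text \<open>Decomposing at the last visit to $x$ gives $\sum_n p_n(x,x) P_x[\tilde H_x = \infty] = 1$.\<close>

lemma summable_pn: "summable (\<lambda>n. pn n x x)"
proof -
  let ?A = "\<lambda>n. {\<omega>. \<omega> n = x \<and> (sh ^^ n) \<omega> \<in> escape {x}}"
  have A: "?A n \<in> sets (srw E x)" for n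
    using sets.Int[OF coord_sets[of "\<lambda>v. v = x" n] sh_vimage_sets[OF escape_sets, of n "{x}"]] by (simp add: sets_srw Int_def)
  have last: "\<omega> \<in> ?A n \<longleftrightarrow> \<omega> n = x \<and> (\<forall>m>n. \<omega> m \<noteq> x)" for \<omega> n
  proof -
    have "(\<forall>i\<ge>1. \<omega> (n + i) \<noteq> x) \<longleftrightarrow> (\<forall>m>n. \<omega> m \<noteq> x)"
      by (metis One_nat_def Suc_leI add.commute add_diff_cancel_left' less_add_same_cancel1 less_imp_add_positive less_eq_Suc_le)
    then show ?thesis by (simp add: escape_def funpow_sh)
  qed
  have "disjoint_family ?A"
    unfolding disjoint_family_on_def disjoint_iff last by (metis nat_neq_iff)
  then have "(\<lambda>n. P x (?A n)) sums P x (\<Union>n. ?A n)"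
    by (intro srw.finite_measure_UNION) (use A in auto)
  moreover have "P x (\<Union>n. ?A n) = P x UNIV"
  proof (rule measure_eq_AE)
    show "AE \<omega> in srw E x. \<omega> \<in> (\<Union>n. ?A n) \<longleftrightarrow> \<omega> \<in> UNIV" using AE_start[of x] AE_transient[of x x]
    proof eventually_elim
      case (elim \<omega>)
      let ?n = "Max {n. \<omega> n = x}"
      have "?n \<in> {n. \<omega> n = x}" using elim by (intro Max_in) auto
      moreover have "m \<le> ?n" if "\<omega> m = x" for m using elim(2) that by (intro Max_ge) auto
      ultimately have "\<omega> \<in> ?A ?n" unfolding last by (metis linorder_not_less mem_Collect_eq)
      then show ?case by blast
    qed
  qed (use A sets.top[of path_M] in \<open>auto simp: sets_srw\<close>)
  ultimately have s: "(\<lambda>n. pn n x x * P x (escape {x})) sums 1"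
    using srw.prob_space[of x] by (simp add: markov[OF escape_sets])
  then have "P x (escape {x}) \<noteq> 0" using sums_0 sums_unique2 by fastforce
  moreover have "summable (\<lambda>n. P x (escape {x}) * pn n x x)" using sums_summable[OF s] by (simp add: mult.commute)
  ultimately show ?thesis by (metis summable_mult_D)
qed

text \<open>A vertex outside the ball of radius \<open>2 * N\<close> is not reached before time
  \<open>2 * N\<close>, and the visits after that are bounded by the tail of a convergent series of
  return probabilities, uniformly in both vertices.\<close>

lemma hit_small:
  assumes e: "\<epsilon> > 0"
  shows "\<exists>R. \<forall>x y. y \<notin> gball E R x \<longrightarrow> P x {\<omega>. \<exists>n. \<omega> n = y} \<le> \<epsilon>"
proof -
  fix c :: 'v
  have sum: "summable (\<lambda>k. pn (2 * k) c c)"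
    using summable_reindex[OF summable_pn[of c], of "\<lambda>k. 2 * k"] by (simp add: o_def pn_nonneg inj_def)
  \<comment> \<open>Half of \<open>\<epsilon>\<close>, because each even return probability is used
    twice: for an even time and for the odd time after it.\<close>
  then obtain N where N: "\<And>n. n \<ge> N \<Longrightarrow> norm (\<Sum>i. pn (2 * (i + n)) c c) < \<epsilon> / 2"
    using suminf_exist_split[of "\<epsilon> / 2" "\<lambda>k. pn (2 * k) c c"] e by auto
  have "P x {\<omega>. \<exists>n. \<omega> n = y} \<le> \<epsilon>" if y: "y \<notin> gball E (2 * N) x" for x y
  proof -
    let ?A = "\<lambda>k. {\<omega>. \<omega> (2 * (k + N)) = y} \<union> {\<omega>. \<omega> (Suc (2 * (k + N))) = y}"
    have A: "?A k \<in> sets (srw E x)" for k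
      using sets.Un[OF coord_sets[of "\<lambda>v. v = y" "2 * (k + N)"] coord_sets[of "\<lambda>v. v = y" "Suc (2 * (k + N))"]]
      by (simp add: sets_srw)
    have le: "P x (?A k) \<le> 2 * pn (2 * (k + N)) c c" for k
    proof -
      have "P x (?A k) \<le> pn (2 * (k + N)) x y + pn (Suc (2 * (k + N))) x y"
        unfolding pn_def by (rule measure_Un_le) (use coord_sets in \<open>auto simp: sets_srw\<close>)
      then show ?thesis using pn_even_le[of "k+N" x y c] pn_odd_le[of "k+N" x y c] by simp
    qed
    have s: "summable (\<lambda>k. 2 * pn (2 * (k + N)) c c)"
      using summable_ignore_initial_segment[OF sum, of N] by (intro summable_mult)
    have sA: "summable (\<lambda>k. P x (?A k))"
      by (rule summable_comparison_test[OF _ s]) (use le in auto)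
    have nohit: "AE \<omega> in srw E x. \<forall>n<2 * N. \<omega> n \<noteq> y"
    proof (rule AE_all_countable[THEN iffD2], rule allI)
      fix n
      show "AE \<omega> in srw E x. n < 2 * N \<longrightarrow> \<omega> n \<noteq> y"
      proof (cases "n < 2 * N")
        case True
        then have "y \<notin> gball E n x" using y gball_mono[of n "2 * N" x] by auto
        then have "P x {\<omega>. \<omega> n = y} = 0" using pn_zero by (simp add: pn_def)
        then show ?thesis
          by (intro AE_I[of _ _ "{\<omega>. \<omega> n = y}"]) (use coord_sets in \<open>auto simp: sets_srw srw.emeasure_eq_measure\<close>)
      qed simp
    qed
    have "P x {\<omega>. \<exists>n. \<omega> n = y} \<le> P x (\<Union>k. ?A k)"
    proof (rule srw.finite_measure_mono_AE)
      show "AE \<omega> in srw E x. \<omega> \<in> {\<omega>. \<exists>n. \<omega> n = y} \<longrightarrow> \<omega> \<in> (\<Union>k. ?A k)"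
        using nohit
      proof eventually_elim
        case (elim \<omega>)
        show ?case
        proof
          assume "\<omega> \<in> {\<omega>. \<exists>n. \<omega> n = y}"
          then obtain n where n: "\<omega> n = y" by blast
          then have "\<not> n < 2 * N" using elim by blast
          then have "2 * N \<le> n" by simp
          moreover have "n = 2 * (n div 2) \<or> n = Suc (2 * (n div 2))" by presburger
          ultimately have "n = 2 * ((n div 2 - N) + N) \<or> n = Suc (2 * ((n div 2 - N) + N))" by auto
          then have "\<omega> \<in> ?A (n div 2 - N)" using n by auto
          then show "\<omega> \<in> (\<Union>k. ?A k)" by blast
        qed
      qed
    qed (use A in auto)
    also have "\<dots> \<le> (\<Sum>k. P x (?A k))"
      by (rule srw.finite_measure_subadditive_countably) (use A sA in auto)
    also have "\<dots> \<le> (\<Sum>k. 2 * pn (2 * (k + N)) c c)" by (rule suminf_le[OF le sA s])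
    also have "\<dots> = 2 * (\<Sum>k. pn (2 * (k + N)) c c)"
      using summable_ignore_initial_segment[OF sum, of N] by (rule suminf_mult)
    also have "\<dots> \<le> \<epsilon>" using N[of N] by simp
    finally show ?thesis .
  qed
  then show ?thesis by blast
qed

end

section \<open>Doubly infinite paths and the intensity measure\<close>

text \<open>Both halves contain time 0; this fits \<open>escape\<close>, which imposes its condition
  from time 1 on.\<close>

definition fwd :: "(int \<Rightarrow> 'v) \<Rightarrow> nat \<Rightarrow> 'v" where "fwd w = (\<lambda>n. w (int n))"
definition bwd :: "(int \<Rightarrow> 'v) \<Rightarrow> nat \<Rightarrow> 'v" where "bwd w = (\<lambda>n. w (- int n))"
definition dshift :: "int \<Rightarrow> (int \<Rightarrow> 'v) \<Rightarrow> int \<Rightarrow> 'v" where "dshift k w = (\<lambda>n. w (n + k))"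

definition walks :: "('v \<Rightarrow> 'v \<Rightarrow> bool) \<Rightarrow> (nat \<Rightarrow> 'v) set" where
  "walks E = {\<omega>. (\<forall>n. E (\<omega> n) (\<omega> (Suc n))) \<and> (\<forall>x. finite {n. \<omega> n = x})}"

text \<open>The ordered pairs in \<open>L\<close> stand for undirected edges, hence the test of both
  orientations.\<close>

definition unlinked :: "('v \<times> 'v) set \<Rightarrow> 'v \<Rightarrow> 'v \<Rightarrow> bool" where
  "unlinked L a b \<longleftrightarrow> (a, b) \<notin> L \<and> (b, a) \<notin> L"

definition avoiding :: "('v \<times> 'v) set \<Rightarrow> (nat \<Rightarrow> 'v) set" where
  "avoiding L = {\<omega>. \<forall>n. unlinked L (\<omega> n) (\<omega> (Suc n))}"

definition traversing :: "('v \<times> 'v) set \<Rightarrow> (int \<Rightarrow> 'v) set" where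
  "traversing L = {w. \<exists>k. \<not> unlinked L (w k) (w (k + 1))}"

definition hitting :: "'v set \<Rightarrow> (int \<Rightarrow> 'v) set" where
  "hitting K = {w. \<exists>n. w n \<in> K}"

text \<open>Only some representative has to be in \<open>T\<close>, so that \<open>T\<close> may
  prescribe the origin of time, as \<open>looping\<close> below does.\<close>

definition classes :: "('v \<Rightarrow> 'v \<Rightarrow> bool) \<Rightarrow> (int \<Rightarrow> 'v) set \<Rightarrow> (int \<Rightarrow> 'v) set set" where
  "classes E T = {c \<in> Wstar E. \<exists>w\<in>c. w \<in> T}"

lemma space_dpath_M[simp]: "space dpath_M = UNIV"
  by (auto simp: dpath_M_def space_PiM)

lemma measurable_dpath_coord: "(\<lambda>w. w i) \<in> dpath_M \<rightarrow>\<^sub>M count_space UNIV"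
  unfolding dpath_M_def by simp

lemma pred_dpath_coord: "Measurable.pred dpath_M (\<lambda>w. Q (w i))"
  by (rule measurable_compose[OF measurable_dpath_coord]) simp

lemma measurable_fwd: "fwd \<in> dpath_M \<rightarrow>\<^sub>M path_M"
  by (rule measurable_into_path) (simp add: fwd_def measurable_dpath_coord)

lemma measurable_bwd: "bwd \<in> dpath_M \<rightarrow>\<^sub>M path_M"
  by (rule measurable_into_path) (simp add: bwd_def measurable_dpath_coord)

lemma measurable_dshift: "dshift k \<in> dpath_M \<rightarrow>\<^sub>M dpath_M"
  unfolding dpath_M_def by (rule measurable_PiM_single') (auto simp: dshift_def)

lemma fwd_sets: "B \<in> sets path_M \<Longrightarrow> {w. fwd w \<in> B} \<in> sets dpath_M"
  using measurable_sets[OF measurable_fwd, of B] by (simp add: vimage_def)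

lemma bwd_sets: "B \<in> sets path_M \<Longrightarrow> {w. bwd w \<in> B} \<in> sets dpath_M"
  using measurable_sets[OF measurable_bwd, of B] by (simp add: vimage_def)

lemma dcoord_sets: "{w. Q (w i)} \<in> sets dpath_M"
  using pred_dpath_coord[of Q i] by (simp add: pred_def)

lemma int_cases_fwd_bwd: "(\<forall>k :: int. Q k) \<longleftrightarrow> (\<forall>n. Q (int n)) \<and> (\<forall>n. Q (- int n))"
  by (metis int_cases2)

text \<open>\<open>bwd\<close> reads the steps at negative times in the opposite direction, which is
  harmless because \<open>unlinked\<close> is symmetric.\<close>

lemma avoiding_fwd_bwd: "w \<notin> traversing L \<longleftrightarrow> fwd w \<in> avoiding L \<and> bwd w \<in> avoiding L"
proof -
  have "w \<notin> traversing L \<longleftrightarrow> (\<forall>k. unlinked L (w k) (w (k + 1)))" by (simp add: traversing_def)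
  also have "\<dots> \<longleftrightarrow> (\<forall>n. unlinked L (w (int n)) (w (int n + 1))) \<and> (\<forall>n. unlinked L (w (- int n - 1)) (w (- int n)))"
  proof safe
    fix k :: int assume 1: "\<forall>n. unlinked L (w (int n)) (w (int n + 1))" and 2: "\<forall>n. unlinked L (w (- int n - 1)) (w (- int n))"
    show "unlinked L (w k) (w (k + 1))"
    proof (cases "k \<ge> 0")
      case True then show ?thesis using 1[rule_format, of "nat k"] by simp
    next
      case False then show ?thesis using 2[rule_format, of "nat (- k - 1)"] by (simp add: add.commute)
    qed
  qed (metis diff_add_cancel)+
  also have "\<dots> \<longleftrightarrow> fwd w \<in> avoiding L \<and> bwd w \<in> avoiding L"
  proof -
    have e: "- 1 - int n = - int n - 1" "1 + int n = int n + 1" for n by auto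
    show ?thesis by (auto simp: avoiding_def fwd_def bwd_def unlinked_def e)
  qed
  finally show ?thesis .
qed

lemma pistar_eq: "w' \<in> pistar w \<longleftrightarrow> (\<exists>k. w' = dshift k w)"
  by (auto simp: pistar_def dshift_def)

lemma dshift_dshift[simp]: "dshift k (dshift l w) = dshift (k + l) w"
  by (simp add: dshift_def algebra_simps)

lemma dshift_0[simp]: "dshift 0 w = w"
  by (simp add: dshift_def)

lemma classes_vimage:
  "pistar -` classes E T \<inter> Wpaths E = {w. (\<exists>k. dshift k w \<in> T) \<and> w \<in> Wpaths E}"
proof -
  have "pistar w \<in> classes E T \<longleftrightarrow> (\<exists>k. dshift k w \<in> T)" if "w \<in> Wpaths E" for w
  proof -
    have "pistar w \<in> Wstar E" using that by (simp add: Wstar_def)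
    then show ?thesis unfolding classes_def mem_Collect_eq Bex_def pistar_eq by auto
  qed
  then show ?thesis by auto
qed

lemma dshift_traversing: "dshift k w \<in> traversing L \<longleftrightarrow> w \<in> traversing L"
proof -
  have *: "w \<in> traversing L \<Longrightarrow> dshift k w \<in> traversing L" for k and w :: "int \<Rightarrow> 'a"
  proof -
    assume "w \<in> traversing L"
    then obtain l where "\<not> unlinked L (w l) (w (l + 1))" by (auto simp: traversing_def)
    then have "\<not> unlinked L (dshift k w (l - k)) (dshift k w (l - k + 1))" by (simp add: dshift_def)
    then show "dshift k w \<in> traversing L" unfolding traversing_def by blast
  qed
  show ?thesis using *[of w k] *[of "dshift k w" "- k"] by auto
qed

lemma dshift_hitting: "dshift k w \<in> hitting K \<longleftrightarrow> w \<in> hitting K"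
proof
  assume "w \<in> hitting K"
  then obtain n where "dshift k w (n - k) \<in> K" by (auto simp: hitting_def dshift_def)
  then show "dshift k w \<in> hitting K" unfolding hitting_def by blast
qed (auto simp: hitting_def dshift_def)

lemma WstarK_eq: "WstarK E K = classes E (hitting K)"
  by (auto simp: WstarK_def classes_def hitting_def)

section \<open>Trajectory laws seen from a finite set\<close>

context transient_transitive_graph begin

lemma path_UNIV_sets: "UNIV \<in> sets (path_M :: (nat \<Rightarrow> 'v) measure)"
  using sets.top[of "path_M :: (nat \<Rightarrow> 'v) measure"] by simp

lemma avoiding_sets: "avoiding (L :: ('v \<times> 'v) set) \<in> sets path_M"
proof -
  have "{\<omega>. unlinked L (\<omega> n) (\<omega> (Suc n))} =
      (\<Union>a\<in>UNIV. {\<omega>. \<omega> n = a} \<inter> {\<omega>. unlinked L a (\<omega> (Suc n))})" for n by auto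
  moreover have "(\<Union>a\<in>UNIV. {\<omega>. \<omega> n = a} \<inter> {\<omega>. unlinked L a (\<omega> (Suc n))}) \<in> sets path_M" for n
    by (rule sets.countable_UN''[OF countable_V], rule sets.Int,
        rule coord_sets[of "\<lambda>v. v = _"], rule coord_sets[of "\<lambda>v. unlinked L _ v"])
  ultimately have *: "{\<omega>. unlinked L (\<omega> n) (\<omega> (Suc n))} \<in> sets path_M" for n by simp
  have "avoiding L = (\<Inter>n. {\<omega>. unlinked L (\<omega> n) (\<omega> (Suc n))})" by (auto simp: avoiding_def)
  also have "\<dots> \<in> sets path_M" by (rule sets.countable_INT'') (use path_UNIV_sets * in auto)
  finally show ?thesis .
qed

text \<open>Adjacency of successive vertices is avoidance of all non-edges, so walks inherit
  measurability and the splitting into two halves from \<open>avoiding\<close>.\<close>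

lemma walks_eq: "walks E = avoiding {(a, b). \<not> E a b} \<inter> (\<Inter>x. {\<omega>. finite {n. \<omega> n = x}})"
  using E_sym by (auto simp: walks_def avoiding_def unlinked_def)

lemma walks_sets: "walks E \<in> sets path_M"
  unfolding walks_eq
proof (intro sets.Int avoiding_sets sets.countable_INT'')
  show "countable (UNIV :: 'v set)" by (rule countable_V)
  show "{\<omega>. finite {n. \<omega> n = x}} \<in> sets path_M" for x :: 'v using pred_finite_visits[of x] by (simp add: pred_def)
qed (rule path_UNIV_sets)

lemma AE_walks: "AE \<omega> in srw E x. \<omega> \<in> walks E"
proof -
  have "AE \<omega> in srw E x. \<forall>y\<in>UNIV. finite {n. \<omega> n = y}"
    using AE_transient by (subst AE_ball_countable) (auto simp: countable_V)
  with AE_walk show ?thesis by eventually_elim (simp add: walks_def)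
qed

lemma Wpaths_eq: "w \<in> Wpaths E \<longleftrightarrow> fwd w \<in> walks E \<and> bwd w \<in> walks E"
proof -
  have 1: "(\<forall>n. E (w n) (w (n + 1))) \<longleftrightarrow> fwd w \<in> avoiding {(a, b). \<not> E a b} \<and> bwd w \<in> avoiding {(a, b). \<not> E a b}"
    using avoiding_fwd_bwd[of w "{(a, b). \<not> E a b}"] E_sym by (auto simp: traversing_def unlinked_def)
  have 2: "finite {n. w n = x} \<longleftrightarrow> finite {n. fwd w n = x} \<and> finite {n. bwd w n = x}" for x
  proof
    assume f: "finite {n. w n = x}"
    show "finite {n. fwd w n = x} \<and> finite {n. bwd w n = x}"
      using finite_vimageI[OF f, of int] finite_vimageI[OF f, of "\<lambda>n. - int n"]
      by (simp add: vimage_def fwd_def bwd_def inj_def)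
  next
    assume f: "finite {n. fwd w n = x} \<and> finite {n. bwd w n = x}"
    have "n \<in> int ` {n. fwd w n = x} \<union> (\<lambda>n. - int n) ` {n. bwd w n = x}" if "w n = x" for n
    proof (cases "n \<ge> 0")
      case True
      then have "n = int (nat n)" by simp
      then show ?thesis using that unfolding fwd_def by (metis (mono_tags) UnI1 image_eqI mem_Collect_eq)
    next
      case False
      then have "n = - int (nat (- n))" by simp
      then show ?thesis using that unfolding bwd_def by (metis (mono_tags) UnI2 image_eqI mem_Collect_eq)
    qed
    then have "{n. w n = x} \<subseteq> int ` {n. fwd w n = x} \<union> (\<lambda>n. - int n) ` {n. bwd w n = x}" by blast
    then show "finite {n. w n = x}" by (rule finite_subset) (use f in auto)
  qed
  show ?thesis unfolding walks_eq Wpaths_def using 1 2 by auto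
qed

lemma Wpaths_sets: "Wpaths E \<in> sets dpath_M"
proof -
  have "Wpaths E = {w. fwd w \<in> walks E} \<inter> {w. bwd w \<in> walks E}" using Wpaths_eq by auto
  then show ?thesis using fwd_sets[OF walks_sets] bwd_sets[OF walks_sets] by simp
qed

lemma traversing_sets: "traversing (L :: ('v \<times> 'v) set) \<in> sets dpath_M"
proof -
  have "traversing L = UNIV - ({w. fwd w \<in> avoiding L} \<inter> {w. bwd w \<in> avoiding L})" using avoiding_fwd_bwd by auto
  also have "\<dots> \<in> sets dpath_M"
    using sets.compl_sets[OF sets.Int[OF fwd_sets[OF avoiding_sets] bwd_sets[OF avoiding_sets]], of L L] by simp
  finally show ?thesis .
qed

lemma hitting_sets: "hitting (K :: 'v set) \<in> sets dpath_M"
proof -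
  have "hitting K = (\<Union>n. {w. w n \<in> K})" by (auto simp: hitting_def)
  also have "\<dots> \<in> sets dpath_M" by (rule sets.countable_UN''[OF countableI_type dcoord_sets])
  finally show ?thesis .
qed

lemma classes_sets:
  assumes T: "T \<in> sets dpath_M" shows "classes E T \<in> sets (Wstar_M E)"
proof -
  have "{w. (\<exists>k. dshift k w \<in> T) \<and> w \<in> Wpaths E} = (\<Union>k. dshift k -` T \<inter> space dpath_M) \<inter> Wpaths E" by auto
  also have "\<dots> \<in> sets dpath_M"
    by (rule sets.Int[OF sets.countable_UN''[OF countableI_type measurable_sets[OF measurable_dshift T]] Wpaths_sets])
  finally have "pistar -` classes E T \<inter> Wpaths E \<in> sets dpath_M" unfolding classes_vimage .
  moreover have "classes E T \<subseteq> Wstar E" by (auto simp: classes_def)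
  ultimately show ?thesis unfolding Wstar_M_def by (subst sets_measure_of) auto
qed

lemma space_Wstar_M: "space (Wstar_M E) = Wstar E"
  unfolding Wstar_M_def by (rule space_measure_of) auto

text \<open>The mass under a law as in \<open>is_QK\<close> of a backward half in \<open>A\<close>
  and a forward half in \<open>B\<close>, after the escape probability has been cancelled against
  the equilibrium weight.\<close>

definition \<kappa> :: "'v set \<Rightarrow> (nat \<Rightarrow> 'v) set \<Rightarrow> (nat \<Rightarrow> 'v) set \<Rightarrow> real" where
  "\<kappa> K A B = (\<Sum>x\<in>K. d * P x (A \<inter> escape K) * P x B)"

lemma \<kappa>_nonneg: "\<kappa> K A B \<ge> 0"
  unfolding \<kappa>_def by (intro sum_nonneg) auto

lemma emeasure_QK:
  assumes Q: "is_QK E K Q" and K: "finite K" and A: "A \<in> sets path_M" and B: "B \<in> sets path_M"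
  shows "emeasure Q {w. bwd w \<in> A \<and> fwd w \<in> B} = ennreal (\<kappa> K A B)"
proof -
  have sQ: "sets Q = sets dpath_M" using Q by (simp add: is_QK_def)
  let ?S = "\<lambda>x. {w. bwd w \<in> A \<and> w 0 = x \<and> fwd w \<in> B}"
  have S: "?S x \<in> sets Q" for x
    using sets.Int[OF bwd_sets[OF A] sets.Int[OF dcoord_sets[of "\<lambda>v. v = x" 0] fwd_sets[OF B]]]
    by (simp add: sQ Int_def conj_ac)
  have val: "emeasure Q (?S x) = (if x \<in> K then ennreal (d * P x (A \<inter> escape K) * P x B) else 0)" for x
  proof -
    have le: "P x (A \<inter> escape K) \<le> P x (escape K)"
      by (rule srw.finite_measure_mono) (auto simp: escape_sets sets_srw)
    have "emeasure Q (?S x) = ennreal (P x (A \<inter> escape K) / P x (escape K) * equilibrium E K x * P x B)"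
      using Q A B unfolding is_QK_def by (auto simp: bwd_def fwd_def)
    also have "P x (A \<inter> escape K) / P x (escape K) * equilibrium E K x * P x B
        = (if x \<in> K then d * P x (A \<inter> escape K) * P x B else 0)"
    \<comment> \<open>If escape has probability 0, the quotient is 0 by the convention for division,
      in accordance with the right-hand side.\<close>
    proof (cases "P x (escape K) = 0")
      case True
      then have "P x (A \<inter> escape K) = 0" using le measure_nonneg[of "srw E x" "A \<inter> escape K"] by simp
      then show ?thesis by simp
    qed (simp add: equilibrium_def deg_eq)
    finally show ?thesis by auto
  qed
  have "{w. bwd w \<in> A \<and> fwd w \<in> B} = (\<Union>x\<in>UNIV. ?S x)" by auto
  then have "emeasure Q {w. bwd w \<in> A \<and> fwd w \<in> B} = emeasure Q (\<Union>x\<in>UNIV. ?S x)" by simp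
  also have "\<dots> = (\<integral>\<^sup>+x. emeasure Q (?S x) \<partial>count_space UNIV)"
    by (rule emeasure_UN_countable[OF S countable_V]) (auto simp: disjoint_family_on_def)
  also have "\<dots> = (\<Sum>x\<in>K. emeasure Q (?S x))"
    by (rule nn_integral_count_space') (use K val in auto)
  also have "\<dots> = (\<Sum>x\<in>K. ennreal (d * P x (A \<inter> escape K) * P x B))" by (intro sum.cong refl) (simp add: val)
  also have "\<dots> = ennreal (\<kappa> K A B)" unfolding \<kappa>_def by (rule sum_ennreal) auto
  finally show ?thesis .
qed

lemma AE_QK_bwd:
  assumes Q: "is_QK E K Q" and K: "finite K" and A: "A \<in> sets path_M" and 0: "\<And>x. x \<in> K \<Longrightarrow> P x (-A \<inter> escape K) = 0"
  shows "AE w in Q. bwd w \<in> A"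
proof (rule AE_I[of _ _ "{w. bwd w \<in> -A \<and> fwd w \<in> UNIV}"])
  have cA: "-A \<in> sets path_M" using sets.compl_sets[OF A] by (simp add: Compl_eq_Diff_UNIV)
  show "emeasure Q {w. bwd w \<in> -A \<and> fwd w \<in> UNIV} = 0"
    using emeasure_QK[OF Q K cA path_UNIV_sets] 0 by (simp add: \<kappa>_def)
  show "{w. bwd w \<in> -A \<and> fwd w \<in> UNIV} \<in> sets Q" using bwd_sets[OF cA] Q by (simp add: is_QK_def)
qed auto

lemma AE_QK_fwd:
  assumes Q: "is_QK E K Q" and K: "finite K" and A: "A \<in> sets path_M" and 0: "\<And>x. x \<in> K \<Longrightarrow> P x (-A) = 0"
  shows "AE w in Q. fwd w \<in> A"
proof (rule AE_I[of _ _ "{w. bwd w \<in> UNIV \<and> fwd w \<in> -A}"])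
  have cA: "-A \<in> sets path_M" using sets.compl_sets[OF A] by (simp add: Compl_eq_Diff_UNIV)
  show "emeasure Q {w. bwd w \<in> UNIV \<and> fwd w \<in> -A} = 0"
    using emeasure_QK[OF Q K path_UNIV_sets cA] 0 by (simp add: \<kappa>_def)
  show "{w. bwd w \<in> UNIV \<and> fwd w \<in> -A} \<in> sets Q" using fwd_sets[OF cA] Q by (simp add: is_QK_def)
qed auto

lemma AE_QK_Wpaths:
  assumes Q: "is_QK E K Q" and K: "finite K" shows "AE w in Q. w \<in> Wpaths E"
proof -
  have cA: "-walks E \<in> sets path_M" using sets.compl_sets[OF walks_sets] by (simp add: Compl_eq_Diff_UNIV)
  have 0: "P x (- walks E) = 0" for x
    using AE_walks[of x] by (subst srw.prob_eq_0[OF cA[unfolded sets_srw[of x, symmetric]]]) auto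
  have "P x (- walks E \<inter> escape K) = 0" for x
    using srw.finite_measure_mono[of "- walks E \<inter> escape K" "- walks E" x] 0 cA measure_nonneg
    by (metis inf_le1 order_antisym sets_srw)
  then show ?thesis
    using AE_QK_bwd[OF Q K walks_sets] AE_QK_fwd[OF Q K walks_sets] 0 Wpaths_eq by auto
qed

text \<open>The weights only charge backward halves that escape, so no visit to \<open>K\<close>
  precedes time 0.\<close>

lemma AE_QK_escape:
  assumes Q: "is_QK E K Q" and K: "finite K" shows "AE w in Q. bwd w \<in> escape K"
  by (rule AE_QK_bwd[OF Q K escape_sets]) simp

lemma AE_QK_start:
  assumes Q: "is_QK E {x} Q" shows "AE w in Q. w 0 = x"
proof -
  have "AE w in Q. fwd w \<in> {\<omega>. \<omega> 0 = x}"
  proof (rule AE_QK_fwd[OF Q])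
    show "P y (- {\<omega>. \<omega> 0 = x}) = 0" if "y \<in> {x}" for y
      using that AE_start[of x] coord_sets[of "\<lambda>v. v \<noteq> x" 0]
      by (subst srw.prob_eq_0) (auto simp: sets_srw Compl_eq)
  qed (use coord_sets in auto)
  then show ?thesis by (simp add: fwd_def)
qed

end

section \<open>Intensity of trajectories with prescribed edges\<close>

definition link :: "('v \<Rightarrow> 'v \<Rightarrow> bool) \<Rightarrow> ('v \<times> 'v) set \<Rightarrow> (int \<Rightarrow> 'v) set set" where
  "link E L = classes E (traversing L)"

definition endpoints :: "('v \<times> 'v) set \<Rightarrow> 'v set" where
  "endpoints L = fst ` L \<union> snd ` L"

definition through :: "('v \<Rightarrow> 'v \<Rightarrow> bool) \<Rightarrow> 'v \<Rightarrow> (int \<Rightarrow> 'v) set set" where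
  "through E x = classes E (hitting {x})"

text \<open>Time 0 is fixed as the first visit to \<open>x\<close>; a class thus has at most one
  representative of this kind.\<close>

definition looping :: "'v \<Rightarrow> 'v \<Rightarrow> (int \<Rightarrow> 'v) set" where
  "looping x y = {w. w 0 = x \<and> bwd w \<in> escape {x} \<and> w 1 = y \<and> w 2 = x}"

definition loop_through :: "('v \<Rightarrow> 'v \<Rightarrow> bool) \<Rightarrow> 'v \<Rightarrow> 'v \<Rightarrow> (int \<Rightarrow> 'v) set set" where
  "loop_through E x y = classes E (looping x y)"

lemma classes_mono: "S \<subseteq> T \<Longrightarrow> classes E S \<subseteq> classes E T"
  by (auto simp: classes_def)

lemma traversing_hitting: "endpoints L \<subseteq> K \<Longrightarrow> traversing L \<subseteq> hitting K"
  by (force simp: traversing_def hitting_def unlinked_def endpoints_def)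

lemma link_subset: "endpoints L \<subseteq> K \<Longrightarrow> link E L \<subseteq> WstarK E K"
  unfolding link_def WstarK_eq by (intro classes_mono traversing_hitting)

lemma through_eq: "through E x = WstarK E {x}"
  by (simp add: through_def WstarK_eq)

lemma loop_through_subset: "loop_through E x y \<subseteq> through E x"
  unfolding loop_through_def through_def by (intro classes_mono) (auto simp: looping_def hitting_def)

context transient_transitive_graph begin

lemma \<kappa>_mono: "A \<subseteq> A' \<Longrightarrow> B \<subseteq> B' \<Longrightarrow> A' \<in> sets path_M \<Longrightarrow> B' \<in> sets path_M \<Longrightarrow> \<kappa> K A B \<le> \<kappa> K A' B'"
  unfolding \<kappa>_def
  by (intro sum_mono mult_mono order_refl srw.finite_measure_mono)
    (auto simp: sets_srw intro: sets.Int escape_sets)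

lemma \<kappa>_automorphism:
  assumes f: "automorphism E f" and A: "A \<in> sets path_M" and B: "B \<in> sets path_M"
  shows "\<kappa> (f ` K) A B = \<kappa> K {\<omega>. (\<lambda>i. f (\<omega> i)) \<in> A} {\<omega>. (\<lambda>i. f (\<omega> i)) \<in> B}"
proof -
  have inj: "inj f" using f by (simp add: automorphism_def bij_is_inj)
  have esc: "{\<omega>. (\<lambda>i. f (\<omega> i)) \<in> A \<inter> escape (f ` K)} = {\<omega>. (\<lambda>i. f (\<omega> i)) \<in> A} \<inter> escape K"
    using inj by (auto simp: escape_def inj_image_mem_iff)
  have "\<kappa> (f ` K) A B = (\<Sum>x\<in>K. d * P (f x) (A \<inter> escape (f ` K)) * P (f x) B)"
    unfolding \<kappa>_def by (rule sum.reindex_cong[OF inj_on_subset[OF inj]]) auto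
  also have "\<dots> = \<kappa> K {\<omega>. (\<lambda>i. f (\<omega> i)) \<in> A} {\<omega>. (\<lambda>i. f (\<omega> i)) \<in> B}"
    unfolding \<kappa>_def
    by (simp only: P_automorphism[OF f B] P_automorphism[OF f sets.Int[OF A escape_sets]] esc)
  finally show ?thesis .
qed

text \<open>The capacity of the endpoints minus the mass of trajectories that visit an endpoint but
  use no edge of \<open>L\<close>. This is the intensity of \<open>link E L\<close>, written in
  terms of the walk so that automorphisms do not have to act on classes of trajectories.\<close>

definition \<tau> :: "('v \<times> 'v) set \<Rightarrow> real" where
  "\<tau> L = \<kappa> (endpoints L) UNIV UNIV - \<kappa> (endpoints L) (avoiding L) (avoiding L)"

lemma \<tau>_nonneg: "\<tau> L \<ge> 0"
  unfolding \<tau>_def using \<kappa>_mono[of "avoiding L" UNIV "avoiding L" UNIV] path_UNIV_sets by simp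

lemma \<tau>_automorphism:
  assumes f: "automorphism E f" shows "\<tau> (map_prod f f ` L) = \<tau> L"
proof -
  have inj: "inj f" using f by (simp add: automorphism_def bij_is_inj)
  have e: "endpoints (map_prod f f ` L) = f ` endpoints L"
    by (force simp: endpoints_def)
  have m: "(f a, f b) \<in> map_prod f f ` L \<longleftrightarrow> (a, b) \<in> L" for a b
    using inj by (auto simp: inj_def)
  have a: "{\<omega>. (\<lambda>i. f (\<omega> i)) \<in> avoiding (map_prod f f ` L)} = avoiding L"
    by (simp add: avoiding_def unlinked_def m)
  show ?thesis unfolding \<tau>_def e
    by (simp add: \<kappa>_automorphism[OF f path_UNIV_sets path_UNIV_sets] \<kappa>_automorphism[OF f avoiding_sets avoiding_sets] a)
qed

lemma ex_escaping_automorphism: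
  "\<exists>f. automorphism E f \<and> (\<forall>x\<in>gball E n c. \<forall>v\<in>gball E n c. f v \<notin> gball E n x)"
proof -
  \<comment> \<open>The three legs of length at most \<open>n\<close>, from \<open>c\<close> to
    \<open>x\<close>, from there to \<open>f v\<close> and on to \<open>z\<close>, must not suffice
    to reach \<open>z\<close>.\<close>
  obtain z where z: "z \<notin> gball E (n + n + n) c"
    using infinite_V finite_gball by (metis UNIV_eq_I)
  obtain f where f: "automorphism E f" "f c = z" using ex_automorphism by blast
  have "f v \<notin> gball E n x" if "x \<in> gball E n c" "v \<in> gball E n c" for x v
  proof
    assume fv: "f v \<in> gball E n x"
    have "f v \<in> gball E n z" using gball_automorphism[OF f(1), of n c] that(2) f(2) by blast
    then have "z \<in> gball E n (f v)" using gball_sym by blast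
    with gball_trans[OF gball_trans[OF that(1) fv]] z show False by blast
  qed
  with f show ?thesis by blast
qed

end

locale interlacement_intensity = transient_transitive_graph E for E :: "'v \<Rightarrow> 'v \<Rightarrow> bool" +
  fixes \<nu> :: "(int \<Rightarrow> 'v) set measure"
  assumes intensity: "is_interlacement_intensity E \<nu>"
begin

lemma sets_nu: "sets \<nu> = sets (Wstar_M E)"
  using intensity by (simp add: is_interlacement_intensity_def)

lemma space_nu: "space \<nu> = Wstar E"
  using sets_eq_imp_space_eq[OF sets_nu] space_Wstar_M by simp

lemma link_sets: "link E L \<in> sets \<nu>" and through_sets: "through E x \<in> sets \<nu>"
  unfolding sets_nu link_def through_def by (intro classes_sets traversing_sets hitting_sets)+

lemma looping_sets: "looping x y \<in> sets dpath_M"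
proof -
  have "looping x y = {w. w 0 = x} \<inter> {w. bwd w \<in> escape {x}} \<inter> {w. w 1 = y} \<inter> {w. w 2 = x}"
    by (auto simp: looping_def)
  also have "\<dots> \<in> sets dpath_M"
    by (intro sets.Int bwd_sets escape_sets)
      (use dcoord_sets[of "\<lambda>v. v = x" 0] dcoord_sets[of "\<lambda>v. v = y" 1] dcoord_sets[of "\<lambda>v. v = x" 2] in auto)
  finally show ?thesis .
qed

lemma loop_through_sets: "loop_through E x y \<in> sets \<nu>"
  unfolding sets_nu loop_through_def by (intro classes_sets looping_sets)

lemma ex_QK:
  assumes "finite K"
  shows "\<exists>Q. is_QK E K Q \<and> (\<forall>A\<in>sets \<nu>. A \<subseteq> WstarK E K \<longrightarrow> emeasure \<nu> A = emeasure Q (pistar -` A \<inter> Wpaths E))"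
proof -
  obtain Q where Q: "is_QK E K Q"
    "\<And>A. A \<in> sets (Wstar_M E) \<Longrightarrow> emeasure \<nu> (A \<inter> WstarK E K) = emeasure Q (pistar -` A \<inter> Wpaths E)"
    using intensity assms unfolding is_interlacement_intensity_def by blast
  then have "emeasure \<nu> A = emeasure Q (pistar -` A \<inter> Wpaths E)" if "A \<in> sets \<nu>" "A \<subseteq> WstarK E K" for A
    using that sets_nu by (metis inf.absorb1)
  with Q(1) show ?thesis by blast
qed

lemma link_vimage: "pistar -` link E L \<inter> Wpaths E = traversing L \<inter> Wpaths E"
  unfolding link_def classes_vimage by (auto simp: dshift_traversing)

lemma through_vimage: "pistar -` through E x \<inter> Wpaths E = hitting {x} \<inter> Wpaths E"
  unfolding through_def classes_vimage by (auto simp: dshift_hitting)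

text \<open>A trajectory using an edge of \<open>L\<close> visits an endpoint and is thus described
  by \<open>Q\<close> for the endpoints. Avoiding \<open>L\<close> splits over the two halves, and
  its finite mass is subtracted from the total.\<close>

lemma nu_link:
  assumes L: "finite L" shows "emeasure \<nu> (link E L) = ennreal (\<tau> L)"
proof -
  let ?K = "endpoints L" and ?N = "avoiding L"
  have K: "finite ?K" using L by (simp add: endpoints_def)
  obtain Q where Q: "is_QK E ?K Q"
    "\<And>A. A \<in> sets \<nu> \<Longrightarrow> A \<subseteq> WstarK E ?K \<Longrightarrow> emeasure \<nu> A = emeasure Q (pistar -` A \<inter> Wpaths E)"
    using ex_QK[OF K] by blast
  have sQ: "sets Q = sets dpath_M" using Q by (simp add: is_QK_def)
  have spQ: "space Q = UNIV" using sets_eq_imp_space_eq[OF sQ] by simp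
  have N: "{w. bwd w \<in> ?N \<and> fwd w \<in> ?N} \<in> sets Q"
    using sets.Int[OF bwd_sets[OF avoiding_sets[of L]] fwd_sets[OF avoiding_sets[of L]]] by (simp add: sQ Int_def)
  have "emeasure \<nu> (link E L) = emeasure Q (traversing L \<inter> Wpaths E)"
    unfolding Q(2)[OF link_sets link_subset[OF order_refl]] link_vimage ..
  also have "\<dots> = emeasure Q (traversing L)"
    by (rule emeasure_eq_AE) (use AE_QK_Wpaths[OF Q(1) K] traversing_sets[of L] Wpaths_sets in \<open>auto simp: sQ\<close>)
  also have "traversing L = {w. bwd w \<in> UNIV \<and> fwd w \<in> UNIV} - {w. bwd w \<in> ?N \<and> fwd w \<in> ?N}"
    using avoiding_fwd_bwd by auto
  also have "emeasure Q \<dots> = emeasure Q {w. bwd w \<in> UNIV \<and> fwd w \<in> UNIV} - emeasure Q {w. bwd w \<in> ?N \<and> fwd w \<in> ?N}"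
  proof (rule emeasure_Diff)
    show "emeasure Q {w. bwd w \<in> ?N \<and> fwd w \<in> ?N} \<noteq> \<infinity>"
      using emeasure_QK[OF Q(1) K avoiding_sets[of L] avoiding_sets[of L]] by simp
    show "{w. bwd w \<in> UNIV \<and> fwd w \<in> UNIV} \<in> sets Q" using sets.top[of Q] spQ by simp
  qed (use N in auto)
  also have "\<dots> = ennreal (\<tau> L)"
    unfolding emeasure_QK[OF Q(1) K path_UNIV_sets path_UNIV_sets]
      emeasure_QK[OF Q(1) K avoiding_sets[of L] avoiding_sets[of L]] \<tau>_def
    by (rule ennreal_minus[OF \<kappa>_nonneg])
  finally show ?thesis .
qed

text \<open>Under \<open>Q\<close> for the endpoints of \<open>L\<close>, one of the two halves must
  hit an endpoint of \<open>L'\<close>. The factor 2 counts the halves; a union bound over pairs of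
  endpoints does the rest.\<close>

lemma nu_overlap_le:
  fixes \<epsilon> :: real
  assumes L: "finite L" "finite L'" and e: "\<epsilon> \<ge> 0"
    and small: "\<And>x v. x \<in> endpoints L \<Longrightarrow> v \<in> endpoints L' \<Longrightarrow> P x {\<omega>. \<exists>n. \<omega> n = v} \<le> \<epsilon>"
  shows "emeasure \<nu> (link E L \<inter> link E L') \<le> ennreal (2 * (d * card (endpoints L) * card (endpoints L')) * \<epsilon>)"
proof -
  let ?K = "endpoints L" and ?K' = "endpoints L'"
  let ?H = "{\<omega>. \<exists>n. \<omega> n \<in> ?K'}"
  have K: "finite ?K" "finite ?K'" using L by (auto simp: endpoints_def)
  obtain Q where Q: "is_QK E ?K Q"
    "\<And>A. A \<in> sets \<nu> \<Longrightarrow> A \<subseteq> WstarK E ?K \<Longrightarrow> emeasure \<nu> A = emeasure Q (pistar -` A \<inter> Wpaths E)"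
    using ex_QK[OF K(1)] by blast
  have sQ: "sets Q = sets dpath_M" using Q by (simp add: is_QK_def)
  have hit: "{\<omega>. \<exists>n. \<omega> n = v} \<in> sets path_M" for v
  proof -
    have "{\<omega>. \<exists>n. \<omega> n = v} = (\<Union>n. {\<omega>. \<omega> n = v})" by auto
    also have "\<dots> \<in> sets path_M" by (rule sets.countable_UN''[OF countableI_type coord_sets])
    finally show ?thesis .
  qed
  have Heq: "?H = (\<Union>v\<in>?K'. {\<omega>. \<exists>n. \<omega> n = v})" by auto
  have H: "?H \<in> sets path_M" unfolding Heq using K(2) hit by (intro sets.finite_UN) auto
  have PH: "P x ?H \<le> card ?K' * \<epsilon>" if "x \<in> ?K" for x
  proof -
    have "P x ?H \<le> (\<Sum>v\<in>?K'. P x {\<omega>. \<exists>n. \<omega> n = v})" unfolding Heq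
      by (rule measure_UNION_le[OF K(2)]) (use hit in \<open>auto simp: sets_srw\<close>)
    also have "\<dots> \<le> (\<Sum>v\<in>?K'. \<epsilon>)" by (intro sum_mono small that)
    finally show ?thesis by simp
  qed
  have \<kappa>1: "\<kappa> ?K ?H UNIV \<le> d * card ?K * card ?K' * \<epsilon>"
  proof -
    have "d * P x (?H \<inter> escape ?K) * P x UNIV \<le> d * (card ?K' * \<epsilon>)" if "x \<in> ?K" for x
    proof -
      have "P x (?H \<inter> escape ?K) \<le> P x ?H" by (rule srw.finite_measure_mono) (use H in \<open>auto simp: sets_srw\<close>)
      with PH[OF that] have "P x (?H \<inter> escape ?K) \<le> card ?K' * \<epsilon>" by linarith
      then show ?thesis using srw.prob_space[of x] by (simp add: mult_left_mono)
    qed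
    then have "\<kappa> ?K ?H UNIV \<le> (\<Sum>x\<in>?K. d * (card ?K' * \<epsilon>))" unfolding \<kappa>_def by (intro sum_mono)
    then show ?thesis by (simp add: algebra_simps)
  qed
  have \<kappa>2: "\<kappa> ?K UNIV ?H \<le> d * card ?K * card ?K' * \<epsilon>"
  proof -
    have "d * P x (UNIV \<inter> escape ?K) * P x ?H \<le> d * (card ?K' * \<epsilon>)" if "x \<in> ?K" for x
    proof -
      have "P x (UNIV \<inter> escape ?K) * P x ?H \<le> 1 * (card ?K' * \<epsilon>)"
        using PH[OF that] e by (intro mult_mono) auto
      then show ?thesis by (simp add: mult_left_mono mult.assoc)
    qed
    then have "\<kappa> ?K UNIV ?H \<le> (\<Sum>x\<in>?K. d * (card ?K' * \<epsilon>))" unfolding \<kappa>_def by (intro sum_mono)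
    then show ?thesis by (simp add: algebra_simps)
  qed
  have sub: "link E L \<inter> link E L' \<subseteq> WstarK E ?K" using link_subset[of L ?K E] by auto
  have "emeasure \<nu> (link E L \<inter> link E L') = emeasure Q (pistar -` (link E L \<inter> link E L') \<inter> Wpaths E)"
    by (rule Q(2)[OF sets.Int[OF link_sets link_sets] sub])
  also have "\<dots> \<le> emeasure Q ({w. bwd w \<in> ?H \<and> fwd w \<in> UNIV} \<union> {w. bwd w \<in> UNIV \<and> fwd w \<in> ?H})"
  proof (rule emeasure_mono)
    show "pistar -` (link E L \<inter> link E L') \<inter> Wpaths E \<subseteq> {w. bwd w \<in> ?H \<and> fwd w \<in> UNIV} \<union> {w. bwd w \<in> UNIV \<and> fwd w \<in> ?H}"
    proof
      fix w assume "w \<in> pistar -` (link E L \<inter> link E L') \<inter> Wpaths E"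
      then have "w \<in> traversing L'" using link_vimage[of L'] by blast
      then have "w \<in> hitting ?K'" using traversing_hitting[OF order_refl] by blast
      then obtain k where "w k \<in> ?K'" by (auto simp: hitting_def)
      then have "(\<exists>n. fwd w n \<in> ?K') \<or> (\<exists>n. bwd w n \<in> ?K')"
        using int_cases_fwd_bwd[of "\<lambda>k. w k \<notin> ?K'"] by (auto simp: fwd_def bwd_def)
      then show "w \<in> {w. bwd w \<in> ?H \<and> fwd w \<in> UNIV} \<union> {w. bwd w \<in> UNIV \<and> fwd w \<in> ?H}" by blast
    qed
    show "{w. bwd w \<in> ?H \<and> fwd w \<in> UNIV} \<union> {w. bwd w \<in> UNIV \<and> fwd w \<in> ?H} \<in> sets Q"
      using sets.Un[OF bwd_sets[OF H] fwd_sets[OF H]] by (simp add: sQ)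
  qed
  also have "\<dots> \<le> emeasure Q {w. bwd w \<in> ?H \<and> fwd w \<in> UNIV} + emeasure Q {w. bwd w \<in> UNIV \<and> fwd w \<in> ?H}"
    by (rule emeasure_subadditive) (use bwd_sets[OF H] fwd_sets[OF H] in \<open>auto simp: sQ\<close>)
  also have "\<dots> = ennreal (\<kappa> ?K ?H UNIV + \<kappa> ?K UNIV ?H)"
    unfolding emeasure_QK[OF Q(1) K(1) H path_UNIV_sets] emeasure_QK[OF Q(1) K(1) path_UNIV_sets H]
    by (rule ennreal_plus[symmetric]) (rule \<kappa>_nonneg)+
  also have "\<dots> \<le> ennreal (2 * (d * card ?K * card ?K') * \<epsilon>)"
    by (rule ennreal_leI) (use \<kappa>1 \<kappa>2 in \<open>simp add: algebra_simps\<close>)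
  finally show ?thesis .
qed

lemma nu_through_avoid:
  "emeasure \<nu> (through E x - link E L) = ennreal (\<kappa> {x} (avoiding L) (avoiding L))"
proof -
  obtain Q where Q: "is_QK E {x} Q"
    "\<And>A. A \<in> sets \<nu> \<Longrightarrow> A \<subseteq> WstarK E {x} \<Longrightarrow> emeasure \<nu> A = emeasure Q (pistar -` A \<inter> Wpaths E)"
    using ex_QK[of "{x}"] by auto
  have sQ: "sets Q = sets dpath_M" using Q by (simp add: is_QK_def)
  have "emeasure \<nu> (through E x - link E L) = emeasure Q (pistar -` (through E x - link E L) \<inter> Wpaths E)"
    by (rule Q(2)) (auto simp: through_eq intro: sets.Diff through_sets[unfolded through_eq] link_sets)
  also have "pistar -` (through E x - link E L) \<inter> Wpaths E = (hitting {x} \<inter> Wpaths E) - traversing L"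
    using link_vimage[of L] through_vimage[of x] by blast
  also have "emeasure Q \<dots> = emeasure Q {w. bwd w \<in> avoiding L \<and> fwd w \<in> avoiding L}"
  proof (rule emeasure_eq_AE)
    show "AE w in Q. w \<in> hitting {x} \<inter> Wpaths E - traversing L \<longleftrightarrow> w \<in> {w. bwd w \<in> avoiding L \<and> fwd w \<in> avoiding L}"
      using AE_QK_start[OF Q(1)] AE_QK_Wpaths[OF Q(1) finite.insertI[OF finite.emptyI]]
    proof eventually_elim
      case (elim w)
      then have "w \<in> hitting {x}" by (auto simp: hitting_def)
      then show ?case using elim(2) avoiding_fwd_bwd[of w L] by auto
    qed
    show "hitting {x} \<inter> Wpaths E - traversing L \<in> sets Q"
      unfolding sQ by (intro sets.Diff sets.Int hitting_sets Wpaths_sets traversing_sets)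
    show "{w. bwd w \<in> avoiding L \<and> fwd w \<in> avoiding L} \<in> sets Q"
      using sets.Int[OF bwd_sets[OF avoiding_sets[of L]] fwd_sets[OF avoiding_sets[of L]]] by (simp add: sQ Int_def)
  qed
  also have "\<dots> = ennreal (\<kappa> {x} (avoiding L) (avoiding L))"
    by (rule emeasure_QK[OF Q(1) _ avoiding_sets avoiding_sets]) simp
  finally show ?thesis .
qed

text \<open>The Markov property is applied twice, at the cost of 1/d each. Both steps run along xy,
  so the loop avoids \<open>L\<close> exactly if xy does.\<close>

lemma P_loop:
  assumes xy: "E x y"
  shows "P x (avoiding L \<inter> {\<omega>. \<omega> 1 = y} \<inter> {\<omega>. \<omega> 2 = x}) = (if unlinked L x y then P x (avoiding L) / d ^ 2 else 0)"
proof -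
  let ?A = "avoiding L \<inter> {\<omega>. \<omega> 1 = y} \<inter> {\<omega>. \<omega> 2 = x}"
  let ?C = "{\<omega>. \<omega> 1 = x \<and> sh \<omega> \<in> avoiding L}"
  have C: "?C \<in> sets path_M"
    using sets.Int[OF coord_sets[of "\<lambda>v. v = x" 1] sh_vimage_sets1[OF avoiding_sets[of L]]] by (simp add: Int_def)
  have C': "{\<omega>. \<omega> 1 = y \<and> sh \<omega> \<in> ?C} \<in> sets path_M"
    using sets.Int[OF coord_sets[of "\<lambda>v. v = y" 1] sh_vimage_sets1[OF C]] by (simp add: Int_def)
  have A: "?A \<in> sets path_M"
    by (intro sets.Int avoiding_sets) (use coord_sets[of "\<lambda>v. v = y" 1] coord_sets[of "\<lambda>v. v = x" 2] in auto)
  have step: "\<omega> \<in> avoiding L \<longleftrightarrow> unlinked L (\<omega> 0) (\<omega> 1) \<and> unlinked L (\<omega> 1) (\<omega> 2) \<and> sh (sh \<omega>) \<in> avoiding L" for \<omega>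
  proof -
    have split: "(\<forall>n. Q n) \<longleftrightarrow> Q 0 \<and> Q (Suc 0) \<and> (\<forall>n. Q (Suc (Suc n)))" for Q :: "nat \<Rightarrow> bool"
      by (metis not0_implies_Suc)
    show ?thesis unfolding avoiding_def sh_def mem_Collect_eq numeral_2_eq_2 One_nat_def by (rule split)
  qed
  have u: "unlinked L y x \<longleftrightarrow> unlinked L x y" by (auto simp: unlinked_def)
  show ?thesis
  proof (cases "unlinked L x y")
    case True
    have "P x ?A = P x {\<omega>. \<omega> 1 = y \<and> sh \<omega> \<in> ?C}"
    proof (rule measure_eq_AE)
      show "AE \<omega> in srw E x. \<omega> \<in> ?A \<longleftrightarrow> \<omega> \<in> {\<omega>. \<omega> 1 = y \<and> sh \<omega> \<in> ?C}"
        using AE_start[of x]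
      proof eventually_elim
        case (elim \<omega>)
        then show ?case using True u step[of \<omega>] by (auto simp: sh_def numeral_2_eq_2)
      qed
    qed (use A C' in \<open>auto simp: sets_srw\<close>)
    also have "\<dots> = (P x (avoiding L) / d) / d"
      unfolding srw_step[OF xy C] srw_step[OF E_sym[OF xy] avoiding_sets] ..
    finally show ?thesis using True by (simp add: power2_eq_square)
  next
    case False
    have "P x ?A = P x {}"
    proof (rule measure_eq_AE)
      show "AE \<omega> in srw E x. \<omega> \<in> ?A \<longleftrightarrow> \<omega> \<in> {}"
        using AE_start[of x]
      proof eventually_elim
        case (elim \<omega>)
        then show ?case using False step[of \<omega>] by auto
      qed
    qed (use A in \<open>auto simp: sets_srw\<close>)
    then show ?thesis using False by simp
  qed
qed

lemma nu_loop_avoid: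
  assumes xy: "E x y"
  shows "emeasure \<nu> (loop_through E x y - link E L) =
    ennreal (if unlinked L x y then \<kappa> {x} (avoiding L) (avoiding L) / d ^ 2 else 0)"
proof -
  let ?B = "avoiding L \<inter> {\<omega>. \<omega> 1 = y} \<inter> {\<omega>. \<omega> 2 = x}"
  obtain Q where Q: "is_QK E {x} Q"
    "\<And>A. A \<in> sets \<nu> \<Longrightarrow> A \<subseteq> WstarK E {x} \<Longrightarrow> emeasure \<nu> A = emeasure Q (pistar -` A \<inter> Wpaths E)"
    using ex_QK[of "{x}"] by auto
  have sQ: "sets Q = sets dpath_M" using Q by (simp add: is_QK_def)
  have B: "?B \<in> sets path_M"
    by (intro sets.Int avoiding_sets) (use coord_sets[of "\<lambda>v. v = y" 1] coord_sets[of "\<lambda>v. v = x" 2] in auto)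
  let ?S = "pistar -` (loop_through E x y - link E L) \<inter> Wpaths E"
  have Seq: "?S = (\<Union>k. dshift k -` looping x y \<inter> space dpath_M) \<inter> Wpaths E - traversing L"
  proof -
    have "?S = (pistar -` loop_through E x y \<inter> Wpaths E) - (pistar -` link E L \<inter> Wpaths E)" by blast
    also have "\<dots> = {w. (\<exists>k. dshift k w \<in> looping x y) \<and> w \<in> Wpaths E} - (traversing L \<inter> Wpaths E)"
      unfolding loop_through_def classes_vimage link_vimage ..
    finally show ?thesis by auto
  qed
  have "emeasure \<nu> (loop_through E x y - link E L) = emeasure Q ?S"
    by (rule Q(2)) (use loop_through_subset[of E x y] in \<open>auto simp: through_eq intro: sets.Diff loop_through_sets link_sets\<close>)
  also have "\<dots> = emeasure Q {w. bwd w \<in> avoiding L \<and> fwd w \<in> ?B}"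
  proof (rule emeasure_eq_AE)
    have "AE w in Q. bwd w \<in> escape {x}" by (rule AE_QK_escape[OF Q(1)]) simp
    moreover have "AE w in Q. w \<in> Wpaths E" by (rule AE_QK_Wpaths[OF Q(1)]) simp
    ultimately show "AE w in Q. w \<in> ?S \<longleftrightarrow> w \<in> {w. bwd w \<in> avoiding L \<and> fwd w \<in> ?B}"
      using AE_QK_start[OF Q(1)]
    proof eventually_elim
      case (elim w)
      have "(\<exists>k. dshift k w \<in> looping x y) \<longleftrightarrow> fwd w 1 = y \<and> fwd w 2 = x"
      proof
        assume "\<exists>k. dshift k w \<in> looping x y"
        then obtain k where k: "w k = x" "\<And>n. n \<ge> 1 \<Longrightarrow> w (k - int n) \<noteq> x" "w (1 + k) = y" "w (2 + k) = x"
          by (auto simp: looping_def dshift_def bwd_def escape_def algebra_simps)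
        \<comment> \<open>Both \<open>k\<close> and 0 are the first time at which \<open>w\<close>
          visits \<open>x\<close>, hence they coincide.\<close>
        have "k \<le> 0"
        proof (rule ccontr)
          assume "\<not> k \<le> 0"
          then have "1 \<le> nat k" "k - int (nat k) = 0" by auto
          then show False using k(2)[of "nat k"] elim(3) by simp
        qed
        moreover have "k \<ge> 0"
        proof (rule ccontr)
          assume "\<not> k \<ge> 0"
          then have "1 \<le> nat (- k)" "w (- int (nat (- k))) = w k" by auto
          moreover have "w (- int n) \<noteq> x" if "n \<ge> 1" for n using elim(1) that by (auto simp: escape_def bwd_def)
          ultimately show False using k(1) by metis
        qed
        ultimately show "fwd w 1 = y \<and> fwd w 2 = x" using k by (simp add: fwd_def)
      next
        assume "fwd w 1 = y \<and> fwd w 2 = x"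
        then have "dshift 0 w \<in> looping x y" using elim by (simp add: looping_def fwd_def)
        then show "\<exists>k. dshift k w \<in> looping x y" by blast
      qed
      then show ?case unfolding Seq using elim(2) avoiding_fwd_bwd[of w L] by auto
    qed
    show "?S \<in> sets Q" unfolding sQ Seq
      by (intro sets.Diff traversing_sets sets.Int[OF sets.countable_UN''[OF countableI_type measurable_sets[OF measurable_dshift looping_sets]] Wpaths_sets])
    show "{w. bwd w \<in> avoiding L \<and> fwd w \<in> ?B} \<in> sets Q"
      using sets.Int[OF bwd_sets[OF avoiding_sets[of L]] fwd_sets[OF B]] by (simp add: sQ Int_def)
  qed
  also have "\<dots> = ennreal (\<kappa> {x} (avoiding L) ?B)"
    by (rule emeasure_QK[OF Q(1) _ avoiding_sets B]) simp
  also have "\<kappa> {x} (avoiding L) ?B = (if unlinked L x y then \<kappa> {x} (avoiding L) (avoiding L) / d ^ 2 else 0)"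
    using P_loop[OF xy, of L] by (simp add: \<kappa>_def)
  finally show ?thesis .
qed

end

section \<open>The law of the random edge set\<close>

text \<open>For finite \<open>L\<close> these avoidance events are stable under intersection and
  generate the configuration space; their probabilities come directly from the Poisson
  process.\<close>

definition closed_on :: "('v \<times> 'v) set \<Rightarrow> ('v \<times> 'v \<Rightarrow> bool) set" where
  "closed_on L = {s. \<forall>e\<in>L. \<not> s e}"

lemma sets_conf_M_closed_on: "sets conf_M = sigma_sets UNIV {closed_on L | L. finite L}"
proof -
  let ?G = "{closed_on L | L :: ('a \<times> 'a) set. finite L}"
  have eq: "sets conf_M = sigma_sets UNIV {{f. f i \<in> A} | (i :: 'a \<times> 'a) (A :: bool set). True}"
    unfolding conf_M_def sets_PiM_single by simp
  have cl: "{f. \<not> f i} \<in> sigma_sets UNIV ?G" for i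
    by (rule sigma_sets.Basic) (auto simp: closed_on_def intro!: exI[of _ "{i}"])
  have "{f. f i \<in> A} \<in> sigma_sets UNIV ?G" for i and A :: "bool set"
  proof -
    have A: "{f. f i \<in> A} = (if True \<in> A then {f. f i} else {}) \<union> (if False \<in> A then {f. \<not> f i} else {})"
    proof (rule set_eqI)
      fix f :: "'a \<times> 'a \<Rightarrow> bool"
      show "f \<in> {f. f i \<in> A} \<longleftrightarrow> f \<in> (if True \<in> A then {f. f i} else {}) \<union> (if False \<in> A then {f. \<not> f i} else {})"
        by (cases "f i") auto
    qed
    have "UNIV - {f. \<not> f i} \<in> sigma_sets UNIV ?G" using cl by (rule sigma_sets.Compl)
    moreover have "UNIV - {f. \<not> f i} = {f. f i}" by auto
    ultimately have "{f. f i} \<in> sigma_sets UNIV ?G" by simp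
    then show ?thesis unfolding A
      by (intro sigma_sets_Un) (auto intro: cl sigma_sets.Empty)
  qed
  then have "sets conf_M \<subseteq> sigma_sets UNIV ?G" unfolding eq by (intro sigma_sets_mono) auto
  moreover have "sigma_sets UNIV ?G \<subseteq> sets conf_M"
  proof -
    have "closed_on L \<in> sets conf_M" if "finite L" for L :: "('a \<times> 'a) set"
    proof -
      have "Measurable.pred conf_M (\<lambda>s. \<forall>e\<in>L. \<not> s e)"
        by (intro pred_intros_finite(3)[OF that] pred_intros_logic measurable_conf_coord)
      then show ?thesis by (simp add: closed_on_def pred_def)
    qed
    then show ?thesis using sets.sigma_sets_subset[of ?G conf_M] by auto
  qed
  ultimately show ?thesis by (rule equalityI)
qed

lemma Int_stable_closed_on: "Int_stable {closed_on L | L. finite L}"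
proof (rule Int_stableI)
  fix a b :: "('a \<times> 'a \<Rightarrow> bool) set"
  assume "a \<in> {closed_on L | L. finite L}" "b \<in> {closed_on L | L. finite L}"
  then obtain L L' where "a = closed_on L" "b = closed_on L'" "finite L" "finite L'" by auto
  then have "a \<inter> b = closed_on (L \<union> L')" "finite (L \<union> L')" by (auto simp: closed_on_def)
  then show "a \<inter> b \<in> {closed_on L | L. finite L}" by blast
qed

lemma closed_on_sets: "finite L \<Longrightarrow> closed_on L \<in> sets conf_M"
  unfolding sets_conf_M_closed_on by (rule sigma_sets.Basic) blast

lemma conf_measure_eqI:
  assumes M: "sets M = sets conf_M" and N: "sets N = sets conf_M" and fin: "finite_measure M"
    and eq: "\<And>L. finite L \<Longrightarrow> emeasure M (closed_on L) = emeasure N (closed_on L)"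
  shows "M = N"
proof (rule measure_eqI_generator_eq[OF Int_stable_closed_on])
  show "sets M = sigma_sets UNIV {closed_on L | L. finite L}" "sets N = sigma_sets UNIV {closed_on L | L. finite L}"
    using M N sets_conf_M_closed_on by auto
  show "range (\<lambda>i :: nat. closed_on {}) \<subseteq> {closed_on L | L. finite L}" by auto
  show "(\<Union>i :: nat. closed_on {}) = UNIV" by (simp add: closed_on_def)
  show "emeasure M (closed_on {}) \<noteq> \<infinity>" using finite_measure.emeasure_finite[OF fin] by simp
qed (use eq in auto)

text \<open>The sets with the desired limit form a Dynkin system: domination by the finite measure
  \<open>D\<close> supplies a summable bound, so Tannery's theorem exchanges the limit with a
  countable disjoint sum.\<close>

lemma dominated_limit_measures:
  fixes M :: "nat \<Rightarrow> 'a measure" and c :: real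
  assumes G: "Int_stable G" "UNIV \<in> G" and D: "sets D = sigma_sets UNIV G" "space D = UNIV" "finite_measure D"
    and M: "\<And>n. sets (M n) = sets D" "\<And>n. finite_measure (M n)"
    and dom: "\<And>n b. b \<in> sets D \<Longrightarrow> measure (M n) b \<le> measure D b"
    and lim: "\<And>b. b \<in> G \<Longrightarrow> (\<lambda>n. measure (M n) b) \<longlonglongrightarrow> c * measure D b"
    and b: "b \<in> sets D"
  shows "(\<lambda>n. measure (M n) b) \<longlonglongrightarrow> c * measure D b"
proof -
  interpret D: finite_measure D by fact
  interpret M: finite_measure "M n" for n by fact
  have spM: "space (M n) = UNIV" for n using sets_eq_imp_space_eq[OF M(1)] D(2) by simp
  have bG: "b \<in> sigma_sets UNIV G" using b D(1) by simp
  have GP: "G \<subseteq> Pow UNIV" by simp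
  from G(1) GP bG show ?thesis
  proof (induction rule: sigma_sets_induct_disjoint)
    case (basic A) then show ?case by (rule lim)
  next
    case empty then show ?case by simp
  next
    case (compl A)
    then have A: "A \<in> sets D" using D(1) by simp
    have m: "measure (M n) (UNIV - A) = measure (M n) UNIV - measure (M n) A" for n
      using M.finite_measure_compl[of A n] A M(1) spM by simp
    have mD: "measure D (UNIV - A) = measure D UNIV - measure D A"
      using D.finite_measure_compl[OF A] D(2) by simp
    show ?case unfolding m mD right_diff_distrib by (rule tendsto_diff[OF lim[OF G(2)] compl.IH])
  next
    case (union A)
    then have A: "range A \<subseteq> sets D" using D(1) by simp
    have sums: "(\<lambda>i. measure (M n) (A i)) sums measure (M n) (\<Union>i. A i)" for n
      by (rule M.finite_measure_UNION) (use A M(1) union in auto)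
    have sumsD: "(\<lambda>i. measure D (A i)) sums measure D (\<Union>i. A i)"
      by (rule D.finite_measure_UNION) (use A union in auto)
    have "(\<lambda>n. \<Sum>i. measure (M n) (A i)) \<longlonglongrightarrow> (\<Sum>i. c * measure D (A i))"
    proof (rule tannerys_theorem[THEN conjunct2, THEN conjunct2])
      show "(\<lambda>n. measure (M n) (A i)) \<longlonglongrightarrow> c * measure D (A i)" for i by (rule union.IH)
      show "\<forall>\<^sub>F (i, n) in at_top \<times>\<^sub>F sequentially. norm (measure (M n) (A i)) \<le> measure D (A i)"
        by (rule always_eventually) (use dom A in auto)
      show "summable (\<lambda>i. measure D (A i))" using sumsD by (rule sums_summable)
    qed simp
    then show ?case using sums_unique[OF sums] sums_unique[OF sums_mult[OF sumsD, of c]] by simp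
  qed
qed

lemma count_pp_eq_0: "count_pp h A = 0 \<longleftrightarrow> (\<forall>c\<in>A. h c = 0)"
  unfolding count_pp_def by (subst nn_integral_0_iff_AE) (auto simp: AE_count_space)

lemma count_pp_indicator: "count_pp h A = (\<integral>\<^sup>+c. ennreal (real (h c)) * indicator A c \<partial>count_space UNIV)"
  unfolding count_pp_def by (subst nn_integral_count_space_indicator) simp_all

lemma count_pp_cong: "(\<And>c. h c > 0 \<Longrightarrow> c \<in> A \<longleftrightarrow> c \<in> B) \<Longrightarrow> count_pp h A = count_pp h B"
  unfolding count_pp_indicator by (intro nn_integral_cong) (auto simp: indicator_def)

section \<open>Poisson counts and the law of the edge set\<close>

locale interlacement_process = interlacement_intensity E \<nu> for E :: "'v \<Rightarrow> 'v \<Rightarrow> bool" and \<nu> +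
  fixes \<Omega> :: "'w measure" and \<eta> :: "'w \<Rightarrow> (int \<Rightarrow> 'v) set \<Rightarrow> nat" and u :: real
  assumes u: "u > 0" and ppp: "is_PPP \<Omega> (scale_measure (ennreal u) \<nu>) \<eta>"
begin

sublocale \<Omega>: prob_space \<Omega>
  using ppp by (simp add: is_PPP_def)

abbreviation N :: "(int \<Rightarrow> 'v) set set \<Rightarrow> 'w \<Rightarrow> ennreal" where "N A \<omega> \<equiv> count_pp (\<eta> \<omega>) A"

lemma support: "\<omega> \<in> space \<Omega> \<Longrightarrow> \<eta> \<omega> c > 0 \<Longrightarrow> c \<in> Wstar E"
  using ppp unfolding is_PPP_def by (auto simp: space_scale_measure space_nu)

lemma measurable_N: "A \<in> sets \<nu> \<Longrightarrow> N A \<in> borel_measurable \<Omega>"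
  using ppp unfolding is_PPP_def by simp

lemma N_sets: "A \<in> sets \<nu> \<Longrightarrow> {\<omega>\<in>space \<Omega>. N A \<omega> = a} \<in> sets \<Omega>"
  using measurable_sets[OF measurable_N, of A "{a}"] by (simp add: vimage_def Int_def conj_commute)

lemma poisson:
  assumes A: "A \<in> sets \<nu>" "emeasure \<nu> A = ennreal a" "a \<ge> 0"
  shows "\<P>(\<omega> in \<Omega>. N A \<omega> = of_nat k) = (u * a) ^ k / fact k * exp (- (u * a))"
proof -
  have e: "emeasure (scale_measure (ennreal u) \<nu>) A = ennreal (u * a)"
    using A u by (simp add: ennreal_mult'')
  then have "measure (scale_measure (ennreal u) \<nu>) A = u * a" using A u by (simp add: measure_def)
  then show ?thesis using ppp A(1) e unfolding is_PPP_def by (auto simp: ennreal_less_top)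
qed

lemma poisson_pair:
  assumes A: "A \<in> sets \<nu>" "emeasure \<nu> A = ennreal a" "a \<ge> 0"
    and B: "B \<in> sets \<nu>" "emeasure \<nu> B = ennreal b" "b \<ge> 0" and disj: "A \<inter> B = {}"
  shows "\<P>(\<omega> in \<Omega>. N A \<omega> = of_nat k \<and> N B \<omega> = 0) = (u * a) ^ k / fact k * exp (- u * (a + b))"
proof -
  \<comment> \<open>Independence in \<open>is_PPP\<close> concerns families indexed by natural
    numbers, hence the coding of the pair by 0 and 1.\<close>
  let ?F = "\<lambda>i :: nat. if i = 0 then A else B" and ?S = "\<lambda>i :: nat. if i = 0 then {of_nat k} else {0 :: ennreal}"
  have "\<Omega>.indep_vars (\<lambda>_. borel) (\<lambda>i \<omega>. N (?F i) \<omega>) {0, 1}"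
  proof -
    have all: "\<forall>I (F :: nat \<Rightarrow> _). finite I \<longrightarrow> F ` I \<subseteq> sets (scale_measure (ennreal u) \<nu>) \<longrightarrow> disjoint_family_on F I \<longrightarrow>
        \<Omega>.indep_vars (\<lambda>_. borel) (\<lambda>i \<omega>. count_pp (\<eta> \<omega>) (F i)) I"
      using ppp unfolding is_PPP_def by (elim conjE)
    show ?thesis
      by (rule all[rule_format]) (use A B disj in \<open>auto simp: disjoint_family_on_def\<close>)
  qed
  from \<Omega>.indep_varsD_finite[OF this, of ?S]
  have "\<Omega>.prob (\<Inter>i\<in>{0, 1}. (\<lambda>\<omega>. N (?F i) \<omega>) -` ?S i \<inter> space \<Omega>) =
     (\<Prod>i\<in>{0, 1}. \<Omega>.prob ((\<lambda>\<omega>. N (?F i) \<omega>) -` ?S i \<inter> space \<Omega>))" by auto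
  also have "(\<Inter>i\<in>{0, 1}. (\<lambda>\<omega>. N (?F i) \<omega>) -` ?S i \<inter> space \<Omega>) = {\<omega>\<in>space \<Omega>. N A \<omega> = of_nat k \<and> N B \<omega> = 0}" by auto
  also have "(\<Prod>i\<in>{0, 1}. \<Omega>.prob ((\<lambda>\<omega>. N (?F i) \<omega>) -` ?S i \<inter> space \<Omega>)) =
     \<P>(\<omega> in \<Omega>. N A \<omega> = of_nat k) * \<P>(\<omega> in \<Omega>. N B \<omega> = of_nat 0)"
    by (simp add: vimage_def Int_def conj_commute)
  also have "\<dots> = (u * a) ^ k / fact k * (exp (- (u * a)) * exp (- (u * b)))"
    unfolding poisson[OF A] poisson[OF B] by simp
  also have "exp (- (u * a)) * exp (- (u * b)) = exp (- u * (a + b))"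
    by (simp add: algebra_simps flip: exp_add)
  finally show ?thesis .
qed

text \<open>The Poisson weights add up to 1, leaving no mass for an infinite count.\<close>

lemma AE_N_finite:
  assumes A: "A \<in> sets \<nu>" "emeasure \<nu> A = ennreal a" "a \<ge> 0"
  shows "AE \<omega> in \<Omega>. \<exists>k. N A \<omega> = of_nat k"
proof -
  let ?E = "\<lambda>k :: nat. {\<omega>\<in>space \<Omega>. N A \<omega> = of_nat k}"
  have "(\<lambda>k. \<Omega>.prob (?E k)) sums \<Omega>.prob (\<Union>k. ?E k)"
    by (rule \<Omega>.finite_measure_UNION) (use N_sets[OF A(1)] in \<open>auto simp: disjoint_family_on_def\<close>)
  moreover have "(\<lambda>k. \<Omega>.prob (?E k)) sums (exp (u * a) * exp (- (u * a)))"
    unfolding poisson[OF A] using sums_mult2[OF exp_converges[of "u * a"], of "exp (- (u * a))"]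
    by (simp add: field_simps)
  ultimately have "\<Omega>.prob (\<Union>k. ?E k) = exp (u * a) * exp (- (u * a))" by (rule sums_unique2)
  then have "\<Omega>.prob (\<Union>k. ?E k) = 1" by (simp flip: exp_add)
  then have "AE \<omega> in \<Omega>. \<omega> \<in> (\<Union>k. ?E k)" by (rule \<Omega>.AE_prob_1)
  then show ?thesis by eventually_elim auto
qed

definition S :: "'w \<Rightarrow> 'v \<times> 'v \<Rightarrow> bool" where
  "S \<omega> = (\<lambda>(a, b). {a, b} \<in> interlacement_edges (\<eta> \<omega>))"

lemma S_eq: "S \<omega> (a, b) \<longleftrightarrow> (\<exists>c. \<eta> \<omega> c > 0 \<and> (\<exists>w\<in>c. \<exists>k. {a, b} = {w k, w (k + 1)}))"
  by (auto simp: S_def interlacement_edges_def)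

text \<open>Avoidance events of the edge set are void events of the Poisson process; this yields
  both the measurability of \<open>S\<close> and its law.\<close>

lemma N_link_eq_0:
  assumes \<omega>: "\<omega> \<in> space \<Omega>" shows "N (link E L) \<omega> = 0 \<longleftrightarrow> S \<omega> \<in> closed_on L"
proof -
  have "S \<omega> \<notin> closed_on L \<longleftrightarrow> (\<exists>a b. (a, b) \<in> L \<and> S \<omega> (a, b))" by (auto simp: closed_on_def)
  also have "\<dots> \<longleftrightarrow> (\<exists>c. \<eta> \<omega> c > 0 \<and> (\<exists>w\<in>c. w \<in> traversing L))"
    unfolding S_eq traversing_def unlinked_def by (auto simp: doubleton_eq_iff) blast+
  also have "\<dots> \<longleftrightarrow> (\<exists>c\<in>link E L. \<eta> \<omega> c > 0)"
    using support[OF \<omega>] by (auto simp: link_def classes_def)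
  also have "\<dots> \<longleftrightarrow> N (link E L) \<omega> \<noteq> 0" by (auto simp: count_pp_eq_0)
  finally show ?thesis by blast
qed

lemma measurable_S: "S \<in> \<Omega> \<rightarrow>\<^sub>M conf_M"
proof (rule measurable_into_conf)
  fix e :: "'v \<times> 'v"
  have "{\<omega>\<in>space \<Omega>. S \<omega> e} = space \<Omega> - {\<omega>\<in>space \<Omega>. N (link E {e}) \<omega> = 0}"
    using N_link_eq_0[of _ "{e}"] by (auto simp: closed_on_def)
  also have "\<dots> \<in> sets \<Omega>" by (intro sets.compl_sets N_sets link_sets)
  finally show "Measurable.pred \<Omega> (\<lambda>\<omega>. S \<omega> e)" by (simp add: pred_def)
qed

definition \<mu> :: "('v \<times> 'v \<Rightarrow> bool) measure" where "\<mu> = distr \<Omega> conf_M S"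

lemma sets_mu': "sets \<mu> = sets conf_M" and space_mu': "space \<mu> = UNIV"
  by (auto simp: \<mu>_def)

sublocale \<mu>: prob_space \<mu>
  unfolding \<mu>_def by (rule \<Omega>.prob_space_distr[OF measurable_S])

lemma prob_closed_on:
  assumes L: "finite L" shows "\<mu>.prob (closed_on L) = exp (- u * \<tau> L)"
proof -
  have "\<mu>.prob (closed_on L) = \<P>(\<omega> in \<Omega>. N (link E L) \<omega> = of_nat 0)"
    unfolding \<mu>_def using N_link_eq_0
    by (subst measure_distr[OF measurable_S closed_on_sets[OF L]]) (auto intro!: arg_cong[where f="\<Omega>.prob"])
  also have "\<dots> = exp (- u * \<tau> L)" unfolding poisson[OF link_sets nu_link[OF L] \<tau>_nonneg] by simp
  finally show ?thesis .
qed

lemma pull_closed_on: "pull f -` closed_on L = closed_on (map_prod f f ` L)"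
  by (auto simp: closed_on_def pull_def)

lemma measurable_pull_mu: "pull f \<in> \<mu> \<rightarrow>\<^sub>M conf_M"
  using measurable_pull measurable_cong_sets[OF sets_mu' refl] by blast

text \<open>Avoidance probabilities depend on \<open>L\<close> through \<open>\<tau>\<close> alone,
  which is invariant, and they determine the law.\<close>

lemma mu_invariant:
  assumes f: "automorphism E f" shows "distr \<mu> conf_M (pull f) = \<mu>"
proof (rule conf_measure_eqI)
  show "finite_measure (distr \<mu> conf_M (pull f))"
    using \<mu>.prob_space_distr[OF measurable_pull_mu] by (rule prob_space.finite_measure)
  fix L :: "('v \<times> 'v) set" assume L: "finite L"
  have "emeasure (distr \<mu> conf_M (pull f)) (closed_on L) = emeasure \<mu> (closed_on (map_prod f f ` L))"
    by (subst emeasure_distr[OF measurable_pull_mu closed_on_sets[OF L]]) (simp add: pull_closed_on space_mu')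
  also have "\<dots> = emeasure \<mu> (closed_on L)"
    using L by (simp add: \<mu>.emeasure_eq_measure prob_closed_on \<tau>_automorphism[OF f])
  finally show "emeasure (distr \<mu> conf_M (pull f)) (closed_on L) = emeasure \<mu> (closed_on L)" .
qed (simp_all add: sets_mu')

section \<open>Mixing and the zero-one law\<close>

definition far :: "nat \<Rightarrow> 'v \<Rightarrow> 'v" where
  "far n = (SOME f. automorphism E f \<and> (\<forall>x\<in>gball E n undefined. \<forall>v\<in>gball E n undefined. f v \<notin> gball E n x))"

lemma far: "automorphism E (far n)"
  "x \<in> gball E n undefined \<Longrightarrow> v \<in> gball E n undefined \<Longrightarrow> far n v \<notin> gball E n x"
  using someI_ex[OF ex_escaping_automorphism[of n undefined]] unfolding far_def[symmetric] by blast+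

lemma overlap_tendsto_0:
  assumes L: "finite L" "finite L'"
  shows "(\<lambda>n. measure \<nu> (link E L \<inter> link E (map_prod (far n) (far n) ` L'))) \<longlonglongrightarrow> 0"
proof (rule LIMSEQ_I)
  fix r :: real assume r: "r > 0"
  let ?K = "endpoints L" and ?K' = "endpoints L'"
  define C where "C = 2 * real (d * card ?K * card ?K')"
  \<comment> \<open>\<open>nu_overlap_le\<close> will give the bound \<open>C * \<epsilon>\<close>;
    the added 1 makes it strictly less than \<open>r\<close> and covers the case
    \<open>C = 0\<close>.\<close>
  define \<epsilon> where "\<epsilon> = r / (C + 1)"
  have C: "C \<ge> 0" by (simp add: C_def)
  have e: "\<epsilon> > 0" using r C by (simp add: \<epsilon>_def)
  obtain R where R: "\<And>x y. y \<notin> gball E R x \<Longrightarrow> P x {\<omega>. \<exists>n. \<omega> n = y} \<le> \<epsilon>" using hit_small[OF e] by blast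
  have K: "finite (?K \<union> ?K')" using L by (simp add: endpoints_def)
  have "\<forall>v. \<exists>r. v \<in> gball E r undefined" using ex_gball by blast
  then obtain \<rho> where \<rho>: "\<And>v. v \<in> gball E (\<rho> v) undefined" using choice[of "\<lambda>v r. v \<in> gball E r undefined"] by blast
  \<comment> \<open>From \<open>n0\<close> on, the ball of radius \<open>n\<close> about the base
    vertex contains all endpoints, and \<open>n\<close> is at least the radius \<open>R\<close>
    beyond which hitting is unlikely.\<close>
  define n0 where "n0 = R + (\<Sum>v\<in>?K \<union> ?K'. \<rho> v)"
  have "norm (measure \<nu> (link E L \<inter> link E (map_prod (far n) (far n) ` L')) - 0) < r" if n: "n \<ge> n0" for n
  proof -
    let ?L = "map_prod (far n) (far n) ` L'"
    have e': "endpoints ?L = far n ` ?K'" by (force simp: endpoints_def)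
    have ball: "v \<in> gball E n undefined" if "v \<in> ?K \<union> ?K'" for v
    proof -
      have "\<rho> v \<le> (\<Sum>v\<in>?K \<union> ?K'. \<rho> v)" by (rule member_le_sum) (use that K in auto)
      then have "\<rho> v \<le> n" using n by (simp add: n0_def)
      then show ?thesis using \<rho>[of v] gball_mono by blast
    qed
    have "P x {\<omega>. \<exists>n. \<omega> n = v} \<le> \<epsilon>" if x: "x \<in> ?K" and v: "v \<in> endpoints ?L" for x v
    proof -
      obtain v' where "v' \<in> ?K'" "v = far n v'" using v e' by auto
      then have "v \<notin> gball E n x" using far(2)[OF ball ball, of x v'] x by auto
      moreover have "R \<le> n" using n by (simp add: n0_def)
      ultimately show ?thesis using R gball_mono[of R n x] by blast
    qed
    then have "emeasure \<nu> (link E L \<inter> link E ?L) \<le> ennreal (2 * (d * card ?K * card (endpoints ?L)) * \<epsilon>)"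
      using L e by (intro nu_overlap_le) auto
    also have "\<dots> \<le> ennreal (C * \<epsilon>)"
    proof (rule ennreal_leI)
      have "card (endpoints ?L) \<le> card ?K'" unfolding e' using K by (intro card_image_le) auto
      then have "d * card ?K * card (endpoints ?L) \<le> d * card ?K * card ?K'" by (rule mult_left_mono) simp
      then have "real (d * card ?K * card (endpoints ?L)) \<le> real (d * card ?K * card ?K')" by (rule of_nat_mono)
      then show "2 * (d * card ?K * card (endpoints ?L)) * \<epsilon> \<le> C * \<epsilon>"
        unfolding C_def using e by (intro mult_right_mono mult_left_mono) auto
    qed
    finally have "measure \<nu> (link E L \<inter> link E ?L) \<le> C * \<epsilon>" using C e by (simp add: measure_def enn2real_leI)
    also have "\<dots> < r" using r C by (simp add: \<epsilon>_def field_simps)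
    finally show ?thesis by simp
  qed
  then show "\<exists>n0. \<forall>n\<ge>n0. norm (measure \<nu> (link E L \<inter> link E (map_prod (far n) (far n) ` L')) - 0) < r" by blast
qed

lemma link_Un: "link E (L \<union> L') = link E L \<union> link E L'"
  by (auto simp: link_def classes_def traversing_def unlinked_def)

text \<open>By inclusion-exclusion, \<open>\<tau>\<close> of the union is a sum minus an overlap
  that tends to 0, and the exponential turns the sum into a product.\<close>

lemma mixing_closed_on:
  assumes L: "finite L" "finite L'"
  shows "(\<lambda>n. \<mu>.prob (closed_on L \<inter> pull (far n) -` closed_on L')) \<longlonglongrightarrow> \<mu>.prob (closed_on L') * \<mu>.prob (closed_on L)"
proof -
  have eq: "\<mu>.prob (closed_on L \<inter> pull (far n) -` closed_on L') =
     exp (- u * (\<tau> L + \<tau> L' - measure \<nu> (link E L \<inter> link E (map_prod (far n) (far n) ` L'))))" for n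
  proof -
    let ?L = "map_prod (far n) (far n) ` L'"
    have finL: "finite ?L" using L by simp
    have fin: "link E L \<in> fmeasurable \<nu>" "link E ?L \<in> fmeasurable \<nu>"
      by (auto intro!: fmeasurableI link_sets simp: nu_link L finL)
    have m: "measure \<nu> (link E L) = \<tau> L" if "finite L" for L
      using nu_link[OF that] \<tau>_nonneg by (simp add: measure_def)
    have "measure \<nu> (link E (L \<union> ?L)) = measure \<nu> (link E L) + measure \<nu> (link E ?L) - measure \<nu> (link E L \<inter> link E ?L)"
      unfolding link_Un using measure_Un3[OF fin] by simp
    then have "\<tau> (L \<union> ?L) = \<tau> L + \<tau> L' - measure \<nu> (link E L \<inter> link E ?L)"
      using L finL by (simp add: m \<tau>_automorphism[OF far(1)])
    moreover have "closed_on L \<inter> pull (far n) -` closed_on L' = closed_on (L \<union> ?L)"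
      unfolding pull_closed_on by (auto simp: closed_on_def)
    ultimately show ?thesis using prob_closed_on[of "L \<union> ?L"] L by simp
  qed
  have "(\<lambda>n. exp (- u * (\<tau> L + \<tau> L' - measure \<nu> (link E L \<inter> link E (map_prod (far n) (far n) ` L'))))) \<longlonglongrightarrow>
      exp (- u * (\<tau> L + \<tau> L' - 0))"
    by (intro tendsto_intros overlap_tendsto_0 L)
  also have "exp (- u * (\<tau> L + \<tau> L' - 0)) = \<mu>.prob (closed_on L') * \<mu>.prob (closed_on L)"
    using L by (simp add: prob_closed_on algebra_simps flip: exp_add)
  finally show ?thesis unfolding eq .
qed

lemma pull_sets: "B \<in> sets \<mu> \<Longrightarrow> pull f -` B \<in> sets \<mu>"
  using measurable_sets[OF measurable_pull_mu[of f], of B] by (simp add: sets_mu' space_mu')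

lemma prob_pull: "automorphism E f \<Longrightarrow> B \<in> sets \<mu> \<Longrightarrow> \<mu>.prob (pull f -` B) = \<mu>.prob B"
  using measure_distr[OF measurable_pull_mu[of f], of B] by (simp add: mu_invariant sets_mu' space_mu')

lemma UNIV_closed_on: "UNIV \<in> {closed_on L | L. finite L}"
  by (auto simp: closed_on_def intro!: exI[of _ "{}"])

lemma sets_mu_closed_on: "sets \<mu> = sigma_sets UNIV {closed_on L | L. finite L}"
  using sets_mu' sets_conf_M_closed_on by simp

text \<open>Avoidance events are replaced by general events one factor at a time. The measures to be
  dominated by \<open>\<mu>\<close> are restrictions of \<open>\<mu>\<close> in the first round, and
  are dominated thanks to invariance in the second.\<close>

lemma mixing:
  assumes A: "A \<in> sets \<mu>" and B: "B \<in> sets \<mu>"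
  shows "(\<lambda>n. \<mu>.prob (A \<inter> pull (far n) -` B)) \<longlonglongrightarrow> \<mu>.prob A * \<mu>.prob B"
proof -
  have 1: "(\<lambda>n. \<mu>.prob (A \<inter> pull (far n) -` closed_on L)) \<longlonglongrightarrow> \<mu>.prob A * \<mu>.prob (closed_on L)" if L: "finite L" for L
  proof -
    let ?C = "\<lambda>n. pull (far n) -` closed_on L"
    let ?M = "\<lambda>n. distr (density \<mu> (indicator (?C n))) \<mu> (\<lambda>s. s)"
    have C: "?C n \<in> sets \<mu>" for n by (rule pull_sets) (simp add: closed_on_sets L sets_mu')
    have em: "emeasure (?M n) b = emeasure \<mu> (?C n \<inter> b)" if "b \<in> sets \<mu>" for n b
      using emeasure_distr_density_indicator[OF C[of n] measurable_ident_sets[OF refl] that] by simp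
    have m: "measure (?M n) b = \<mu>.prob (b \<inter> ?C n)" if "b \<in> sets \<mu>" for n b
      using em[OF that] by (simp add: measure_def Int_commute)
    have "(\<lambda>n. measure (?M n) A) \<longlonglongrightarrow> \<mu>.prob (closed_on L) * \<mu>.prob A"
    proof (rule dominated_limit_measures[OF Int_stable_closed_on UNIV_closed_on sets_mu_closed_on space_mu'])
      show "finite_measure (?M n)" for n
      proof (rule finite_measureI)
        have "space (?M n) = space \<mu>" by simp
        then show "emeasure (?M n) (space (?M n)) \<noteq> \<infinity>" using em[OF sets.top, of n] by simp
      qed
      show "measure (?M n) b \<le> \<mu>.prob b" if "b \<in> sets \<mu>" for n b
        unfolding m[OF that] using that by (intro \<mu>.finite_measure_mono) auto
      fix b assume "b \<in> {closed_on L :: ('v \<times> 'v \<Rightarrow> bool) set | L. finite L}"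
      then obtain L' where L': "b = closed_on L'" "finite L'" by blast
      then have b: "b \<in> sets \<mu>" by (simp add: closed_on_sets sets_mu')
      show "(\<lambda>n. measure (?M n) b) \<longlonglongrightarrow> \<mu>.prob (closed_on L) * \<mu>.prob b"
        unfolding m[OF b] unfolding L'(1) by (rule mixing_closed_on[OF L'(2) L])
    qed (use A \<mu>.finite_measure_axioms in auto)
    then show ?thesis unfolding m[OF A] by (simp add: mult.commute)
  qed
  let ?M = "\<lambda>n. distr (density \<mu> (indicator A)) conf_M (pull (far n))"
  have em: "emeasure (?M n) b = emeasure \<mu> (A \<inter> pull (far n) -` b)" if "b \<in> sets \<mu>" for n b
    using emeasure_distr_density_indicator[OF A measurable_pull_mu[of "far n"], of b] that by (simp add: sets_mu')
  have m: "measure (?M n) b = \<mu>.prob (A \<inter> pull (far n) -` b)" if "b \<in> sets \<mu>" for n b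
    using em[OF that] by (simp add: measure_def)
  have "(\<lambda>n. measure (?M n) B) \<longlonglongrightarrow> \<mu>.prob A * \<mu>.prob B"
  proof (rule dominated_limit_measures[OF Int_stable_closed_on UNIV_closed_on sets_mu_closed_on space_mu'])
    show "finite_measure (?M n)" for n
    proof (rule finite_measureI)
      have "space (?M n) = space \<mu>" by (simp add: space_mu')
      then show "emeasure (?M n) (space (?M n)) \<noteq> \<infinity>" using em[OF sets.top, of n] by simp
    qed
    show "measure (?M n) b \<le> \<mu>.prob b" if "b \<in> sets \<mu>" for n b
    proof -
      have "\<mu>.prob (A \<inter> pull (far n) -` b) \<le> \<mu>.prob (pull (far n) -` b)"
        using pull_sets[OF that] by (intro \<mu>.finite_measure_mono) auto
      then show ?thesis unfolding m[OF that] prob_pull[OF far(1) that] .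
    qed
    fix b assume "b \<in> {closed_on L :: ('v \<times> 'v \<Rightarrow> bool) set | L. finite L}"
    then obtain L where L: "b = closed_on L" "finite L" by blast
    then have b: "b \<in> sets \<mu>" by (simp add: closed_on_sets sets_mu')
    show "(\<lambda>n. measure (?M n) b) \<longlonglongrightarrow> \<mu>.prob A * \<mu>.prob b"
      unfolding m[OF b] unfolding L(1) by (rule 1[OF L(2)])
  qed (use B \<mu>.finite_measure_axioms in \<open>auto simp: sets_mu'\<close>)
  then show ?thesis unfolding m[OF B] .
qed

text \<open>For an invariant event the mixing limit concerns a constant sequence and reads p = p *
  p.\<close>

lemma mu_ergodic:
  assumes A: "A \<in> sets conf_M" and inv: "\<And>f. automorphism E f \<Longrightarrow> pull f -` A = A"
  shows "\<mu>.prob A = 0 \<or> \<mu>.prob A = 1"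
proof -
  have "(\<lambda>n. \<mu>.prob (A \<inter> pull (far n) -` A)) \<longlonglongrightarrow> \<mu>.prob A * \<mu>.prob A" using A by (intro mixing) (simp_all add: sets_mu')
  then have "(\<lambda>n :: nat. \<mu>.prob A) \<longlonglongrightarrow> \<mu>.prob A * \<mu>.prob A" by (simp add: inv[OF far(1)])
  then have "\<mu>.prob A = \<mu>.prob A * \<mu>.prob A" by (simp add: LIMSEQ_const_iff)
  then show ?thesis by simp
qed

end

section \<open>Insertion tolerance\<close>

context interlacement_process begin

lemma measurable_open_edges: "open_edges L \<in> conf_M \<rightarrow>\<^sub>M conf_M"
  by (rule measurable_into_conf) (auto simp: open_edges_def intro!: pred_intros_logic measurable_conf_coord)

lemma open_edge_closed_on: "open_edges {(x, y), (y, x)} s \<in> closed_on L \<longleftrightarrow> s \<in> closed_on L \<and> unlinked L x y"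
  by (auto simp: open_edges_def closed_on_def unlinked_def)

lemma N_pair_sets:
  "A \<in> sets \<nu> \<Longrightarrow> B \<in> sets \<nu> \<Longrightarrow> {\<omega>\<in>space \<Omega>. N A \<omega> = a \<and> N B \<omega> = b} \<in> sets \<Omega>"
  using sets.Int[OF N_sets[of A a] N_sets[of B b]] by (simp add: Int_def conj_ac)

lemma N_Diff_null:
  assumes "N B \<omega> = 0" shows "N (A - B) \<omega> = N A \<omega>"
  by (rule count_pp_cong) (use assms in \<open>auto simp: count_pp_eq_0\<close>)

lemma prob_through_closed:
  fixes x :: 'v and k :: nat
  assumes L: "finite L"
  defines "k0 \<equiv> \<kappa> {x} (avoiding L) (avoiding L)"
  shows "\<P>(\<omega> in \<Omega>. N (through E x) \<omega> = of_nat k \<and> S \<omega> \<in> closed_on L) =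
    (u * k0) ^ k / fact k * exp (- u * (k0 + \<tau> L))"
proof -
  have "{\<omega>\<in>space \<Omega>. N (through E x) \<omega> = of_nat k \<and> S \<omega> \<in> closed_on L} =
     {\<omega>\<in>space \<Omega>. N (through E x - link E L) \<omega> = of_nat k \<and> N (link E L) \<omega> = 0}"
    using N_link_eq_0[of _ L] N_Diff_null[where A="through E x" and B="link E L"] by auto
  moreover have "\<P>(\<omega> in \<Omega>. N (through E x - link E L) \<omega> = of_nat k \<and> N (link E L) \<omega> = 0) =
      (u * k0) ^ k / fact k * exp (- u * (k0 + \<tau> L))" unfolding k0_def
    by (rule poisson_pair[OF sets.Diff[OF through_sets link_sets] nu_through_avoid \<kappa>_nonneg link_sets nu_link[OF L] \<tau>_nonneg])
      auto
  ultimately show ?thesis by simp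
qed

text \<open>The disjoint sets \<open>?Y\<close> and \<open>?Z\<close> have the same union as the two
  sets of \<open>prob_through_closed\<close>. The exponent is therefore the same, and only the base
  of the power changes, from \<open>k0\<close> to \<open>k1\<close>.\<close>

lemma prob_loop_closed:
  fixes x y :: 'v and k :: nat
  assumes L: "finite L" and xy: "E x y"
  defines "k0 \<equiv> \<kappa> {x} (avoiding L) (avoiding L)"
  defines "k1 \<equiv> if unlinked L x y then k0 / d ^ 2 else 0"
  shows "\<P>(\<omega> in \<Omega>. N (loop_through E x y) \<omega> = of_nat k \<and> N (through E x - loop_through E x y) \<omega> = 0 \<and> S \<omega> \<in> closed_on L) =
    (u * k1) ^ k / fact k * exp (- u * (k0 + \<tau> L))"
proof -
  let ?D = "through E x" and ?D1 = "loop_through E x y" and ?W = "link E L"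
  let ?Y = "?D1 - ?W" and ?Z = "(?D - ?D1) \<union> ?W"
  have Y: "?Y \<in> sets \<nu>" and Z: "?Z \<in> sets \<nu>"
    by (auto intro!: sets.Diff sets.Un through_sets loop_through_sets link_sets)
  have k0: "k0 \<ge> 0" and k1: "k1 \<ge> 0" using \<kappa>_nonneg by (auto simp: k0_def k1_def)
  have nuY: "emeasure \<nu> ?Y = ennreal k1" unfolding k1_def k0_def by (rule nu_loop_avoid[OF xy])
  have "emeasure \<nu> ?Y + emeasure \<nu> ?Z = emeasure \<nu> (?Y \<union> ?Z)"
    by (rule plus_emeasure) (use Y Z in auto)
  also have "?Y \<union> ?Z = (?D - ?W) \<union> ?W" using loop_through_subset[of E x y] by blast
  also have "emeasure \<nu> \<dots> = emeasure \<nu> (?D - ?W) + emeasure \<nu> ?W"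
    by (rule plus_emeasure[symmetric]) (auto intro!: sets.Diff through_sets link_sets)
  also have "\<dots> = ennreal (k0 + \<tau> L)"
    unfolding nu_through_avoid nu_link[OF L] k0_def[symmetric] using k0 \<tau>_nonneg by simp
  finally have sum: "emeasure \<nu> ?Y + emeasure \<nu> ?Z = ennreal (k0 + \<tau> L)" .
  define z where "z = measure \<nu> ?Z"
  have "emeasure \<nu> ?Z \<noteq> \<infinity>"
    using sum by (metis ennreal_add_eq_top ennreal_neq_top infinity_ennreal_def)
  then have nuZ: "emeasure \<nu> ?Z = ennreal z" unfolding z_def by (rule emeasure_eq_ennreal_measure[unfolded infinity_ennreal_def[symmetric]])
  have z: "z \<ge> 0" by (simp add: z_def)
  have "ennreal (k1 + z) = ennreal (k0 + \<tau> L)" using sum k1 z unfolding nuY nuZ by simp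
  then have tot: "k1 + z = k0 + \<tau> L" using k0 k1 z \<tau>_nonneg[of L] by (simp add: ennreal_inj del: ennreal_plus)
  have "{\<omega>\<in>space \<Omega>. N ?D1 \<omega> = of_nat k \<and> N (?D - ?D1) \<omega> = 0 \<and> S \<omega> \<in> closed_on L} =
     {\<omega>\<in>space \<Omega>. N ?Y \<omega> = of_nat k \<and> N ?Z \<omega> = 0}"
  proof (rule Collect_cong, rule conj_cong[OF refl])
    fix \<omega> assume \<omega>: "\<omega> \<in> space \<Omega>"
    have 1: "N ?Z \<omega> = 0 \<longleftrightarrow> N (?D - ?D1) \<omega> = 0 \<and> N ?W \<omega> = 0" by (auto simp: count_pp_eq_0)
    show "(N ?D1 \<omega> = of_nat k \<and> N (?D - ?D1) \<omega> = 0 \<and> S \<omega> \<in> closed_on L) \<longleftrightarrow> (N ?Y \<omega> = of_nat k \<and> N ?Z \<omega> = 0)"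
      unfolding 1 N_link_eq_0[OF \<omega>, symmetric] using N_Diff_null[where A="?D1" and B="?W" and \<omega>=\<omega>] by auto
  qed
  moreover have "\<P>(\<omega> in \<Omega>. N ?Y \<omega> = of_nat k \<and> N ?Z \<omega> = 0) = (u * k1) ^ k / fact k * exp (- u * (k1 + z))"
    by (rule poisson_pair[OF Y nuY k1 Z nuZ z]) auto
  ultimately show ?thesis unfolding tot by simp
qed

text \<open>It suffices to compare avoidance probabilities. If xy is not in \<open>L\<close>, they
  differ by the \<open>k\<close>-th power of the ratio of the masses \<open>k0\<close> and
  \<open>k1\<close>, which is d^2 for every such \<open>L\<close>.\<close>

lemma insertion_law:
  assumes xy: "E x y" and k: "k > 0" and A: "A \<in> sets conf_M"
  shows "emeasure \<Omega> {\<omega>\<in>space \<Omega>. N (through E x) \<omega> = of_nat k \<and> open_edges {(x, y), (y, x)} (S \<omega>) \<in> A} =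
    ennreal (d ^ (2 * k)) * emeasure \<Omega> {\<omega>\<in>space \<Omega>. N (loop_through E x y) \<omega> = of_nat k \<and> N (through E x - loop_through E x y) \<omega> = 0 \<and> S \<omega> \<in> A}"
proof -
  let ?D = "through E x" and ?D1 = "loop_through E x y" and ?ins = "open_edges {(x, y), (y, x)}"
  let ?C1 = "{\<omega>\<in>space \<Omega>. N ?D \<omega> = of_nat k}" and ?C2 = "{\<omega>\<in>space \<Omega>. N ?D1 \<omega> = of_nat k \<and> N (?D - ?D1) \<omega> = 0}"
  define M1 where "M1 = distr (density \<Omega> (indicator ?C1)) conf_M (\<lambda>\<omega>. ?ins (S \<omega>))"
  define M2 where "M2 = scale_measure (ennreal (d ^ (2 * k))) (distr (density \<Omega> (indicator ?C2)) conf_M S)"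
  have C: "?C1 \<in> sets \<Omega>" "?C2 \<in> sets \<Omega>"
    by (intro N_sets N_pair_sets through_sets loop_through_sets sets.Diff)+
  have insS: "(\<lambda>\<omega>. ?ins (S \<omega>)) \<in> \<Omega> \<rightarrow>\<^sub>M conf_M"
    by (rule measurable_compose[OF measurable_S measurable_open_edges])
  have M1: "emeasure M1 A = emeasure \<Omega> {\<omega>\<in>space \<Omega>. N ?D \<omega> = of_nat k \<and> ?ins (S \<omega>) \<in> A}" if "A \<in> sets conf_M" for A
    unfolding M1_def emeasure_distr_density_indicator[OF C(1) insS that]
    by (rule arg_cong[where f="emeasure \<Omega>"]) auto
  have M2: "emeasure M2 A = ennreal (d ^ (2 * k)) * emeasure \<Omega> {\<omega>\<in>space \<Omega>. N ?D1 \<omega> = of_nat k \<and> N (?D - ?D1) \<omega> = 0 \<and> S \<omega> \<in> A}"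
    if "A \<in> sets conf_M" for A
  proof -
    have "?C2 \<inter> S -` A = {\<omega>\<in>space \<Omega>. N ?D1 \<omega> = of_nat k \<and> N (?D - ?D1) \<omega> = 0 \<and> S \<omega> \<in> A}" by auto
    then show ?thesis unfolding M2_def by (simp only: emeasure_scale_measure emeasure_distr_density_indicator[OF C(2) measurable_S that])
  qed
  have "M1 = M2"
  proof (rule conf_measure_eqI)
    show "sets M1 = sets conf_M" "sets M2 = sets conf_M" by (auto simp: M1_def M2_def)
    show "finite_measure M1"
    proof (rule finite_measureI)
      have U: "UNIV \<in> sets conf_M" using sets.top[of conf_M] by simp
      have "space M1 = UNIV" by (simp add: M1_def)
      then show "emeasure M1 (space M1) \<noteq> \<infinity>" using M1[OF U] by simp
    qed
    fix L :: "('v \<times> 'v) set" assume L: "finite L"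
    let ?k0 = "\<kappa> {x} (avoiding L) (avoiding L)"
    show "emeasure M1 (closed_on L) = emeasure M2 (closed_on L)"
    proof (cases "unlinked L x y")
      case True
      have eq: "real (d ^ (2 * k)) * ((u * (?k0 / real (d ^ 2))) ^ k / fact k * exp (- u * (?k0 + \<tau> L))) = (u * ?k0) ^ k / fact k * exp (- u * (?k0 + \<tau> L))"
      proof -
        have p: "real (d ^ (2 * k)) = real (d ^ 2) ^ k" by (simp add: power_mult)
        have "real (d ^ 2) ^ k * (u * (?k0 / real (d ^ 2))) ^ k = (real (d ^ 2) * (u * (?k0 / real (d ^ 2)))) ^ k"
          by (rule power_mult_distrib[symmetric])
        also have "real (d ^ 2) * (u * (?k0 / real (d ^ 2))) = u * ?k0" using d_pos by simp
        finally show ?thesis unfolding p by simp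
      qed
      have "\<P>(\<omega> in \<Omega>. N ?D \<omega> = of_nat k \<and> S \<omega> \<in> closed_on L) = real (d ^ (2 * k)) *
          \<P>(\<omega> in \<Omega>. N ?D1 \<omega> = of_nat k \<and> N (?D - ?D1) \<omega> = 0 \<and> S \<omega> \<in> closed_on L)"
        by (simp only: prob_through_closed[OF L] prob_loop_closed[OF L xy] True if_True eq)
      then show ?thesis
        unfolding M1[OF closed_on_sets[OF L]] M2[OF closed_on_sets[OF L]] open_edge_closed_on \<Omega>.emeasure_eq_measure
        using True by (simp only: ennreal_mult'[symmetric] of_nat_0_le_iff simp_thms)
    next
      \<comment> \<open>On the left the opened edge xy is in \<open>L\<close>. On the right a
        looping trajectory uses xy, so having \<open>k > 0\<close> of them while \<open>L\<close> is
        closed has probability 0.\<close>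
      case False
      then show ?thesis
        unfolding M1[OF closed_on_sets[OF L]] M2[OF closed_on_sets[OF L]] open_edge_closed_on \<Omega>.emeasure_eq_measure
        using prob_loop_closed[OF L xy, of k] k by simp
    qed
  qed
  then show ?thesis using M1[OF A] M2[OF A] by simp
qed

lemma touched_through:
  assumes \<omega>: "\<omega> \<in> space \<Omega>" and t: "touched (S \<omega>) x" shows "N (through E x) \<omega> \<noteq> 0"
proof -
  obtain z c w k where c: "\<eta> \<omega> c > 0" "w \<in> c" "{x, z} = {w k, w (k + 1)}" using t unfolding touched_def S_eq by blast
  then have "w \<in> hitting {x}" by (auto simp: hitting_def doubleton_eq_iff)
  then have "c \<in> through E x" using support[OF \<omega> c(1)] c(2) by (auto simp: through_def classes_def)
  then show ?thesis using c(1) by (auto simp: count_pp_eq_0)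
qed

text \<open>Split according to the number of trajectories through \<open>x\<close>, which is almost
  surely finite, and positive if \<open>x\<close> is touched. For each value
  \<open>insertion_law\<close> gives a multiple of the probability of a null event.\<close>

lemma insertion_null:
  assumes A: "A \<in> sets conf_M" "emeasure \<mu> A = 0" and xy: "E x y"
  shows "AE s in \<mu>. touched s x \<longrightarrow> open_edges {(x, y), (y, x)} s \<notin> A"
proof -
  let ?ins = "open_edges {(x, y), (y, x)}"
  have SA: "emeasure \<Omega> {\<omega>\<in>space \<Omega>. S \<omega> \<in> A} = 0"
    using A(2) unfolding \<mu>_def by (subst (asm) emeasure_distr[OF measurable_S A(1)]) (simp add: vimage_def Int_def conj_commute)
  have null: "AE \<omega> in \<Omega>. \<not> (N (through E x) \<omega> = of_nat k \<and> ?ins (S \<omega>) \<in> A)" if k: "k > 0" for k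
  proof (rule AE_I[of _ _ "{\<omega>\<in>space \<Omega>. N (through E x) \<omega> = of_nat k \<and> ?ins (S \<omega>) \<in> A}"])
    have "emeasure \<Omega> {\<omega>\<in>space \<Omega>. N (loop_through E x y) \<omega> = of_nat k \<and> N (through E x - loop_through E x y) \<omega> = 0 \<and> S \<omega> \<in> A}
       \<le> emeasure \<Omega> {\<omega>\<in>space \<Omega>. S \<omega> \<in> A}"
      by (rule emeasure_mono) (use measurable_sets[OF measurable_S A(1)] in \<open>auto simp: vimage_def Int_def conj_commute\<close>)
    then show "emeasure \<Omega> {\<omega>\<in>space \<Omega>. N (through E x) \<omega> = of_nat k \<and> ?ins (S \<omega>) \<in> A} = 0"
      unfolding insertion_law[OF xy k A(1)] using SA by simp
    have "{\<omega>\<in>space \<Omega>. N (through E x) \<omega> = of_nat k \<and> ?ins (S \<omega>) \<in> A} =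
       {\<omega>\<in>space \<Omega>. N (through E x) \<omega> = of_nat k} \<inter> ((\<lambda>\<omega>. ?ins (S \<omega>)) -` A \<inter> space \<Omega>)" by auto
    also have "\<dots> \<in> sets \<Omega>"
      by (intro sets.Int N_sets through_sets measurable_sets[OF measurable_compose[OF measurable_S measurable_open_edges] A(1)])
    finally show "{\<omega>\<in>space \<Omega>. N (through E x) \<omega> = of_nat k \<and> ?ins (S \<omega>) \<in> A} \<in> sets \<Omega>" .
  qed auto
  have "AE \<omega> in \<Omega>. \<forall>k>0. \<not> (N (through E x) \<omega> = of_nat k \<and> ?ins (S \<omega>) \<in> A)"
    unfolding AE_all_countable using null by (auto intro: AE_impI)
  moreover have "AE \<omega> in \<Omega>. \<exists>k. N (through E x) \<omega> = of_nat k"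
  proof (rule AE_N_finite[OF through_sets])
    \<comment> \<open>With empty \<open>L\<close>, \<open>nu_through_avoid\<close> becomes the
      finite mass of all trajectories through \<open>x\<close>.\<close>
    have "link E {} = {}" by (auto simp: link_def classes_def traversing_def unlinked_def)
    then show "emeasure \<nu> (through E x) = ennreal (\<kappa> {x} (avoiding {}) (avoiding {}))"
      using nu_through_avoid[of x "{}"] by simp
  qed (rule \<kappa>_nonneg)
  ultimately have "AE \<omega> in \<Omega>. touched (S \<omega>) x \<longrightarrow> ?ins (S \<omega>) \<notin> A" using AE_space[of \<Omega>]
  proof eventually_elim
    case (elim \<omega>)
    show ?case
    proof
      assume "touched (S \<omega>) x"
      from touched_through[OF elim(3) this] elim(1,2) show "?ins (S \<omega>) \<notin> A" by (metis gr0I of_nat_0)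
    qed
  qed
  then show ?thesis unfolding \<mu>_def
  proof (subst AE_distr_iff[OF measurable_S])
    have "Measurable.pred conf_M (\<lambda>s. touched s x \<longrightarrow> ?ins s \<notin> A)"
      by (intro pred_intros_logic pred_touched) (use measurable_sets[OF measurable_open_edges A(1)] in \<open>simp add: pred_def vimage_def\<close>)
    then show "{s \<in> space conf_M. touched s x \<longrightarrow> ?ins s \<notin> A} \<in> sets conf_M" by (simp add: pred_def)
  qed
qed

text \<open>The exceptions of an arbitrary predicate are enclosed in a measurable null set.\<close>

lemma mu_insertion:
  assumes Q: "AE s in \<mu>. Q s" and xy: "E x y"
  shows "AE s in \<mu>. touched s x \<longrightarrow> Q (open_edges {(x, y), (y, x)} s)"
proof -
  obtain A where A: "{s \<in> space \<mu>. \<not> Q s} \<subseteq> A" "emeasure \<mu> A = 0" "A \<in> sets \<mu>" using Q by (rule AE_E)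
  then have "AE s in \<mu>. touched s x \<longrightarrow> open_edges {(x, y), (y, x)} s \<notin> A"
    by (intro insertion_null[OF _ _ xy]) (auto simp: sets_mu')
  then show ?thesis by eventually_elim (use A(1) in \<open>auto simp: space_mu'\<close>)
qed

section \<open>From percolation back to the interlacement\<close>

lemma S_edges:
  assumes \<omega>: "\<omega> \<in> space \<Omega>" and s: "S \<omega> (a, b)" shows "S \<omega> (b, a) \<and> E a b"
proof
  show "S \<omega> (b, a)" using s by (simp add: S_def insert_commute)
  obtain c w k where c: "\<eta> \<omega> c > 0" "w \<in> c" "{a, b} = {w k, w (k + 1)}" using s unfolding S_eq by blast
  have "c \<in> Wstar E" using support[OF \<omega> c(1)] .
  then obtain w' l where w': "w' \<in> Wpaths E" "w = dshift l w'" using c(2) by (auto simp: Wstar_def pistar_eq)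
  have "E (w k) (w (k + 1))"
  proof -
    have "E (w' (k + l)) (w' (k + l + 1))" using w'(1) by (simp add: Wpaths_def)
    then show ?thesis by (simp add: w'(2) dshift_def algebra_simps)
  qed
  then show "E a b" using c(3) E_sym by (auto simp: doubleton_eq_iff)
qed

text \<open>A trajectory visits every vertex only finitely often, so it cannot remain in a finite
  cluster after its visit to \<open>a\<close>.\<close>

lemma S_infinite:
  assumes \<omega>: "\<omega> \<in> space \<Omega>" and t: "touched (S \<omega>) a" shows "infinite {v. (crel (S \<omega>))^** a v}"
proof
  assume fin: "finite {v. (crel (S \<omega>))^** a v}"
  obtain b c w k where c: "\<eta> \<omega> c > 0" "w \<in> c" "{a, b} = {w k, w (k + 1)}" using t unfolding touched_def S_eq by blast
  then obtain j where j: "w j = a" by (auto simp: doubleton_eq_iff)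
  have "c \<in> Wstar E" using support[OF \<omega> c(1)] .
  then obtain w' l where w': "w' \<in> Wpaths E" "w = dshift l w'" using c(2) by (auto simp: Wstar_def pistar_eq)
  have reach: "(crel (S \<omega>))^** a (w (j + int n))" for n
  proof (induction n)
    case (Suc n)
    have "S \<omega> (w (j + int n), w (j + int n + 1))" unfolding S_eq using c(1,2) by blast
    then have "crel (S \<omega>) (w (j + int n)) (w (j + int (Suc n)))" by (simp add: crel_def algebra_simps)
    with Suc show ?case by simp
  qed (simp add: j)
  have "range (\<lambda>n. j + int n) \<subseteq> (\<Union>v\<in>{v. (crel (S \<omega>))^** a v}. {m. w m = v})" using reach by blast
  moreover have "finite (\<Union>v\<in>{v. (crel (S \<omega>))^** a v}. {m. w m = v})"
  proof (rule finite_UN_I[OF fin])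
    fix v
    have "finite {m. w' m = v}" using w'(1) by (simp add: Wpaths_def)
    then have "finite ((\<lambda>m. m + l) -` {m. w' m = v})" by (rule finite_vimageI) (simp add: inj_def)
    then show "finite {m. w m = v}" by (simp add: w'(2) dshift_def vimage_def)
  qed
  ultimately have "finite (range (\<lambda>n. j + int n))" by (rule finite_subset)
  moreover have "inj (\<lambda>n. j + int n)" by (simp add: inj_def)
  ultimately show False using finite_imageD infinite_UNIV_nat by blast
qed

lemma AE_mu_iff:
  assumes "Measurable.pred conf_M Q" shows "(AE s in \<mu>. Q s) \<longleftrightarrow> (AE \<omega> in \<Omega>. Q (S \<omega>))"
  unfolding \<mu>_def using assms by (intro AE_distr_iff measurable_S) (simp add: pred_def)

lemma AE_S_connected:
  assumes "amenable E" shows "AE \<omega> in \<Omega>. conf_connected (S \<omega>)"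
proof -
  interpret invariant_percolation E \<mu>
  proof
    show "sets \<mu> = sets conf_M" by (rule sets_mu')
    have "Measurable.pred conf_M (\<lambda>s. \<forall>a b :: 'v. s (a, b) \<longrightarrow> s (b, a) \<and> E a b)"
      by (intro pred_all_V pred_intros_logic measurable_conf_coord) simp
    then show "AE s in \<mu>. \<forall>a b. s (a, b) \<longrightarrow> s (b, a) \<and> E a b"
      using S_edges by (auto simp: AE_mu_iff intro!: AE_I2)
    have "Measurable.pred conf_M (\<lambda>s. \<forall>a :: 'v. touched s a \<longrightarrow> infinite {v. (crel s)^** a v})"
      unfolding crel_def[abs_def]
      by (intro pred_all_V pred_intros_logic pred_touched pred_infinite pred_rtranclp measurable_conf_coord)
    then show "AE s in \<mu>. \<forall>a. touched s a \<longrightarrow> infinite {v. (crel s)^** a v}"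
      using S_infinite by (auto simp: AE_mu_iff intro!: AE_I2)
    show "distr \<mu> conf_M (pull f) = \<mu>" if "automorphism E f" for f by (rule mu_invariant[OF that])
    show "\<mu>.prob A = 0 \<or> \<mu>.prob A = 1"
      if "A \<in> sets conf_M" "\<And>f. automorphism E f \<Longrightarrow> pull f -` A = A" for A by (rule mu_ergodic[OF that])
    show "AE s in \<mu>. touched s x \<longrightarrow> Q (open_edges {(x, y), (y, x)} s)" if "AE s in \<mu>. Q s" "E x y" for Q x y
      by (rule mu_insertion[OF that])
  qed (rule assms)
  show ?thesis using AE_conf_connected AE_mu_iff[OF pred_conf_connected] by simp
qed

lemma conf_connected_edges:
  assumes "conf_connected (S \<omega>)" shows "edges_connected (interlacement_edges (\<eta> \<omega>))"
  unfolding edges_connected_def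
proof (intro ballI)
  let ?F = "interlacement_edges (\<eta> \<omega>)"
  have t: "touched (S \<omega>) x" if "x \<in> \<Union>?F" for x
  proof -
    from that obtain e where e: "e \<in> ?F" "x \<in> e" by blast
    then obtain w :: "int \<Rightarrow> 'v" and k where "e = {w k, w (k + 1)}" unfolding interlacement_edges_def by blast
    with e have "{x, w k} \<in> ?F \<or> {x, w (k + 1)} \<in> ?F" by (auto simp: insert_commute)
    then show ?thesis by (auto simp: touched_def S_def)
  qed
  fix x y assume "x \<in> \<Union>?F" "y \<in> \<Union>?F"
  then have "(crel (S \<omega>))^** x y" using assms t by (simp add: conf_connected_def)
  then show "(\<lambda>a b. {a, b} \<in> ?F)^** x y" by (simp add: crel_def[abs_def] S_def)
qed

text \<open>Every visited vertex is an endpoint of a traversed edge, and traversed edges belong to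
  the induced subgraph, so connecting paths carry over.\<close>

lemma edges_connected_induced:
  assumes \<omega>: "\<omega> \<in> space \<Omega>" and c: "edges_connected (interlacement_edges (\<eta> \<omega>))"
  shows "induced_connected E (interlacement (\<eta> \<omega>))"
  unfolding induced_connected_def
proof (intro ballI)
  let ?F = "interlacement_edges (\<eta> \<omega>)" and ?I = "interlacement (\<eta> \<omega>)"
  have I: "?I = \<Union>?F"
  proof
    show "?I \<subseteq> \<Union>?F" unfolding interlacement_def interlacement_edges_def by blast
    show "\<Union>?F \<subseteq> ?I" unfolding interlacement_def interlacement_edges_def by blast
  qed
  fix x y assume "x \<in> ?I" "y \<in> ?I"
  then have "(\<lambda>a b. {a, b} \<in> ?F)^** x y" using c unfolding I edges_connected_def by blast
  then show "(\<lambda>a b. E a b \<and> a \<in> ?I \<and> b \<in> ?I)^** x y"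
  proof (rule rtranclp_mono[THEN predicate2D, rotated], intro predicate2I conjI)
    fix a b assume ab: "{a, b} \<in> ?F"
    then show "E a b" using S_edges[OF \<omega>, of a b] by (simp add: S_def)
    show "a \<in> ?I" "b \<in> ?I" using ab I by auto
  qed
qed

end

theorem theorem3p3:
  fixes E :: "'v \<Rightarrow> 'v \<Rightarrow> bool"
    and \<nu> :: "(int \<Rightarrow> 'v) set measure"
    and P :: "'w measure"
    and \<eta> :: "'w \<Rightarrow> (int \<Rightarrow> 'v) set \<Rightarrow> nat"
    and u :: real
  assumes "simple_graph E"
    and "infinite (UNIV :: 'v set)"
    and "graph_connected E"
    and "locally_finite E"
    and "transient E"
    and "vertex_transitive E"
    and "amenable E"
    and "is_interlacement_intensity E \<nu>"
    and "u > 0"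
    and "is_PPP P (scale_measure (ennreal u) \<nu>) \<eta>"
  shows "(AE \<omega> in P. induced_connected E (interlacement (\<eta> \<omega>)))
       \<and> (AE \<omega> in P. edges_connected (interlacement_edges (\<eta> \<omega>)))"
proof -
  interpret interlacement_process E \<nu> P \<eta> u
    by unfold_locales (fact assms)+
  have edges: "AE \<omega> in P. edges_connected (interlacement_edges (\<eta> \<omega>))"
    using AE_S_connected[OF assms(7)] by eventually_elim (rule conf_connected_edges)
  moreover from edges AE_space have "AE \<omega> in P. induced_connected E (interlacement (\<eta> \<omega>))"
    by eventually_elim (rule edges_connected_induced)
  ultimately show ?thesis by blast
qed

end
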